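(* Let $a\in(0,\infty)$, $\beta\in(0,1)$, $1<p<q<\infty$ and $1/q=1/p-\beta$. Then there exists a positive constant $C$, depending on $a$, $p$ and $q$, such that the following hold for real-valued functions $b$. (i) If $b\in\mathrm{BMO}(\gamma)$ and $b^-\in L^\infty(\gamma)$, then for all $f\in L_c^\infty(\gamma)$, $$\|[b,\mathcal M_a^\beta](f)\|_{L^q(\gamma)}\le C\left(\|b\|_\ast+\|b^-\|_{L^\infty(\gamma)}\right)\|f\|_{L^p(\gamma)}.$$ (ii) If $b\in L^1(\gamma)$ and $[b,\mathcal M_a^\beta]$ is bounded from $L^p(\gamma)\cap L_c^\infty(\gamma)$ to $L^q(\gamma)$, then $b\in\mathrm{BMO}(\gamma)$, $b^-\in L^\infty(\gamma)$ and $$\|b\|_{\mathrm{BMO}(\gamma)}+\|b^-\|_{L^\infty(\gamma)}\le\|b\|_{L^1(\gamma)}+C\|[b,\mathcal M_a^\beta]\|_{L^p(\gamma)\to L^q(\gamma)},$$ where $$\|[b,\mathcal M_a^\beta]\|_{L^p(\gamma)\to L^q(\gamma)}=\sup\{\|[b,\mathcal M_a^\beta](f)\|_{L^q(\gamma)}:\ f\in L_c^\infty(\gamma),\ \|f\|_{L^p(\gamma)}=1\}.$$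
   Context: Fix $n\in\{1,2,\dots\}$; constants may depend on $n$. Let $d\gamma(x)=\pi^{-n/2}e^{-|x|^2}dx$ be the Gauss measure on $\mathbb R^n$, where $|\cdot|$ is the Euclidean norm. For a ball $B\subset\mathbb R^n$, $c_B$ and $r_B$ denote its center and radius. Let $m(x)=\min\{1,1/|x|\}$ for $x\in\mathbb R^n$ (with $m(0)=1$). For $a\in(0,\infty)$, $\mathcal B_a$ is the set of all balls $B\subset\mathbb R^n$ with $r_B\le a\,m(c_B)$, and $\mathcal B_a(x)$ is the collection of all balls in $\mathcal B_a$ containing $x$. For $b$ locally integrable and $B$ a ball, $b_B=\frac1{\gamma(B)}\int_B b\,d\gamma$. For $b\in L^1(\gamma)$ set $$\|b\|_\ast=\sup_{B\in\mathcal B_1}\frac1{\gamma(B)}\int_B|b(x)-b_B|\,d\gamma(x);$$ $\mathrm{BMO}(\gamma)$ is the set of $b\in L^1(\gamma)$ with $\|b\|_\ast<\infty$, with norm $\|b\|_{\mathrm{BMO}(\gamma)}=\|b\|_\ast+\|b\|_{L^1(\gamma)}$. For a real-valued function $b$, $b^-(x)=-\min\{0,b(x)\}$. $L_c^\infty(\gamma)$ is the set of functions in $L^\infty(\gamma)$ with compact support. For $a\in(0,\infty)$, $\beta\in(0,1)$ and $f$ locally integrable, the local fractional maximal operator is $$\mathcal M_a^\beta(f)(x)=\sup_{B\in\mathcal B_a(x)}\frac1{[\gamma(B)]^{1-\beta}}\int_B|f(y)|\,d\gamma(y),\qquad x\in\mathbb R^n.$$ For $b\in L^1(\gamma)$ (in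 particular $b\in\mathrm{BMO}(\gamma)$) and $f\in L_c^\infty(\gamma)$, the commutator is $$[b,\mathcal M_a^\beta](f)=b\,\mathcal M_a^\beta(f)-\mathcal M_a^\beta(bf).$$ It is bounded from $L^p(\gamma)\cap L_c^\infty(\gamma)$ to $L^q(\gamma)$ if there is a constant $C'\ge0$ such that $\|[b,\mathcal M_a^\beta](f)\|_{L^q(\gamma)}\le C'\|f\|_{L^p(\gamma)}$ for all $f\in L_c^\infty(\gamma)$. *)

theory Defs
  imports "HOL-Probability.Probability"
begin

text \<open>Gauss measure on the Lebesgue-measurable sets, so that ``measurable function'' below means
  Lebesgue measurable and not only Borel measurable.\<close>

definition gauss :: "'a::euclidean_space measure" where
  "gauss = density lebesgue
     (\<lambda>x. ennreal (pi powr (- real DIM('a) / 2) * exp (- (norm x)\<^sup>2)))"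

text \<open>The case distinction is needed because \<open>1 / 0 = 0\<close> in HOL.\<close>

definition admiss :: "'a::euclidean_space \<Rightarrow> real" where
  "admiss x = (if x = 0 then 1 else min 1 (1 / norm x))"

definition admissible_balls :: "real \<Rightarrow> 'a::euclidean_space set set" where
  "admissible_balls a = {ball c r | c r. 0 < r \<and> r \<le> a * admiss c}"

definition admissible_balls_at :: "real \<Rightarrow> 'a::euclidean_space \<Rightarrow> 'a set set" where
  "admissible_balls_at a x = {B \<in> admissible_balls a. x \<in> B}"

definition ennreal_powr :: "ennreal \<Rightarrow> real \<Rightarrow> ennreal" where
  "ennreal_powr x r = (if x = \<infinity> then \<infinity> else ennreal (enn2real x powr r))"

text \<open>Functions are extended-real valued here because a commutator may take the value \<open>-\<infinity>\<close> at some
  points; used only for \<open>1 \<le> p < \<infinity>\<close>.\<close>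

definition Lp_norm :: "real \<Rightarrow> ('a::euclidean_space \<Rightarrow> ereal) \<Rightarrow> ennreal" where
  "Lp_norm p g = ennreal_powr (\<integral>\<^sup>+x. ennreal_powr (e2ennreal \<bar>g x\<bar>) p \<partial>gauss) (1 / p)"

definition Linf_norm :: "('a::euclidean_space \<Rightarrow> real) \<Rightarrow> ennreal" where
  "Linf_norm f = esssup gauss (\<lambda>x. ennreal \<bar>f x\<bar>)"

definition Linf :: "('a::euclidean_space \<Rightarrow> real) set" where
  "Linf = {f \<in> borel_measurable gauss. Linf_norm f < \<infinity>}"

text \<open>Compactness of the support is understood up to null sets, so that the class is closed
  under almost-everywhere equality.\<close>

definition Linf_c :: "('a::euclidean_space \<Rightarrow> real) set" where
  "Linf_c = {f \<in> Linf. \<exists>K. compact K \<and> (AE x in gauss. x \<notin> K \<longrightarrow> f x = 0)}"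

definition ball_avg :: "('a::euclidean_space \<Rightarrow> real) \<Rightarrow> 'a set \<Rightarrow> real" where
  "ball_avg b B = (LINT x:B|gauss. b x) / measure gauss B"

definition bmo_seminorm :: "('a::euclidean_space \<Rightarrow> real) \<Rightarrow> ennreal" where
  "bmo_seminorm b =
     (SUP B\<in>admissible_balls 1.
        (\<integral>\<^sup>+x\<in>B. ennreal \<bar>b x - ball_avg b B\<bar> \<partial>gauss) / emeasure gauss B)"

definition BMO :: "('a::euclidean_space \<Rightarrow> real) set" where
  "BMO = {b. integrable gauss b \<and> bmo_seminorm b < \<infinity>}"

definition bmo_norm :: "('a::euclidean_space \<Rightarrow> real) \<Rightarrow> ennreal" where
  "bmo_norm b = bmo_seminorm b + Lp_norm 1 (\<lambda>x. ereal (b x))"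

definition neg_part :: "('a \<Rightarrow> real) \<Rightarrow> 'a \<Rightarrow> real" where
  "neg_part b x = - min 0 (b x)"

definition frac_max :: "real \<Rightarrow> real \<Rightarrow> ('a::euclidean_space \<Rightarrow> real) \<Rightarrow> 'a \<Rightarrow> ennreal" where
  "frac_max a \<beta> f x =
     (SUP B\<in>admissible_balls_at a x.
        (\<integral>\<^sup>+y\<in>B. ennreal \<bar>f y\<bar> \<partial>gauss) / ennreal_powr (emeasure gauss B) (1 - \<beta>))"

text \<open>For essentially bounded \<open>f\<close> the first term is finite, so no \<open>\<infinity> - \<infinity>\<close> occurs; the second term
  may be infinite at some points when \<open>b\<close> is merely integrable.\<close>

definition commutator ::
    "('a::euclidean_space \<Rightarrow> real) \<Rightarrow> real \<Rightarrow> real \<Rightarrow> ('a \<Rightarrow> real) \<Rightarrow> 'a \<Rightarrow> ereal" where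
  "commutator b a \<beta> f x =
     ereal (b x) * enn2ereal (frac_max a \<beta> f x) - enn2ereal (frac_max a \<beta> (\<lambda>y. b y * f y) x)"

definition commutator_bounded ::
    "('a::euclidean_space \<Rightarrow> real) \<Rightarrow> real \<Rightarrow> real \<Rightarrow> real \<Rightarrow> real \<Rightarrow> bool" where
  "commutator_bounded b a \<beta> p q \<longleftrightarrow>
     (\<exists>C'\<ge>0. \<forall>f\<in>Linf_c.
        Lp_norm q (commutator b a \<beta> f) \<le> ennreal C' * Lp_norm p (\<lambda>x. ereal (f x)))"

definition commutator_opnorm ::
    "('a::euclidean_space \<Rightarrow> real) \<Rightarrow> real \<Rightarrow> real \<Rightarrow> real \<Rightarrow> real \<Rightarrow> ennreal" where
  "commutator_opnorm b a \<beta> p q =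
     (SUP f\<in>{f \<in> Linf_c. Lp_norm p (\<lambda>x. ereal (f x)) = 1}. Lp_norm q (commutator b a \<beta> f))"

end

theory Submission
  imports Defs
begin

text \<open>
  On admissible balls the density of \<open>\<gamma>\<close> is comparable to a constant, so \<open>\<gamma>\<close> is doubling there and Vitali's
  covering lemma yields the Hardy--Littlewood and, by Hedberg's pointwise inequality, the fractional
  maximal inequality, as well as the John--Nirenberg inequality in \<open>L\<^sup>s\<close> form.

  For (i), up to \<open>2 b\<^sup>- \<M>(f)\<close> the commutator is at most the supremum over \<open>B \<ni> x\<close> of
  \<open>\<gamma>(B)\<^sup>\<beta>\<^sup>-\<^sup>1 \<integral>\<^sub>B |b(x) - b(y)||f(y)| d\<gamma>(y)\<close>. The part with \<open>b(y) - b\<^sub>B\<close> is absorbed by Hoelder and John--Nirenberg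
  into a fractional maximal function of \<open>|f|\<^sup>s\<close>. For the part with \<open>b(x) - b\<^sub>B\<close> one selects, for every
  \<open>k \<in> \<int>\<close>, disjoint balls \<open>B\<^sub>i\<close> whose fractional averages exceed \<open>2\<^sup>k\<close> and whose dilates \<open>B\<^sub>i\<^sup>*\<close> cover all such balls;
  on \<open>B\<^sub>i\<^sup>*\<close> the factor \<open>|b(x) - b\<^sub>B|\<close> is bounded by \<open>|b - b\<^sub>B\<^sub>*|\<close> plus the maximal function of its restriction,
  and summation over \<open>i\<close> and \<open>k\<close> gives \<open>\<parallel>\<M>(f)\<parallel>\<^sub>q\<close>.

  For (ii), testing on \<open>1\<^sub>B\<close> gives \<open>\<gamma>(B)\<^sup>-\<^sup>1 \<integral>\<^sub>B (|b|\<^sub>B - b)\<^sup>+ d\<gamma> \<le> 2 \<parallel>[b, \<M>]\<parallel>\<close>, which controls the oscillation of \<open>b\<close> as well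
  as the averages of \<open>b\<^sup>-\<close>.
\<close>

section \<open>Powers of extended nonnegative reals\<close>

text \<open>The family of admissible balls is not stable: a dilate of a ball, or a ball of the same
  radius about another of its points, satisfies the radius condition only with a larger parameter.
  Every estimate therefore carries a parameter \<open>A\<close>, and \<open>bmo_le_enlarge\<close>
  transfers oscillation bounds between parameters: (i) passes from \<open>1\<close> to multiples of
  \<open>a\<close>, (ii) from \<open>a\<close> to \<open>1\<close>. For the same reason the
  John--Nirenberg iteration has to keep its dilated stopping balls inside the family for which the
  current bound is available.

  The other obstacle is \<open>\<bar>b x - ball_avg b B\<bar>\<close>, where \<open>x\<close> is
  fixed while \<open>B\<close> runs through all balls containing it: an estimate on a single ball
  says nothing about the supremum. Sorting the balls by the dyadic size of their fractional averages
  replaces the uncountable supremum by a countable sum, which is also a measurable majorant.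

  Quantities stay in \<open>ennreal\<close> as long as possible, since the maximal function of
  \<open>b * f\<close> can be infinite and sums and integrals of nonnegative functions can be
  interchanged without integrability.\<close>

lemma ennreal_powr_ennreal: "0 \<le> x \<Longrightarrow> ennreal_powr (ennreal x) r = ennreal (x powr r)"
  by (simp add: ennreal_powr_def)

lemma ennreal_powr_top [simp]: "ennreal_powr \<infinity> r = \<infinity>" "ennreal_powr top r = top"
  by (simp_all add: ennreal_powr_def)

lemma ennreal_powr_0 [simp]: "ennreal_powr 0 r = 0"
  by (simp add: ennreal_powr_def)

lemma ennreal_powr_one [simp]: "ennreal_powr 1 r = 1"
  by (simp add: ennreal_powr_def)

lemma ennreal_powr_1 [simp]: "ennreal_powr x 1 = x"
  by (cases x) (auto simp: ennreal_powr_def)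

text \<open>True for every exponent, also for \<open>r \<le> 0\<close>, because
  \<open>0 powr r = 0\<close> in HOL.\<close>

lemma ennreal_powr_eq_0_iff [simp]: "ennreal_powr x r = 0 \<longleftrightarrow> x = 0"
  by (cases x) (auto simp: ennreal_powr_def)

lemma ennreal_powr_eq_top_iff [simp]: "ennreal_powr x r = top \<longleftrightarrow> x = top"
  by (cases x) (auto simp: ennreal_powr_def)

lemma ennreal_powr_mono:
  assumes "x \<le> y" "0 \<le> r"
  shows "ennreal_powr x r \<le> ennreal_powr y r"
proof (cases y)
  case (real s)
  then obtain t where t: "x = ennreal t" "0 \<le> t"
    using assms by (cases x) (auto simp: top_unique)
  with real assms show ?thesis
    by (auto simp: ennreal_powr_ennreal intro!: powr_mono2 ennreal_leI)
qed (auto simp: ennreal_powr_def)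

lemma ennreal_powr_mult: "ennreal_powr (x * y) r = ennreal_powr x r * ennreal_powr y r"
proof (cases x; cases y)
  fix s t assume "x = ennreal s" "0 \<le> s" "y = ennreal t" "0 \<le> t"
  then show ?thesis
    by (simp add: ennreal_mult [symmetric] ennreal_powr_ennreal powr_mult)
next
  fix s assume s: "x = ennreal s" "0 \<le> s" "y = top"
  show ?thesis
  proof (cases "s = 0")
    case False
    then show ?thesis using s by (simp add: ennreal_powr_ennreal ennreal_mult_top)
  qed (use s in simp)
next
  fix s assume s: "y = ennreal s" "0 \<le> s" "x = top"
  show ?thesis
  proof (cases "s = 0")
    case False
    then show ?thesis using s by (simp add: ennreal_powr_ennreal ennreal_top_mult)
  qed (use s in simp)
qed (simp add: ennreal_top_mult)

lemma ennreal_powr_powr: "ennreal_powr (ennreal_powr x r) s = ennreal_powr x (r * s)"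
  by (cases x) (auto simp: ennreal_powr_ennreal powr_powr)

lemma ennreal_powr_add_exponent:
  assumes "0 \<le> r" "0 \<le> s" "0 < r + s"
  shows "ennreal_powr x (r + s) = ennreal_powr x r * ennreal_powr x s"
  by (cases x) (auto simp: ennreal_powr_ennreal powr_add ennreal_mult ennreal_top_mult)

lemma ennreal_powr_le_iff:
  assumes "0 < r"
  shows "ennreal_powr x r \<le> c \<longleftrightarrow> x \<le> ennreal_powr c (1 / r)"
proof
  assume "ennreal_powr x r \<le> c"
  then have "ennreal_powr (ennreal_powr x r) (1 / r) \<le> ennreal_powr c (1 / r)"
    using assms by (intro ennreal_powr_mono) auto
  then show "x \<le> ennreal_powr c (1 / r)"
    using assms by (simp add: ennreal_powr_powr)
next
  assume "x \<le> ennreal_powr c (1 / r)"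
  then have "ennreal_powr x r \<le> ennreal_powr (ennreal_powr c (1 / r)) r"
    using assms by (intro ennreal_powr_mono) auto
  then show "ennreal_powr x r \<le> c"
    using assms by (simp add: ennreal_powr_powr)
qed

lemma ennreal_powr_add_le:
  assumes "0 \<le> r"
  shows "ennreal_powr (x + y) r \<le> ennreal (2 powr r) * (ennreal_powr x r + ennreal_powr y r)"
proof -
  have "x + y \<le> 2 * max x y"
    by (metis add_mono max.cobounded1 max.cobounded2 mult_2)
  then have "ennreal_powr (x + y) r \<le> ennreal_powr (ennreal 2 * max x y) r"
    using assms by (intro ennreal_powr_mono) auto
  also have "\<dots> = ennreal (2 powr r) * ennreal_powr (max x y) r"
    by (subst ennreal_powr_mult) (auto simp: ennreal_powr_ennreal simp flip: ennreal_numeral)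
  also have "ennreal_powr (max x y) r \<le> ennreal_powr x r + ennreal_powr y r"
    by (auto simp: max_def)
  finally show ?thesis
    by (simp add: mult_left_mono)
qed

lemma borel_measurable_ennreal_powr [measurable (raw)]:
  assumes [measurable]: "f \<in> borel_measurable M"
  shows "(\<lambda>x. ennreal_powr (f x) r) \<in> borel_measurable M"
  unfolding ennreal_powr_def by measurable

text \<open>A convexity-free Young inequality. Either \<open>u \<le> v powr (s - 1)\<close>, and the
  product is at most \<open>v powr s\<close>; or \<open>v \<le> u powr (1 / (s - 1))\<close>, and it
  is at most \<open>u powr s'\<close> because \<open>s' = 1 + 1 / (s - 1)\<close>.\<close>

lemma mult_le_powr_add_powr:
  fixes u v s s' :: real
  assumes "0 \<le> u" "0 \<le> v" "1 < s" "1 < s'" "1 / s + 1 / s' = 1"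
  shows "u * v \<le> u powr s' + v powr s"
proof (cases "u = 0 \<or> v = 0")
  case False
  then have uv: "0 < u" "0 < v" using assms by auto
  have s': "s' = s / (s - 1)" using assms by (auto simp: field_simps)
  show ?thesis
  proof (cases "u \<le> v powr (s - 1)")
    case True
    then have "u * v \<le> v powr (s - 1) * v powr 1" using uv by (intro mult_mono) auto
    also have "\<dots> = v powr s" by (simp only: powr_add [symmetric]) simp
    finally show ?thesis by (smt (verit) powr_ge_zero)
  next
    case False
    then have "v powr (s - 1) \<le> u" by simp
    then have "(v powr (s - 1)) powr (1 / (s - 1)) \<le> u powr (1 / (s - 1))"
      using assms by (intro powr_mono2) auto
    then have "v \<le> u powr (1 / (s - 1))"
      using assms uv by (simp add: powr_powr)
    then have "u * v \<le> u powr 1 * u powr (1 / (s - 1))"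
      using uv by (intro mult_mono) auto
    also have "\<dots> = u powr (1 + 1 / (s - 1))"
      by (simp only: powr_add)
    also have "1 + 1 / (s - 1) = s'" using assms by (simp add: s' field_simps)
    finally show ?thesis by (smt (verit) powr_ge_zero)
  qed
qed auto

lemma set_nn_integral_le_add:
  fixes u v w :: "'a \<Rightarrow> real"
  assumes [measurable]: "v \<in> borel_measurable M" "w \<in> borel_measurable M" "B \<in> sets M"
    and "0 \<le> k" "\<And>x. 0 \<le> v x" "\<And>x. 0 \<le> w x" "\<And>x. u x \<le> k * v x + w x"
  shows "(\<integral>\<^sup>+x\<in>B. ennreal (u x) \<partial>M) \<le> ennreal k * (\<integral>\<^sup>+x\<in>B. ennreal (v x) \<partial>M) + (\<integral>\<^sup>+x\<in>B. ennreal (w x) \<partial>M)"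
proof -
  have "ennreal (u x) \<le> ennreal k * ennreal (v x) + ennreal (w x)" for x
    using assms(4-7) by (simp add: ennreal_leI flip: ennreal_mult ennreal_plus)
  then have "(\<integral>\<^sup>+x\<in>B. ennreal (u x) \<partial>M) \<le>
      (\<integral>\<^sup>+x. ennreal k * (ennreal (v x) * indicator B x) + ennreal (w x) * indicator B x \<partial>M)"
    by (intro nn_integral_mono) (auto split: split_indicator)
  then show ?thesis by (simp add: nn_integral_add nn_integral_cmult)
qed

text \<open>The factor 2 is the price of using the crude form \<open>mult_le_powr_add_powr\<close> of Young's inequality.\<close>

lemma nn_integral_mult_le_powr:
  fixes u v :: "'a \<Rightarrow> real"
  assumes [measurable]: "u \<in> borel_measurable M" "v \<in> borel_measurable M"
    and nonneg: "\<And>x. 0 \<le> u x" "\<And>x. 0 \<le> v x"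
    and s: "1 < s" "1 < s'" "1 / s + 1 / s' = 1"
  shows "(\<integral>\<^sup>+x. ennreal (u x * v x) \<partial>M) \<le>
    2 * ennreal_powr (\<integral>\<^sup>+x. ennreal (u x powr s') \<partial>M) (1 / s')
      * ennreal_powr (\<integral>\<^sup>+x. ennreal (v x powr s) \<partial>M) (1 / s)"
proof -
  let ?U = "\<integral>\<^sup>+x. ennreal (u x powr s') \<partial>M" and ?V = "\<integral>\<^sup>+x. ennreal (v x powr s) \<partial>M"
  consider "?U = 0" | "?V = 0" | "?U \<noteq> 0" "?V \<noteq> 0" "?U = \<infinity> \<or> ?V = \<infinity>"
    | "?U \<noteq> 0" "?V \<noteq> 0" "?U \<noteq> \<infinity>" "?V \<noteq> \<infinity>" by blast
  then show ?thesis
  proof cases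
    case 1
    then have "AE x in M. ennreal (u x powr s') = 0"
      by (subst (asm) nn_integral_0_iff_AE) auto
    then have "AE x in M. ennreal (u x * v x) = 0"
      by eventually_elim (use nonneg in \<open>auto simp: ennreal_eq_0_iff\<close>)
    then have "(\<integral>\<^sup>+x. ennreal (u x * v x) \<partial>M) = 0"
      by (subst nn_integral_0_iff_AE) auto
    then show ?thesis by simp
  next
    case 2
    then have "AE x in M. ennreal (v x powr s) = 0"
      by (subst (asm) nn_integral_0_iff_AE) auto
    then have "AE x in M. ennreal (u x * v x) = 0"
      by eventually_elim (use nonneg in \<open>auto simp: ennreal_eq_0_iff\<close>)
    then have "(\<integral>\<^sup>+x. ennreal (u x * v x) \<partial>M) = 0"
      by (subst nn_integral_0_iff_AE) auto
    then show ?thesis by simp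
  next
    case 3
    then show ?thesis
      by (auto simp: ennreal_top_mult ennreal_mult_top)
  next
    case 4
    then obtain U V where UV: "?U = ennreal U" "?V = ennreal V" "0 < U" "0 < V"
      by (cases ?U; cases ?V) (auto simp: less_le)
    \<comment> \<open>Normalisation: the powers of \<open>u / \<alpha>\<close> and
      \<open>v / \<beta>\<close> both have integral 1, so the pointwise inequality integrates to
      2.\<close>
    define \<alpha> \<beta> where "\<alpha> = U powr (1 / s')" and "\<beta> = V powr (1 / s)"
    have ab: "0 < \<alpha>" "0 < \<beta>" using UV by (auto simp: \<alpha>_def \<beta>_def)
    have abp: "\<alpha> powr s' = U" "\<beta> powr s = V"
      using UV s by (auto simp: \<alpha>_def \<beta>_def powr_powr)
    have pt: "u x * v x \<le> (\<alpha> * \<beta> / U) * u x powr s' + (\<alpha> * \<beta> / V) * v x powr s" for x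
    proof -
      have "(u x / \<alpha>) * (v x / \<beta>) \<le> (u x / \<alpha>) powr s' + (v x / \<beta>) powr s"
        using nonneg ab s by (intro mult_le_powr_add_powr) auto
      also have "\<dots> = u x powr s' / U + v x powr s / V"
        using nonneg ab by (simp add: powr_divide abp)
      finally have "(\<alpha> * \<beta>) * ((u x / \<alpha>) * (v x / \<beta>)) \<le> (\<alpha> * \<beta>) * (u x powr s' / U + v x powr s / V)"
        using ab by (intro mult_left_mono) auto
      then show ?thesis using ab by (simp add: field_simps)
    qed
    have "(\<integral>\<^sup>+x. ennreal (u x * v x) \<partial>M) \<le>
        (\<integral>\<^sup>+x. ennreal (\<alpha> * \<beta> / U) * ennreal (u x powr s') + ennreal (\<alpha> * \<beta> / V) * ennreal (v x powr s) \<partial>M)"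
      using pt ab UV by (intro nn_integral_mono) (simp flip: ennreal_mult ennreal_plus add: ennreal_leI)
    also have "\<dots> = ennreal (\<alpha> * \<beta> / U) * ?U + ennreal (\<alpha> * \<beta> / V) * ?V"
      by (simp add: nn_integral_add nn_integral_cmult)
    also have "\<dots> = ennreal (2 * \<alpha> * \<beta>)"
      using UV ab by (simp flip: ennreal_mult ennreal_plus)
    also have "\<dots> = 2 * ennreal_powr ?U (1 / s') * ennreal_powr ?V (1 / s)"
      using UV ab by (simp add: ennreal_powr_ennreal ennreal_mult \<alpha>_def \<beta>_def)
    finally show ?thesis .
  qed
qed

section \<open>The Gauss measure on admissible balls\<close>

definition gauss_density :: "'a::euclidean_space \<Rightarrow> real" where
  "gauss_density x = pi powr (- real DIM('a) / 2) * exp (- (norm x)\<^sup>2)"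

lemma gauss_density_pos: "0 < gauss_density x"
  by (simp add: gauss_density_def)

lemma gauss_density_le_1: "gauss_density (x::'a::euclidean_space) \<le> 1"
proof -
  have "pi powr (- real DIM('a) / 2) \<le> pi powr 0"
    using pi_gt3 by (intro powr_mono) auto
  then have "gauss_density x \<le> 1 * 1"
    unfolding gauss_density_def by (intro mult_mono) auto
  then show ?thesis by simp
qed

lemma gauss_eq_density: "gauss = density lebesgue (\<lambda>x. ennreal (gauss_density x))"
  by (simp add: gauss_def gauss_density_def)

lemma sets_gauss [simp, measurable_cong]: "sets gauss = sets lebesgue"
  by (simp add: gauss_def)

lemma space_gauss [simp]: "space gauss = UNIV"
  by (simp add: gauss_def)

lemma continuous_gauss_density: "continuous_on UNIV gauss_density"
  unfolding gauss_density_def by (intro continuous_intros)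

lemma measurable_gauss_density [measurable]: "gauss_density \<in> borel_measurable lebesgue"
  by (intro measurable_completion)
    (simp add: borel_measurable_continuous_onI continuous_gauss_density)

lemma emeasure_gauss:
  "S \<in> sets lebesgue \<Longrightarrow> emeasure gauss S = (\<integral>\<^sup>+x\<in>S. ennreal (gauss_density x) \<partial>lebesgue)"
  by (simp add: gauss_eq_density emeasure_density)

lemma AE_gauss_iff: "(AE x in gauss. P x) \<longleftrightarrow> (AE x in lebesgue. P x)"
proof -
  have "(AE x in gauss. P x) \<longleftrightarrow> (AE x in lebesgue. 0 < ennreal (gauss_density x) \<longrightarrow> P x)"
    unfolding gauss_eq_density by (rule AE_density) measurable
  then show ?thesis by (simp add: gauss_density_pos)
qed

text \<open>Yields finiteness on bounded sets, and lets outer approximation by open sets be taken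
  over from Lebesgue measure.\<close>

lemma emeasure_gauss_le_lebesgue:
  assumes [measurable]: "S \<in> sets lebesgue"
  shows "emeasure gauss S \<le> emeasure lebesgue S"
proof -
  have "emeasure gauss S \<le> (\<integral>\<^sup>+x. indicator S x \<partial>lebesgue)"
    unfolding emeasure_gauss[OF assms]
    by (intro nn_integral_mono) (auto split: split_indicator simp: gauss_density_le_1)
  then show ?thesis by simp
qed

lemma negligible_AE_gauss:
  assumes "negligible S" shows "AE x in gauss. x \<notin> S"
  using assms AE_not_in[of S lebesgue] by (simp add: AE_gauss_iff negligible_iff_null_sets)

lemma ball_in_sets_gauss [measurable, simp]: "ball (c::'a::euclidean_space) r \<in> sets gauss"
  by simp

lemma emeasure_gauss_finite_bounded:
  assumes "bounded S" "S \<in> sets lebesgue" shows "emeasure gauss S < \<infinity>"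
proof -
  obtain a r where S: "S \<subseteq> ball a r"
    using assms(1) by (metis bounded_subset_ballD)
  have "emeasure gauss S \<le> emeasure lebesgue S"
    using assms(2) by (rule emeasure_gauss_le_lebesgue)
  also have "\<dots> \<le> emeasure lebesgue (ball a r)"
    using S by (intro emeasure_mono) auto
  also have "\<dots> < \<infinity>"
    using emeasure_lborel_ball_finite[of a r] by simp
  finally show ?thesis .
qed

text \<open>The condition \<open>r \<le> A * admiss c\<close> with the division cleared, since
  \<open>admiss c = 1 / max 1 (norm c)\<close>. Centre and radius are kept as data instead of the
  ball as a set, because covering arguments dilate, shrink and move balls.\<close>

definition admissible :: "real \<Rightarrow> 'a::euclidean_space \<Rightarrow> real \<Rightarrow> bool" where
  "admissible A c r \<longleftrightarrow> 0 < r \<and> r * max 1 (norm c) \<le> A"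

lemma admissibleD:
  assumes "admissible A c r"
  shows "0 < r" "r * max 1 (norm c) \<le> A" "r \<le> A" "r * norm c \<le> A" "0 < A"
proof -
  show r: "0 < r" "r * max 1 (norm c) \<le> A" using assms by (auto simp: admissible_def)
  have "r * 1 \<le> r * max 1 (norm c)" "r * norm c \<le> r * max 1 (norm c)"
    using r by (intro mult_left_mono; simp)+
  with r show "r \<le> A" "r * norm c \<le> A" "0 < A" by linarith+
qed

lemma admissible_balls_eq: "admissible_balls A = {ball c r | c r. admissible A c r}"
proof -
  have "r \<le> A * admiss c \<longleftrightarrow> r * max 1 (norm c) \<le> A" for c :: 'a and r
  proof -
    have "admiss c = 1 / max 1 (norm c)"
      by (auto simp: admiss_def min_def max_def field_simps)
    then show ?thesis by (simp add: pos_le_divide_eq)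
  qed
  then show ?thesis by (simp add: admissible_balls_def admissible_def)
qed

lemma admissible_mono: "admissible A c r \<Longrightarrow> A \<le> A' \<Longrightarrow> admissible A' c r"
  by (auto simp: admissible_def)

lemma admissible_scale: "admissible A c r \<Longrightarrow> 0 < k \<Longrightarrow> admissible (k * A) c (k * r)"
  by (auto simp: admissible_def mult.assoc)

lemma admissible_radius_mono: "admissible A c r \<Longrightarrow> 0 < s \<Longrightarrow> s \<le> r \<Longrightarrow> admissible A c s"
  by (auto simp: admissible_def) (smt (verit, best) mult_right_mono max.cobounded1)

text \<open>The new centre is at distance at most \<open>r \<le> A\<close>, so
  \<open>max 1 (norm c)\<close> grows at most by the factor \<open>1 + A\<close>.\<close>

lemma admissible_move:
  assumes "admissible A c r" "dist c y \<le> r"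
  shows "admissible (A * (1 + A)) y r"
proof -
  note a = admissibleD[OF assms(1)]
  have "norm y \<le> norm c + r"
    using assms(2) norm_triangle_ineq[of c "y - c"] by (simp add: dist_norm norm_minus_commute)
  then have "max 1 (norm y) \<le> max 1 (norm c) + A * 1"
    using a by auto
  also have "\<dots> \<le> max 1 (norm c) + A * max 1 (norm c)"
    using a by (intro add_left_mono mult_left_mono) auto
  finally have "r * max 1 (norm y) \<le> r * (max 1 (norm c) + A * max 1 (norm c))"
    using a by (intro mult_left_mono) auto
  also have "\<dots> = (r * max 1 (norm c)) * (1 + A)" by (simp add: algebra_simps)
  also have "\<dots> \<le> A * (1 + A)" using a by (intro mult_right_mono) auto
  finally show ?thesis using a by (simp add: admissible_def)
qed

text \<open>This is what the radius condition is made for: on the ball the exponent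
  \<open>(norm y)\<^sup>2\<close> differs from its value at the centre by at most
  \<open>r * (r + 2 * norm c)\<close>, and both \<open>r\<close> and \<open>r * norm c\<close> are
  bounded by \<open>A\<close>.\<close>

lemma gauss_density_compare:
  assumes "admissible A c r" "y \<in> ball c r"
  shows "gauss_density y \<le> exp (A\<^sup>2 + 2 * A) * gauss_density c"
    and "gauss_density c \<le> exp (A\<^sup>2 + 2 * A) * gauss_density y"
proof -
  note a = admissibleD[OF assms(1)]
  have yc: "\<bar>norm y - norm c\<bar> \<le> r"
    using assms(2) norm_triangle_ineq3[of y c] by (auto simp: dist_norm norm_minus_commute)
  have "\<bar>(norm y)\<^sup>2 - (norm c)\<^sup>2\<bar> = \<bar>norm y - norm c\<bar> * (norm y + norm c)"
    by (simp add: power2_eq_square square_diff_square_factored abs_mult)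
  also have "\<dots> \<le> r * (r + 2 * norm c)"
    using yc a by (intro mult_mono) auto
  also have "\<dots> = r * r + 2 * (r * norm c)" by (simp add: algebra_simps)
  also have "\<dots> \<le> A * A + 2 * A"
    using a by (intro add_mono mult_mono) auto
  finally have *: "\<bar>(norm y)\<^sup>2 - (norm c)\<^sup>2\<bar> \<le> A\<^sup>2 + 2 * A" by (simp add: power2_eq_square)
  then have "exp (- (norm y)\<^sup>2) \<le> exp (A\<^sup>2 + 2 * A) * exp (- (norm c)\<^sup>2)"
    "exp (- (norm c)\<^sup>2) \<le> exp (A\<^sup>2 + 2 * A) * exp (- (norm y)\<^sup>2)"
    by (auto simp flip: exp_add)
  then show "gauss_density y \<le> exp (A\<^sup>2 + 2 * A) * gauss_density c"
    "gauss_density c \<le> exp (A\<^sup>2 + 2 * A) * gauss_density y"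
    unfolding gauss_density_def by (simp_all add: algebra_simps)
qed

section \<open>Gauss measure of balls and local doubling\<close>

lemma emeasure_lebesgue_ball:
  fixes c :: "'a::euclidean_space"
  assumes "0 \<le> r"
  shows "emeasure lebesgue (ball c r) = ennreal (unit_ball_vol (real DIM('a)) * r ^ DIM('a))"
  using emeasure_ball[OF assms, of c] by simp

lemma emeasure_gauss_ball_finite: "emeasure gauss (ball c r) < \<infinity>"
  by (intro emeasure_gauss_finite_bounded) auto

lemma emeasure_gauss_ball_eq: "emeasure gauss (ball c r) = ennreal (measure gauss (ball c r))"
  using emeasure_gauss_ball_finite[of c r] by (intro emeasure_eq_ennreal_measure) auto

lemma measure_gauss_ball_pos:
  assumes "0 < r" shows "0 < measure gauss (ball c r)"
proof -
  have "emeasure gauss (ball c r) \<noteq> 0"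
  proof
    assume "emeasure gauss (ball c r) = 0"
    then have "AE x in gauss. x \<notin> ball c r"
      by (intro AE_not_in) (auto simp: null_sets_def)
    then have "negligible (ball c r)"
      unfolding AE_gauss_iff
      by (subst (asm) AE_iff_null) (auto simp: negligible_iff_null_sets ball_def)
    then show False
      using assms open_not_negligible[of "ball c r"] by auto
  qed
  then show ?thesis
    by (metis emeasure_gauss_ball_eq ennreal_0 less_le measure_nonneg)
qed

text \<open>Squared because two balls are compared through the density at a common centre; each of
  the two comparisons costs one exponential.\<close>

definition doubling_const :: "real \<Rightarrow> real" where
  "doubling_const A = (exp (A\<^sup>2 + 2 * A))\<^sup>2"

lemma doubling_const_pos: "0 < doubling_const A"
  by (simp add: doubling_const_def)

lemma gauss_ball_bounds:
  fixes c :: "'a::euclidean_space"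
  assumes "admissible A c r" "ball y s \<subseteq> ball c r" "0 < s"
  shows "measure gauss (ball y s) \<le>
      exp (A\<^sup>2 + 2 * A) * gauss_density c * (unit_ball_vol (real DIM('a)) * s ^ DIM('a))"
    and "gauss_density c * (unit_ball_vol (real DIM('a)) * s ^ DIM('a)) \<le>
      exp (A\<^sup>2 + 2 * A) * measure gauss (ball y s)"
proof -
  let ?E = "exp (A\<^sup>2 + 2 * A)" and ?v = "unit_ball_vol (real DIM('a)) * s ^ DIM('a)"
  have v: "emeasure lebesgue (ball y s) = ennreal ?v" "0 \<le> ?v"
    using assms emeasure_lebesgue_ball[of s y] by auto
  have cont: "gauss_density x \<le> ?E * gauss_density c" "gauss_density c \<le> ?E * gauss_density x"
    if "x \<in> ball y s" for x
    using gauss_density_compare[OF assms(1), of x] assms(2) that by auto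
  have cont': "ennreal (gauss_density c) \<le> ennreal ?E * ennreal (gauss_density x)"
    if "x \<in> ball y s" for x
    using cont(2)[OF that] gauss_density_pos[of x] by (subst ennreal_mult [symmetric]) (auto intro: ennreal_leI)
  have "emeasure gauss (ball y s) \<le> (\<integral>\<^sup>+x. ennreal (?E * gauss_density c) * indicator (ball y s) x \<partial>lebesgue)"
    by (subst emeasure_gauss, simp, intro nn_integral_mono)
       (auto split: split_indicator simp del: mem_ball intro!: ennreal_leI cont)
  also have "\<dots> = ennreal (?E * gauss_density c * ?v)"
    using v gauss_density_pos[of c] by (subst nn_integral_cmult_indicator) (auto simp flip: ennreal_mult)
  finally show "measure gauss (ball y s) \<le> ?E * gauss_density c * ?v"
    using v gauss_density_pos[of c] by (simp add: emeasure_gauss_ball_eq)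
  have "ennreal (gauss_density c * ?v) = (\<integral>\<^sup>+x. ennreal (gauss_density c) * indicator (ball y s) x \<partial>lebesgue)"
    using v gauss_density_pos[of c] by (subst nn_integral_cmult_indicator) (auto simp flip: ennreal_mult)
  also have "\<dots> \<le> (\<integral>\<^sup>+x. ennreal ?E * (ennreal (gauss_density x) * indicator (ball y s) x) \<partial>lebesgue)"
    using cont'
    by (intro nn_integral_mono) (auto split: split_indicator simp del: mem_ball)
  also have "\<dots> = ennreal ?E * ennreal (measure gauss (ball y s))"
    by (subst nn_integral_cmult) (auto simp flip: emeasure_gauss_ball_eq simp: emeasure_gauss)
  finally show "gauss_density c * ?v \<le> ?E * measure gauss (ball y s)"
    by (simp flip: ennreal_mult)
qed

lemma gauss_ball_compare:
  fixes c :: "'a::euclidean_space"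
  assumes "admissible A c r" "ball y s \<subseteq> ball c r" "ball z t \<subseteq> ball c r" "0 < s" "0 < t"
  shows "measure gauss (ball y s) \<le> doubling_const A * (s / t) ^ DIM('a) * measure gauss (ball z t)"
proof -
  let ?E = "exp (A\<^sup>2 + 2 * A)" and ?v = "unit_ball_vol (real DIM('a))"
  have "measure gauss (ball y s) \<le> ?E * gauss_density c * (?v * s ^ DIM('a))"
    by (rule gauss_ball_bounds[OF assms(1,2,4)])
  also have "\<dots> = ?E * (s / t) ^ DIM('a) * (gauss_density c * (?v * t ^ DIM('a)))"
    using assms by (simp add: field_simps)
  also have "\<dots> \<le> ?E * (s / t) ^ DIM('a) * (?E * measure gauss (ball z t))"
    using assms by (intro mult_left_mono gauss_ball_bounds(2)[OF assms(1,3,5)]) auto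
  finally show ?thesis by (simp add: doubling_const_def power2_eq_square algebra_simps)
qed

lemma gauss_ball_doubling:
  fixes c :: "'a::euclidean_space"
  assumes "admissible A c r" "1 \<le> k"
  shows "measure gauss (ball c (k * r)) \<le> doubling_const (k * A) * k ^ DIM('a) * measure gauss (ball c r)"
proof -
  have r: "0 < r" using assms by (simp add: admissible_def)
  have "ball c r \<subseteq> ball c (k * r)"
    using assms r by (intro subset_ball) auto
  then have "measure gauss (ball c (k * r)) \<le> doubling_const (k * A) * ((k * r) / r) ^ DIM('a) * measure gauss (ball c r)"
    using assms r by (intro gauss_ball_compare[OF admissible_scale[OF assms(1)]]) auto
  then show ?thesis using r by simp
qed

text \<open>Admissible radii are bounded by \<open>A\<close>, which is what Vitali's covering lemma
  asks for. The selection is made for closed balls, so the open balls are disjoint too.\<close>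

lemma admissible_Vitali:
  assumes "\<And>c r. (c, r) \<in> K \<Longrightarrow> admissible A c r"
  obtains C where "countable C" "C \<subseteq> K" "disjoint_family_on (\<lambda>(c, r). ball c r) C"
    "\<And>c r. (c, r) \<in> K \<Longrightarrow> \<exists>(c', r')\<in>C. ball c r \<subseteq> ball c' (5 * r')"
proof -
  have *: "0 < snd i \<and> snd i \<le> A" if "i \<in> K" for i
    using assms[of "fst i" "snd i"] admissibleD[of A "fst i" "snd i"] that by auto
  show ?thesis
  proof (rule Vitali_covering_lemma_cballs_balls[of K snd A fst])
    fix C assume C: "countable C" "C \<subseteq> K"
      "pairwise (\<lambda>i j. disjnt (cball (fst i) (snd i)) (cball (fst j) (snd j))) C"
      and cov: "\<And>i. i \<in> K \<Longrightarrow> \<exists>j. j \<in> C \<and> \<not> disjnt (cball (fst i) (snd i)) (cball (fst j) (snd j)) \<and>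
          cball (fst i) (snd i) \<subseteq> ball (fst j) (5 * snd j)"
    show ?thesis
    proof
      show "disjoint_family_on (\<lambda>(c, r). ball c r) C"
        using C(3) ball_subset_cball
        unfolding disjoint_family_on_def pairwise_def disjnt_def by fastforce
      show "\<exists>(c', r')\<in>C. ball c r \<subseteq> ball c' (5 * r')" if "(c, r) \<in> K" for c r
        using cov[OF that] ball_subset_cball by fastforce
    qed (use C in auto)
  qed (use * in auto)
qed

text \<open>Sums over selected balls are written as integrals over \<open>count_space\<close>:
  finite and infinite selections are then treated alike, and sum and integral interchange by
  Tonelli. The identity is countable additivity of the measure with density
  \<open>g\<close>.\<close>

lemma nn_integral_UN_countable:
  assumes [measurable]: "g \<in> borel_measurable M" "\<And>i. i \<in> C \<Longrightarrow> X i \<in> sets M"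
    and C: "countable C" "disjoint_family_on X C"
  shows "(\<integral>\<^sup>+i. (\<integral>\<^sup>+x\<in>X i. g x \<partial>M) \<partial>count_space C) = (\<integral>\<^sup>+x\<in>(\<Union>i\<in>C. X i). g x \<partial>M)"
proof -
  have U: "(\<Union>i\<in>C. X i) \<in> sets M"
    using C by (intro sets.countable_UN'') auto
  have "(\<integral>\<^sup>+i. (\<integral>\<^sup>+x\<in>X i. g x \<partial>M) \<partial>count_space C) = (\<integral>\<^sup>+i. emeasure (density M g) (X i) \<partial>count_space C)"
    by (intro nn_integral_cong) (simp add: emeasure_density)
  also have "\<dots> = emeasure (density M g) (\<Union>i\<in>C. X i)"
    using C by (intro emeasure_UN_countable [symmetric]) auto
  also have "\<dots> = (\<integral>\<^sup>+x\<in>(\<Union>i\<in>C. X i). g x \<partial>M)"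
    using U by (simp add: emeasure_density)
  finally show ?thesis .
qed

lemma nn_integral_UN_le:
  fixes g :: "'a \<Rightarrow> ennreal"
  assumes [measurable]: "g \<in> borel_measurable M" "\<And>i. i \<in> C \<Longrightarrow> X i \<in> sets M"
    and C: "countable C" "S \<subseteq> (\<Union>i\<in>C. X i)"
  shows "(\<integral>\<^sup>+x\<in>S. g x \<partial>M) \<le> (\<integral>\<^sup>+i. (\<integral>\<^sup>+x\<in>X i. g x \<partial>M) \<partial>count_space C)"
proof -
  have "(\<integral>\<^sup>+x\<in>S. g x \<partial>M) \<le> (\<integral>\<^sup>+x. \<integral>\<^sup>+i. g x * indicator (X i) x \<partial>count_space C \<partial>M)"
  proof (intro nn_integral_mono)
    fix x
    show "g x * indicator S x \<le> (\<integral>\<^sup>+i. g x * indicator (X i) x \<partial>count_space C)"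
    proof (cases "x \<in> S")
      case True
      then obtain i where "i \<in> C" "x \<in> X i" using C by auto
      then show ?thesis
        using nn_integral_ge_point[of i C "\<lambda>i. g x * indicator (X i) x"] True by simp
    qed simp
  qed
  also have "\<dots> = (\<integral>\<^sup>+i. (\<integral>\<^sup>+x\<in>X i. g x \<partial>M) \<partial>count_space C)"
    using C by (intro nn_integral_count_space_nn_integral) auto
  finally show ?thesis .
qed

text \<open>A substitute for the Lebesgue differentiation theorem: Vitali's covering theorem is applied to the
  superlevel set of \<open>g\<close> inside an open set of almost the same measure.\<close>

lemma AE_le_if_ball_averages_le:
  fixes g :: "'a::euclidean_space \<Rightarrow> real"
  assumes [measurable]: "g \<in> borel_measurable gauss" "E \<in> sets lebesgue"
    and "0 \<le> \<mu>"
    and avg: "\<And>x. x \<in> E \<Longrightarrow> \<exists>\<delta>>0. \<forall>t. 0 < t \<and> t < \<delta> \<longrightarrow>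
        (\<integral>\<^sup>+y\<in>ball x t. ennreal (g y) \<partial>gauss) \<le> ennreal \<mu> * emeasure gauss (ball x t)"
  shows "AE x in gauss. x \<in> E \<longrightarrow> g x \<le> \<mu>"
proof -
  \<comment> \<open>The intersection with a ball makes the measure \<open>m\<close> of the
    superlevel set finite, as the strict comparison at the end requires. Countably many
    \<open>R\<close> and \<open>\<mu>'\<close> then exhaust the full superlevel set.\<close>
  have null: "emeasure gauss {x \<in> E \<inter> ball 0 (real R). \<mu>' < g x} = 0" if "\<mu> < \<mu>'" for \<mu>' and R :: nat
  proof (rule ccontr)
    define S where "S = {x \<in> E \<inter> ball 0 (real R). \<mu>' < g x}"
    assume "emeasure gauss {x \<in> E \<inter> ball 0 (real R). \<mu>' < g x} \<noteq> 0"
    then have nz: "emeasure gauss S \<noteq> 0" by (simp add: S_def)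
    have [measurable]: "g \<in> borel_measurable lebesgue"
      using assms(1) by (simp cong: measurable_cong_sets)
    have S [measurable]: "S \<in> sets lebesgue" unfolding S_def by measurable
    have "emeasure gauss S \<le> emeasure gauss (ball (0::'a) (real R))"
      by (intro emeasure_mono) (auto simp: S_def)
    also have "\<dots> < \<infinity>" by (rule emeasure_gauss_ball_finite)
    finally obtain m where m: "emeasure gauss S = ennreal m" "0 < m"
      using nz by (cases "emeasure gauss S") (auto simp: less_le)
    \<comment> \<open>Chosen so that the excess measure \<open>e\<close> of the open set costs
      \<open>\<mu> * e\<close>, less than the gain \<open>(\<mu>' - \<mu>) * m\<close>; the summand
      1 guards against \<open>\<mu> = 0\<close>.\<close>
    define e where "e = (\<mu>' - \<mu>) * m / (2 * (\<mu> + 1))"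
    have e: "0 < e" using m that \<open>0 \<le> \<mu>\<close> by (auto simp: e_def)
    obtain U where U: "open U" "S \<subseteq> U" "U - S \<in> lmeasurable" "emeasure lebesgue (U - S) < ennreal e"
      using sets_lebesgue_outer_open[OF S e] by blast
    have "emeasure gauss U = emeasure gauss S + emeasure gauss (U - S)"
      using U S by (subst plus_emeasure) (auto simp: Un_absorb1 simp del: mem_ball intro: fmeasurableD)
    also have "\<dots> \<le> ennreal m + ennreal e"
      using U m emeasure_gauss_le_lebesgue[of "U - S"] by (intro add_mono) (auto dest: fmeasurableD)
    finally have gU: "emeasure gauss U \<le> ennreal (m + e)"
      using m e by (simp add: ennreal_plus)
    define K where "K = {(x, t). x \<in> S \<and> 0 < t \<and> ball x t \<subseteq> U \<and>
       (\<integral>\<^sup>+y\<in>ball x t. ennreal (g y) \<partial>gauss) \<le> ennreal \<mu> * emeasure gauss (ball x t)}"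
    have cov: "\<exists>i. i \<in> K \<and> x \<in> ball (fst i) (snd i) \<and> snd i < d" if x: "x \<in> S" and d: "0 < d" for x d
    proof -
      obtain \<delta> where \<delta>: "0 < \<delta>" "\<And>t. 0 < t \<Longrightarrow> t < \<delta> \<Longrightarrow>
        (\<integral>\<^sup>+y\<in>ball x t. ennreal (g y) \<partial>gauss) \<le> ennreal \<mu> * emeasure gauss (ball x t)"
        using avg[of x] x by (auto simp: S_def)
      obtain \<epsilon> where \<epsilon>: "0 < \<epsilon>" "ball x \<epsilon> \<subseteq> U"
        using U x by (meson open_contains_ball subsetD)
      define t where "t = min (min \<delta> \<epsilon>) d / 2"
      have t: "0 < t" "t < \<delta>" "t < \<epsilon>" "t < d" using \<delta>(1) \<epsilon>(1) d by (auto simp: t_def)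
      then have "ball x t \<subseteq> U" using \<epsilon> subset_ball[of t \<epsilon> x] by auto
      then have "(x, t) \<in> K" using x t \<delta>(2) by (auto simp: K_def)
      then show ?thesis using t by (intro exI[of _ "(x, t)"]) auto
    qed
    obtain C where C: "countable C" "C \<subseteq> K"
      "pairwise (\<lambda>i j. disjnt (ball (fst i) (snd i)) (ball (fst j) (snd j))) C"
      "negligible (S - (\<Union>i\<in>C. ball (fst i) (snd i)))"
      by (rule Vitali_covering_theorem_balls[of S K fst snd, OF cov]) (assumption | rule that)+
    define W where "W = (\<Union>i\<in>C. ball (fst i) (snd i))"
    have dj: "disjoint_family_on (\<lambda>i. ball (fst i) (snd i)) C"
      using C(3) by (auto simp: disjoint_family_on_def pairwise_def disjnt_def)
    have W [measurable]: "W \<in> sets gauss" unfolding W_def using C(1) by (intro sets.countable_UN'') auto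
    have "ennreal (\<mu>' * m) = (\<integral>\<^sup>+y\<in>S. ennreal \<mu>' \<partial>gauss)"
      using m that \<open>0 \<le> \<mu>\<close> by (subst nn_integral_cmult_indicator) (auto simp flip: ennreal_mult)
    also have "\<dots> \<le> (\<integral>\<^sup>+y\<in>W. ennreal (g y) \<partial>gauss)"
    proof (intro nn_integral_mono_AE)
      have "AE y in gauss. y \<notin> S - W"
        using C(4) by (intro negligible_AE_gauss) (auto simp: W_def)
      then show "AE y in gauss. ennreal \<mu>' * indicator S y \<le> ennreal (g y) * indicator W y"
        by eventually_elim (auto split: split_indicator intro!: ennreal_leI simp: S_def)
    qed
    also have "\<dots> = (\<integral>\<^sup>+i. (\<integral>\<^sup>+y\<in>ball (fst i) (snd i). ennreal (g y) \<partial>gauss) \<partial>count_space C)"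
      unfolding W_def using C dj by (intro nn_integral_UN_countable [symmetric]) auto
    also have "\<dots> \<le> (\<integral>\<^sup>+i. ennreal \<mu> * emeasure gauss (ball (fst i) (snd i)) \<partial>count_space C)"
      using C(2) by (intro nn_integral_mono) (auto simp: K_def)
    also have "\<dots> = ennreal \<mu> * emeasure gauss W"
      unfolding W_def using C dj by (subst nn_integral_cmult) (auto simp: emeasure_UN_countable)
    also have "\<dots> \<le> ennreal \<mu> * emeasure gauss U"
    proof -
      have "ball (fst i) (snd i) \<subseteq> U" if "i \<in> C" for i
        using subsetD[OF C(2) that] by (simp add: K_def case_prod_beta)
      then have "W \<subseteq> U" unfolding W_def by (rule UN_least)
      then show ?thesis using U(1) by (intro mult_left_mono emeasure_mono) auto
    qed
    also have "\<dots> \<le> ennreal \<mu> * ennreal (m + e)"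
      using gU by (intro mult_left_mono) auto
    also have "\<dots> = ennreal (\<mu> * (m + e))"
      using \<open>0 \<le> \<mu>\<close> m e by (simp add: ennreal_mult)
    finally have "\<mu>' * m \<le> \<mu> * (m + e)"
      using \<open>0 \<le> \<mu>\<close> m e by simp
    moreover have "\<mu> * e < (\<mu>' - \<mu>) * m"
    proof -
      have "\<mu> * e < 2 * (\<mu> + 1) * e" using e \<open>0 \<le> \<mu>\<close> by (intro mult_strict_right_mono) auto
      also have "\<dots> = (\<mu>' - \<mu>) * m" using \<open>0 \<le> \<mu>\<close> by (simp add: e_def)
      finally show ?thesis .
    qed
    ultimately show False by (simp add: algebra_simps)
  qed
  have [measurable]: "g \<in> borel_measurable lebesgue"
    using assms(1) by (simp cong: measurable_cong_sets)
  have meas: "{x \<in> E \<inter> ball 0 (real R). \<mu> + inverse (real (Suc k)) < g x} \<in> sets gauss" for R k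
    by measurable
  have "AE x in gauss. \<forall>R k. x \<notin> {x \<in> E \<inter> ball 0 (real R). \<mu> + inverse (real (Suc k)) < g x}"
    unfolding AE_all_countable
    by (intro allI AE_not_in null_setsI null meas) simp
  then show ?thesis
  proof eventually_elim
    case (elim x)
    show ?case
    proof (rule impI, rule ccontr)
      assume x: "x \<in> E" "\<not> g x \<le> \<mu>"
      then obtain k where "inverse (real (Suc k)) < g x - \<mu>"
        using reals_Archimedean[of "g x - \<mu>"] by auto
      moreover obtain R :: nat where "norm x < real R"
        using reals_Archimedean2 by blast
      ultimately show False
        using elim[rule_format, of R k] x by simp
    qed
  qed
qed

section \<open>Maximal operators\<close>

definition pow2 :: "int \<Rightarrow> real" where "pow2 k = 2 powr real_of_int k"

lemma pow2_pos [simp]: "0 < pow2 k" by (simp add: pow2_def)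

lemma pow2_bracket:
  assumes "0 < v"
  obtains k where "pow2 k < v" "v \<le> pow2 (k + 1)"
proof
  \<comment> \<open>Ceiling minus one, since the lower inequality must be strict to match the strict
    superlevel sets.\<close>
  define k where "k = \<lceil>log 2 v\<rceil> - 1"
  have "real_of_int k < log 2 v" "log 2 v \<le> real_of_int (k + 1)" unfolding k_def by linarith+
  then have "2 powr real_of_int k < 2 powr (log 2 v)" "2 powr (log 2 v) \<le> 2 powr real_of_int (k + 1)"
    by (auto intro: powr_less_mono powr_mono)
  then show "pow2 k < v" "v \<le> pow2 (k + 1)"
    using assms by (auto simp: pow2_def)
qed

text \<open>For finite positive \<open>v\<close> one term suffices, the one with
  \<open>pow2 k < v\<close> and \<open>v \<le> pow2 (k + 1)\<close>. For \<open>v = top\<close> all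
  levels contribute and the terms are unbounded.\<close>

lemma ennreal_powr_le_dyadic_sum:
  assumes "0 < q"
  shows "ennreal_powr v q \<le> (\<integral>\<^sup>+k. ennreal (pow2 (k + 1) powr q) * indicator {k. ennreal (pow2 k) < v} k \<partial>count_space UNIV)"
    (is "_ \<le> ?S")
proof (cases v)
  case (real r)
  show ?thesis
  proof (cases "r = 0")
    case False
    then obtain k where k: "pow2 k < r" "r \<le> pow2 (k + 1)"
      using real pow2_bracket[of r] by auto
    have "ennreal_powr v q \<le> ennreal (pow2 (k + 1) powr q) * indicator {k. ennreal (pow2 k) < v} k"
      using real k assms by (auto simp: ennreal_powr_ennreal ennreal_less_iff less_imp_le intro!: ennreal_leI powr_mono2)
    also have "\<dots> \<le> ?S" by (rule nn_integral_ge_point) simp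
    finally show ?thesis .
  qed (use real in simp)
next
  case top
  have "ennreal (real n) \<le> ?S" for n
  proof -
    obtain k where k: "pow2 k < (real n + 1) powr (1 / q)" "(real n + 1) powr (1 / q) \<le> pow2 (k + 1)"
      using pow2_bracket[of "(real n + 1) powr (1 / q)"] by auto
    have "((real n + 1) powr (1 / q)) powr q \<le> pow2 (k + 1) powr q"
      using k assms by (intro powr_mono2) auto
    then have "real n \<le> pow2 (k + 1) powr q"
      using assms by (simp add: powr_powr)
    then have "ennreal (real n) \<le> ennreal (pow2 (k + 1) powr q) * indicator {k. ennreal (pow2 k) < v} k"
      using top by (simp add: ennreal_leI)
    also have "\<dots> \<le> ?S" by (rule nn_integral_ge_point) simp
    finally show ?thesis .
  qed
  then have "\<not> ?S < of_nat n" for n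
    by (simp add: ennreal_of_nat_eq_real_of_nat not_less)
  then have "?S = top"
    using ennreal_Ex_less_of_nat[of ?S] less_top by blast
  then show ?thesis by simp
qed

text \<open>For finite positive \<open>v\<close> the levels below \<open>v\<close> have a largest
  one \<open>K\<close>; counted downwards from it the terms form a geometric series with ratio
  \<open>2 powr (- q)\<close>.\<close>

lemma dyadic_sum_le_ennreal_powr:
  assumes "0 < q"
  shows "(\<integral>\<^sup>+k. ennreal (pow2 k powr q) * indicator {k. ennreal (pow2 k) < v} k \<partial>count_space UNIV)
    \<le> ennreal (1 / (1 - 2 powr (- q))) * ennreal_powr v q"
proof (cases v)
  case (real r)
  have q2: "2 powr (- q) < 1" using assms powr_less_mono[of "- q" 0 2] by simp
  show ?thesis
  proof (cases "r = 0")
    case False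
    then obtain K where K: "pow2 K < r" "r \<le> pow2 (K + 1)"
      using real pow2_bracket[of r] by auto
    have ind: "ennreal (pow2 k) < v \<longleftrightarrow> k \<le> K" for k
    proof
      assume "ennreal (pow2 k) < v"
      then have "pow2 k < pow2 (K + 1)" using real K by (auto simp: ennreal_less_iff less_imp_le)
      then show "k \<le> K" by (simp add: pow2_def)
    next
      assume "k \<le> K"
      then have "pow2 k \<le> pow2 K" by (simp add: pow2_def)
      then show "ennreal (pow2 k) < v" using K real by (auto simp: ennreal_less_iff less_imp_le)
    qed
    have bij: "bij_betw (\<lambda>j. K - int j) UNIV {..K}"
      by (rule bij_betwI[where g = "\<lambda>k. nat (K - k)"]) auto
    have "(\<integral>\<^sup>+k. ennreal (pow2 k powr q) * indicator {k. ennreal (pow2 k) < v} k \<partial>count_space UNIV)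
        = (\<integral>\<^sup>+k. ennreal (pow2 k powr q) \<partial>count_space {..K})"
      unfolding ind by (simp add: nn_integral_count_space_indicator atMost_def)
    also have "\<dots> = (\<integral>\<^sup>+j. ennreal (pow2 (K - int j) powr q) \<partial>count_space UNIV)"
      by (rule nn_integral_bij_count_space[OF bij, symmetric])
    also have "\<dots> = (\<Sum>j. ennreal (pow2 K powr q * (2 powr (- q)) ^ j))"
      unfolding nn_integral_count_space_nat
    proof (intro suminf_cong arg_cong[where f = ennreal])
      fix j
      have "pow2 (K - int j) powr q = 2 powr (q * real_of_int K) * 2 powr (real j * (- q))"
        by (simp add: pow2_def powr_powr flip: powr_add) (simp add: algebra_simps)
      also have "2 powr (real j * (- q)) = (2 powr (- q)) ^ j"
        by (simp add: powr_realpow[symmetric] powr_powr mult.commute)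
      finally show "pow2 (K - int j) powr q = pow2 K powr q * (2 powr (- q)) ^ j"
        by (simp add: pow2_def powr_powr mult.commute)
    qed
    also have "\<dots> = ennreal (pow2 K powr q * (1 / (1 - 2 powr (- q))))"
      using q2 by (intro suminf_ennreal_eq sums_mult geometric_sums) auto
    also have "\<dots> \<le> ennreal (r powr q * (1 / (1 - 2 powr (- q))))"
      using K assms q2 by (intro ennreal_leI mult_right_mono powr_mono2) (auto intro: less_imp_le)
    also have "\<dots> = ennreal (1 / (1 - 2 powr (- q))) * ennreal_powr v q"
      using real q2 by (simp add: ennreal_powr_ennreal mult.commute ennreal_mult'' flip: ennreal_mult)
    finally show ?thesis .
  qed (use real in simp)
next
  case top
  define G where "G = 1 / (1 - 2 powr (- q))"
  have "0 < G" using assms powr_less_mono[of "- q" 0 2] by (simp add: G_def)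
  then show ?thesis using top by (simp add: ennreal_mult_top flip: G_def)
qed

lemma dyadic_level_sum_le:
  assumes "0 < q" and [measurable]: "F \<in> borel_measurable M"
  shows "(\<integral>\<^sup>+k. ennreal (pow2 k powr q) * emeasure M {x \<in> space M. ennreal (pow2 k) < F x} \<partial>count_space UNIV)
    \<le> ennreal (1 / (1 - 2 powr (- q))) * (\<integral>\<^sup>+x. ennreal_powr (F x) q \<partial>M)"
proof -
  let ?t = "\<lambda>k x. ennreal (pow2 k powr q) * indicator {x \<in> space M. ennreal (pow2 k) < F x} x"
  have "(\<integral>\<^sup>+k. ennreal (pow2 k powr q) * emeasure M {x \<in> space M. ennreal (pow2 k) < F x} \<partial>count_space UNIV)
    = (\<integral>\<^sup>+k. (\<integral>\<^sup>+x. ?t k x \<partial>M) \<partial>count_space UNIV)"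
    by (simp add: nn_integral_cmult_indicator)
  also have "\<dots> = (\<integral>\<^sup>+x. (\<integral>\<^sup>+k. ?t k x \<partial>count_space UNIV) \<partial>M)"
    by (intro nn_integral_count_space_nn_integral [symmetric]) auto
  also have "\<dots> \<le> (\<integral>\<^sup>+x. ennreal (1 / (1 - 2 powr (- q))) * ennreal_powr (F x) q \<partial>M)"
    by (intro nn_integral_mono order_trans[OF _ dyadic_sum_le_ennreal_powr[OF assms(1)]])
       (auto simp: indicator_def)
  also have "\<dots> = ennreal (1 / (1 - 2 powr (- q))) * (\<integral>\<^sup>+x. ennreal_powr (F x) q \<partial>M)"
    by (rule nn_integral_cmult) measurable
  finally show ?thesis .
qed

section \<open>Fractional averages and their suprema\<close>

abbreviation ball_integral :: "('a::euclidean_space \<Rightarrow> real) \<Rightarrow> 'a \<Rightarrow> real \<Rightarrow> ennreal" where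
  "ball_integral f c r \<equiv> (\<integral>\<^sup>+y\<in>ball c r. ennreal \<bar>f y\<bar> \<partial>gauss)"

lemma ennreal_powr_gauss_ball:
  "ennreal_powr (emeasure gauss (ball c r)) s = ennreal (measure gauss (ball c r) powr s)"
  by (simp add: emeasure_gauss_ball_eq ennreal_powr_ennreal)

lemma ennreal_divide_le_iff:
  assumes "0 < g" shows "x / ennreal g \<le> m \<longleftrightarrow> x \<le> m * ennreal g"
proof
  assume "x \<le> m * ennreal g"
  then show "x / ennreal g \<le> m"
    using assms by (intro divide_le_posI_ennreal) (auto simp: mult.commute)
next
  assume "x / ennreal g \<le> m"
  then have "x / ennreal g * ennreal g \<le> m * ennreal g" by (rule mult_right_mono) simp
  then show "x \<le> m * ennreal g"
    using assms by (simp add: ennreal_divide_times ennreal_mult_divide_eq)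
qed

lemma frac_max_eq:
  "frac_max A \<beta> f x =
    (SUP (c, r)\<in>{(c, r). admissible A c r \<and> x \<in> ball c r}.
      ball_integral f c r / ennreal (measure gauss (ball c r) powr (1 - \<beta>)))"
proof -
  have "admissible_balls_at A x = (\<lambda>(c, r). ball c r) ` {(c, r). admissible A c r \<and> x \<in> ball c r}"
    by (auto simp: admissible_balls_at_def admissible_balls_eq)
  then show ?thesis
    unfolding frac_max_def
    by (simp add: image_image case_prod_beta ennreal_powr_gauss_ball del: mem_ball)
qed

lemma frac_max_le_iff:
  "frac_max A \<beta> f x \<le> m \<longleftrightarrow>
    (\<forall>c r. admissible A c r \<and> x \<in> ball c r \<longrightarrow>
      ball_integral f c r \<le> m * ennreal (measure gauss (ball c r) powr (1 - \<beta>)))"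
proof -
  have "0 < measure gauss (ball c r) powr (1 - \<beta>)" if "admissible A c r" for c :: 'a and r
    using measure_gauss_ball_pos[of r c] that by (auto simp: admissible_def)
  then show ?thesis
    unfolding frac_max_eq SUP_le_iff by (auto simp: ennreal_divide_le_iff simp del: mem_ball)
qed

lemma ball_integral_le_frac_max:
  "admissible A c r \<Longrightarrow> x \<in> ball c r \<Longrightarrow>
    ball_integral f c r \<le> frac_max A \<beta> f x * ennreal (measure gauss (ball c r) powr (1 - \<beta>))"
  using frac_max_le_iff[of A \<beta> f x "frac_max A \<beta> f x"] by blast

text \<open>For \<beta> = 0 the operator is the local, uncentred Hardy--Littlewood maximal
  operator.\<close>

lemma ball_integral_le_frac_max_0:
  "admissible A c r \<Longrightarrow> x \<in> ball c r \<Longrightarrow>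
    ball_integral f c r \<le> frac_max A 0 f x * emeasure gauss (ball c r)"
  using ball_integral_le_frac_max[of A c r x f 0] measure_nonneg[of gauss "ball c r"]
  by (simp add: emeasure_gauss_ball_eq)

lemma less_frac_max_iff:
  "t < frac_max A \<beta> f x \<longleftrightarrow>
    (\<exists>c r. admissible A c r \<and> x \<in> ball c r \<and>
      t * ennreal (measure gauss (ball c r) powr (1 - \<beta>)) < ball_integral f c r)"
  using frac_max_le_iff[of A \<beta> f x t] by (auto simp: not_le [symmetric] simp del: mem_ball)

text \<open>The balls are open and merely have to contain the point, so every superlevel set is a
  union of open balls: the maximal function is lower semicontinuous, whatever \<open>f\<close>
  is.\<close>

lemma measurable_frac_max [measurable]: "frac_max A \<beta> f \<in> borel_measurable gauss"
proof (rule borel_measurableI_greater)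
  fix t
  let ?K = "{(c, r). admissible A c r \<and> t * ennreal (measure gauss (ball c r) powr (1 - \<beta>)) < ball_integral f c r}"
  have "{x. t < frac_max A \<beta> f x} = (\<Union>(c, r)\<in>?K. ball c r)"
    unfolding less_frac_max_iff by (auto simp del: mem_ball)
  moreover have "open (\<Union>(c, r)\<in>?K. ball c r)" by (intro open_UN) auto
  ultimately show "{x \<in> space gauss. t < frac_max A \<beta> f x} \<in> sets gauss"
    by simp
qed

text \<open>Bounds the measure of a Vitali dilate by that of the ball itself; the type argument
  supplies the dimension.\<close>

definition five_const :: "'a::euclidean_space itself \<Rightarrow> real \<Rightarrow> real" where
  "five_const _ A = doubling_const (5 * A) * 5 ^ DIM('a)"

lemma five_const_pos: "0 < five_const TYPE('a::euclidean_space) A"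
  by (simp add: five_const_def doubling_const_pos)

lemma emeasure_gauss_ball_five:
  fixes c :: "'a::euclidean_space"
  assumes "admissible A c r"
  shows "emeasure gauss (ball c (5 * r)) \<le> ennreal (five_const TYPE('a) A) * emeasure gauss (ball c r)"
  using gauss_ball_doubling[OF assms, of 5] five_const_pos[where 'a='a, of A]
  by (simp add: emeasure_gauss_ball_eq five_const_def ennreal_leI flip: ennreal_mult)

text \<open>The selected balls are disjoint and \<open>\<bar>f\<bar>\<close> has average at least
  \<open>t\<close> on each, so \<open>t\<close> times their total measure is at most the integral of
  \<open>\<bar>f\<bar>\<close>; their dilates cover the superlevel set.\<close>

lemma frac_max_weak_type:
  fixes f :: "'a::euclidean_space \<Rightarrow> real"
  assumes [measurable]: "f \<in> borel_measurable gauss"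
  shows "ennreal t * emeasure gauss {x. ennreal t < frac_max A 0 f x}
    \<le> ennreal (five_const TYPE('a) A) * (\<integral>\<^sup>+x. ennreal \<bar>f x\<bar> \<partial>gauss)"
proof -
  define K where "K = {(c, r). admissible A c r \<and> ennreal t * emeasure gauss (ball c r) \<le> ball_integral f c r}"
  obtain C where C: "countable C" "C \<subseteq> K" "disjoint_family_on (\<lambda>(c, r). ball c r) C"
    and cov: "\<And>c r. (c, r) \<in> K \<Longrightarrow> \<exists>(c', r')\<in>C. ball c r \<subseteq> ball c' (5 * r')"
    by (rule admissible_Vitali[of K A]) (auto simp: K_def)
  have sub: "{x. ennreal t < frac_max A 0 f x} \<subseteq> (\<Union>i\<in>C. ball (fst i) (5 * snd i))"
  proof
    fix x assume "x \<in> {x. ennreal t < frac_max A 0 f x}"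
    then obtain c r where "admissible A c r" "x \<in> ball c r"
      "ennreal t * emeasure gauss (ball c r) < ball_integral f c r"
      by (auto simp: less_frac_max_iff emeasure_gauss_ball_eq simp del: mem_ball)
    then have "(c, r) \<in> K" "x \<in> ball c r" by (auto simp: K_def)
    then show "x \<in> (\<Union>i\<in>C. ball (fst i) (5 * snd i))"
      using cov[of c r] by fastforce
  qed
  have lev: "{x. ennreal t < frac_max A 0 f x} \<in> sets lebesgue"
    using borel_measurable_less[of "\<lambda>_. ennreal t" gauss "frac_max A 0 f"] by simp
  have "emeasure gauss {x. ennreal t < frac_max A 0 f x} \<le> (\<integral>\<^sup>+i. emeasure gauss (ball (fst i) (5 * snd i)) \<partial>count_space C)"
    using nn_integral_UN_le[OF _ _ C(1) sub, of "\<lambda>_. 1" gauss] lev by simp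
  also have "\<dots> \<le> (\<integral>\<^sup>+i. ennreal (five_const TYPE('a) A) * emeasure gauss (ball (fst i) (snd i)) \<partial>count_space C)"
    using C(2) by (intro nn_integral_mono emeasure_gauss_ball_five) (auto simp: K_def)
  finally have "ennreal t * emeasure gauss {x. ennreal t < frac_max A 0 f x} \<le>
    ennreal t * (\<integral>\<^sup>+i. ennreal (five_const TYPE('a) A) * emeasure gauss (ball (fst i) (snd i)) \<partial>count_space C)"
    by (intro mult_left_mono) auto
  also have "\<dots> = ennreal (five_const TYPE('a) A) * (\<integral>\<^sup>+i. ennreal t * emeasure gauss (ball (fst i) (snd i)) \<partial>count_space C)"
    by (simp add: nn_integral_cmult mult_ac)
  also have "\<dots> \<le> ennreal (five_const TYPE('a) A) * (\<integral>\<^sup>+i. ball_integral f (fst i) (snd i) \<partial>count_space C)"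
    using C(2) by (intro mult_left_mono nn_integral_mono) (auto simp: K_def)
  also have "(\<integral>\<^sup>+i. ball_integral f (fst i) (snd i) \<partial>count_space C) = (\<integral>\<^sup>+y\<in>(\<Union>i\<in>C. ball (fst i) (snd i)). ennreal \<bar>f y\<bar> \<partial>gauss)"
    using C by (intro nn_integral_UN_countable) (auto simp: case_prod_beta')
  also have "\<dots> \<le> (\<integral>\<^sup>+x. ennreal \<bar>f x\<bar> \<partial>gauss)"
    by (intro nn_integral_mono) (auto split: split_indicator)
  finally show ?thesis by (simp add: mult_left_mono)
qed

text \<open>The part of \<open>f\<close> of height at most \<open>s\<close> contributes at most
  \<open>s\<close> to each average, so the high part has to supply the rest.\<close>

lemma frac_max_split_height:
  fixes f :: "'a::euclidean_space \<Rightarrow> real"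
  assumes [measurable]: "f \<in> borel_measurable gauss" and "0 \<le> s"
    and "ennreal (2 * s) < frac_max A 0 f x"
  shows "ennreal s < frac_max A 0 (\<lambda>y. if s < \<bar>f y\<bar> then f y else 0) x"
proof (rule ccontr)
  let ?f = "\<lambda>y. if s < \<bar>f y\<bar> then f y else 0"
  assume "\<not> ?thesis"
  then have *: "frac_max A 0 ?f x \<le> ennreal s" by simp
  have "frac_max A 0 f x \<le> ennreal (2 * s)"
    unfolding frac_max_le_iff
  proof safe
    fix c :: 'a and r assume cr: "admissible A c r" "x \<in> ball c r"
    have "ball_integral f c r \<le> ennreal 1 * ball_integral ?f c r + (\<integral>\<^sup>+y\<in>ball c r. ennreal s \<partial>gauss)"
      using \<open>0 \<le> s\<close> by (intro set_nn_integral_le_add) auto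
    also have "\<dots> = ball_integral ?f c r + ennreal s * emeasure gauss (ball c r)"
      by (simp add: nn_integral_cmult_indicator)
    also have "\<dots> \<le> ennreal s * emeasure gauss (ball c r) + ennreal s * emeasure gauss (ball c r)"
      using ball_integral_le_frac_max_0[OF cr, of ?f] *
      by (intro add_mono order_refl) (blast intro: order_trans mult_right_mono zero_le)
    also have "\<dots> = ennreal (2 * s) * ennreal (measure gauss (ball c r) powr (1 - 0))"
      using \<open>0 \<le> s\<close> by (simp add: emeasure_gauss_ball_eq flip: ennreal_mult ennreal_plus)
    finally show "ball_integral f c r \<le> ennreal (2 * s) * ennreal (measure gauss (ball c r) powr (1 - 0))" .
  qed
  with assms(3) show False by simp
qed

text \<open>Marcinkiewicz interpolation between weak type (1,1) and the trivial bound on bounded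
  functions, done by hand. At level \<open>pow2 k\<close> the weak type estimate is applied to the
  part of \<open>f\<close> above half that height; after Tonelli the levels below
  \<open>2 * \<bar>f x\<bar>\<close> form a geometric sum with exponent \<open>p - 1\<close>, which
  is where \<open>1 < p\<close> enters.\<close>

lemma hardy_littlewood:
  fixes A p :: real
  assumes "1 < p"
  obtains C where "0 < C" "\<And>f :: 'a::euclidean_space \<Rightarrow> real. f \<in> borel_measurable gauss \<Longrightarrow>
    (\<integral>\<^sup>+x. ennreal_powr (frac_max A 0 f x) p \<partial>gauss) \<le> ennreal C * (\<integral>\<^sup>+x. ennreal (\<bar>f x\<bar> powr p) \<partial>gauss)"
proof
  let ?D = "five_const TYPE('a) A" and ?G = "1 / (1 - 2 powr (- (p - 1)))"
  have q2: "2 powr (- (p - 1)) < 1" using assms powr_less_mono[of "- (p - 1)" 0 2] by simp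
  \<comment> \<open>In order: the change from \<open>pow2 (k + 1) powr p\<close> to half-level times
    \<open>pow2 k powr (p - 1)\<close>, the weak type constant, the geometric series, and the 2 in
    \<open>(2 * \<bar>f x\<bar>) powr (p - 1)\<close>.\<close>
  define C where "C = 2 powr (p + 1) * ?D * ?G * 2 powr (p - 1)"
  show "0 < C" using q2 five_const_pos[where 'a='a, of A] by (auto simp: C_def)
  fix f :: "'a \<Rightarrow> real"
  assume f [measurable]: "f \<in> borel_measurable gauss"
  let ?T = "\<lambda>k x. ennreal (2 powr (p + 1) * ?D * \<bar>f x\<bar>) *
    (ennreal (pow2 k powr (p - 1)) * indicator {k. ennreal (pow2 k) < ennreal (2 * \<bar>f x\<bar>)} k)"
  let ?L = "\<lambda>k. {x. ennreal (pow2 k) < frac_max A 0 f x}"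
  have lev [measurable]: "{x. ennreal s < frac_max A 0 g x} \<in> sets lebesgue" for s and g :: "'a \<Rightarrow> real"
    using borel_measurable_less[of "\<lambda>_. ennreal s" gauss "frac_max A 0 g"] by simp
  have weak: "ennreal (pow2 (k + 1) powr p) * emeasure gauss (?L k)
    \<le> (\<integral>\<^sup>+x. ?T k x \<partial>gauss)" for k
  proof -
    define s where "s = pow2 k / 2"
    have s: "0 < s" "2 * s = pow2 k" by (auto simp: s_def)
    let ?f = "\<lambda>y. if s < \<bar>f y\<bar> then f y else 0"
    have "?L k \<subseteq> {x. ennreal s < frac_max A 0 ?f x}"
      using frac_max_split_height[of f s A] s by auto
    then have "ennreal s * emeasure gauss (?L k) \<le>
      ennreal s * emeasure gauss {x. ennreal s < frac_max A 0 ?f x}"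
      using lev by (intro mult_left_mono emeasure_mono) auto
    also have "\<dots> \<le> ennreal ?D * (\<integral>\<^sup>+x. ennreal \<bar>?f x\<bar> \<partial>gauss)"
      by (rule frac_max_weak_type) measurable
    finally have *: "ennreal s * emeasure gauss (?L k) \<le> \<dots>" .
    have "pow2 (k + 1) powr p = 2 powr (p + 1) * pow2 k powr (p - 1) * s"
      by (simp add: pow2_def s_def powr_powr powr_add[symmetric] distrib_left distrib_right algebra_simps)
         (simp add: powr_add powr_diff field_simps)
    then have "ennreal (pow2 (k + 1) powr p) * emeasure gauss (?L k) =
      ennreal (2 powr (p + 1) * pow2 k powr (p - 1)) * (ennreal s * emeasure gauss (?L k))"
      using s by (simp add: ennreal_mult mult.assoc)
    also have "\<dots> \<le> ennreal (2 powr (p + 1) * pow2 k powr (p - 1)) * (ennreal ?D * (\<integral>\<^sup>+x. ennreal \<bar>?f x\<bar> \<partial>gauss))"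
      by (intro mult_left_mono *) auto
    also have "\<dots> = (\<integral>\<^sup>+x. ennreal (2 powr (p + 1) * pow2 k powr (p - 1)) * (ennreal ?D * ennreal \<bar>?f x\<bar>) \<partial>gauss)"
      by (simp add: nn_integral_cmult)
    also have "\<dots> = (\<integral>\<^sup>+x. ?T k x \<partial>gauss)"
    proof (intro nn_integral_cong)
      fix x
      have "ennreal (pow2 k) < ennreal (2 * \<bar>f x\<bar>) \<longleftrightarrow> s < \<bar>f x\<bar>"
        by (subst ennreal_less_iff) (auto simp: s_def less_imp_le)
      then show "ennreal (2 powr (p + 1) * pow2 k powr (p - 1)) * (ennreal ?D * ennreal \<bar>?f x\<bar>) =
        ?T k x"
        using five_const_pos[where 'a='a, of A]
        by (simp add: ennreal_mult mult_ac)
    qed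
    finally show ?thesis .
  qed
  have "(\<integral>\<^sup>+x. ennreal_powr (frac_max A 0 f x) p \<partial>gauss) \<le>
    (\<integral>\<^sup>+x. \<integral>\<^sup>+k. ennreal (pow2 (k + 1) powr p) * indicator (?L k) x \<partial>count_space UNIV \<partial>gauss)"
    using assms
    by (intro nn_integral_mono order_trans[OF ennreal_powr_le_dyadic_sum[of p]])
       (auto simp: indicator_def)
  also have "\<dots> = (\<integral>\<^sup>+k. \<integral>\<^sup>+x. ennreal (pow2 (k + 1) powr p) * indicator (?L k) x \<partial>gauss \<partial>count_space UNIV)"
    by (intro nn_integral_count_space_nn_integral) auto
  also have "\<dots> = (\<integral>\<^sup>+k. ennreal (pow2 (k + 1) powr p) * emeasure gauss (?L k) \<partial>count_space UNIV)"
    by (intro nn_integral_cong nn_integral_cmult_indicator) auto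
  also have "\<dots> \<le> (\<integral>\<^sup>+k. (\<integral>\<^sup>+x. ?T k x \<partial>gauss) \<partial>count_space UNIV)"
    by (intro nn_integral_mono weak)
  also have "\<dots> = (\<integral>\<^sup>+x. (\<integral>\<^sup>+k. ?T k x \<partial>count_space UNIV) \<partial>gauss)"
  proof (intro nn_integral_count_space_nn_integral [symmetric])
    fix k
    have "(\<lambda>x. ennreal (2 powr (p + 1) * ?D * \<bar>f x\<bar>) * (ennreal (pow2 k powr (p - 1)) *
        indicator {x. ennreal (pow2 k) < ennreal (2 * \<bar>f x\<bar>)} x)) \<in> borel_measurable gauss"
      by measurable
    then show "(\<lambda>x. ennreal (2 powr (p + 1) * ?D * \<bar>f x\<bar>) * (ennreal (pow2 k powr (p - 1)) *
        indicator {k. ennreal (pow2 k) < ennreal (2 * \<bar>f x\<bar>)} k)) \<in> borel_measurable gauss"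
      by (simp add: indicator_def)
  qed simp
  also have "\<dots> \<le> (\<integral>\<^sup>+x. ennreal C * ennreal (\<bar>f x\<bar> powr p) \<partial>gauss)"
  proof (intro nn_integral_mono)
    fix x
    have "(\<integral>\<^sup>+k. ?T k x \<partial>count_space UNIV)
      \<le> ennreal (2 powr (p + 1) * ?D * \<bar>f x\<bar>) * (ennreal ?G * ennreal_powr (ennreal (2 * \<bar>f x\<bar>)) (p - 1))"
      using assms dyadic_sum_le_ennreal_powr[of "p - 1" "ennreal (2 * \<bar>f x\<bar>)"]
      by (subst nn_integral_cmult) (auto intro: mult_left_mono)
    also have "\<dots> = ennreal (2 powr (p + 1) * ?D * \<bar>f x\<bar> * (?G * (2 * \<bar>f x\<bar>) powr (p - 1)))"
      using q2 five_const_pos[where 'a='a, of A] by (simp add: ennreal_powr_ennreal flip: ennreal_mult)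
    also have "2 powr (p + 1) * ?D * \<bar>f x\<bar> * (?G * (2 * \<bar>f x\<bar>) powr (p - 1)) = C * (\<bar>f x\<bar> powr p)"
      by (cases "f x = 0") (auto simp: C_def powr_mult powr_diff)
    also have "ennreal (C * (\<bar>f x\<bar> powr p)) = ennreal C * ennreal (\<bar>f x\<bar> powr p)"
      using \<open>0 < C\<close> by (simp add: ennreal_mult)
    finally show "(\<integral>\<^sup>+k. ?T k x \<partial>count_space UNIV)
      \<le> ennreal C * ennreal (\<bar>f x\<bar> powr p)" .
  qed
  also have "\<dots> = ennreal C * (\<integral>\<^sup>+x. ennreal (\<bar>f x\<bar> powr p) \<partial>gauss)"
    by (simp add: nn_integral_cmult)
  finally show "(\<integral>\<^sup>+x. ennreal_powr (frac_max A 0 f x) p \<partial>gauss) \<le> ennreal C * (\<integral>\<^sup>+x. ennreal (\<bar>f x\<bar> powr p) \<partial>gauss)" .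
qed

lemma ball_integral_le_powr:
  fixes f :: "'a::euclidean_space \<Rightarrow> real"
  assumes [measurable]: "f \<in> borel_measurable gauss" and p: "1 < p"
  shows "ball_integral f c r \<le>
    ennreal (2 * measure gauss (ball c r) powr (1 - 1 / p)) * ennreal_powr (\<integral>\<^sup>+x. ennreal (\<bar>f x\<bar> powr p) \<partial>gauss) (1 / p)"
proof -
  define s' where "s' = p / (p - 1)"
  have s': "1 < s'" "1 / p + 1 / s' = 1" "1 / s' = 1 - 1 / p" using p by (auto simp: s'_def field_simps)
  have "ball_integral f c r = (\<integral>\<^sup>+x. ennreal (indicator (ball c r) x * \<bar>f x\<bar>) \<partial>gauss)"
    by (intro nn_integral_cong) (auto split: split_indicator)
  also have "\<dots> \<le> 2 * ennreal_powr (\<integral>\<^sup>+x. ennreal (indicator (ball c r) x powr s') \<partial>gauss) (1 / s')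
      * ennreal_powr (\<integral>\<^sup>+x. ennreal (\<bar>f x\<bar> powr p) \<partial>gauss) (1 / p)"
    using p s' by (intro nn_integral_mult_le_powr) auto
  also have "(\<integral>\<^sup>+x. ennreal (indicator (ball c r) x powr s') \<partial>gauss) = (\<integral>\<^sup>+x. indicator (ball c r) x \<partial>gauss)"
    by (intro nn_integral_cong) (auto split: split_indicator)
  finally show ?thesis
    by (simp add: ennreal_powr_gauss_ball s' ennreal_mult)
qed

text \<open>The ball integral itself is interpolated: its power \<theta> = \<open>p / q\<close> is
  bounded by the maximal function, its power 1 - \<theta> by Hoelder. Since (1 - \<theta>) /
  \<open>p\<close> = \<beta>, the powers of the measure of the ball combine to exactly 1 -
  \<beta>.\<close>

lemma frac_max_hedberg:
  fixes f :: "'a::euclidean_space \<Rightarrow> real"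
  assumes [measurable]: "f \<in> borel_measurable gauss" and p: "1 < p" "p < q" "1 / q = 1 / p - \<beta>"
  shows "frac_max A \<beta> f x \<le> 2 * ennreal_powr (frac_max A 0 f x) (p / q)
    * ennreal_powr (\<integral>\<^sup>+x. ennreal (\<bar>f x\<bar> powr p) \<partial>gauss) \<beta>"
  unfolding frac_max_le_iff
proof safe
  let ?I = "\<integral>\<^sup>+x. ennreal (\<bar>f x\<bar> powr p) \<partial>gauss"
  fix c :: 'a and r assume cr: "admissible A c r" "x \<in> ball c r"
  let ?J = "ball_integral f c r" and ?g = "measure gauss (ball c r)" and ?m = "frac_max A 0 f x"
  define \<theta> where "\<theta> = p / q"
  have \<theta>: "0 < \<theta>" "\<theta> < 1" using p by (auto simp: \<theta>_def)
  have \<theta>p: "(1 - \<theta>) / p = \<beta>" using p by (simp add: \<theta>_def field_simps)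
  have g: "0 < ?g" using cr by (intro measure_gauss_ball_pos) (auto simp: admissible_def)
  have "?J = ennreal_powr ?J (\<theta> + (1 - \<theta>))" by simp
  also have "\<dots> = ennreal_powr ?J \<theta> * ennreal_powr ?J (1 - \<theta>)"
    using \<theta> by (intro ennreal_powr_add_exponent) auto
  also have "\<dots> \<le> ennreal_powr (?m * ennreal ?g) \<theta> *
      ennreal_powr (ennreal (2 * ?g powr (1 - 1 / p)) * ennreal_powr ?I (1 / p)) (1 - \<theta>)"
    using \<theta> p ball_integral_le_frac_max_0[OF cr, of f]
    by (intro mult_mono ennreal_powr_mono ball_integral_le_powr) (auto simp: emeasure_gauss_ball_eq)
  also have "\<dots> = (ennreal_powr ?m \<theta> * ennreal (?g powr \<theta>)) *
      (ennreal ((2 * ?g powr (1 - 1 / p)) powr (1 - \<theta>)) * ennreal_powr ?I \<beta>)"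
    using g by (simp add: ennreal_powr_mult ennreal_powr_powr ennreal_powr_ennreal \<theta>p flip: ennreal_mult)
  also have "\<dots> = ennreal_powr ?m \<theta> * ennreal_powr ?I \<beta> *
      ennreal (?g powr \<theta> * (2 * ?g powr (1 - 1 / p)) powr (1 - \<theta>))"
    using g by (simp add: ennreal_mult mult_ac)
  also have "\<dots> \<le> ennreal_powr ?m \<theta> * ennreal_powr ?I \<beta> * ennreal (2 * ?g powr (1 - \<beta>))"
  proof (intro mult_left_mono ennreal_leI)
    have "?g powr \<theta> * (2 * ?g powr (1 - 1 / p)) powr (1 - \<theta>) = 2 powr (1 - \<theta>) * ?g powr (\<theta> + (1 - 1 / p) * (1 - \<theta>))"
      using g by (simp add: powr_mult powr_powr powr_add)
    also have "\<theta> + (1 - 1 / p) * (1 - \<theta>) = 1 - \<beta>"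
      using \<theta>p by (simp add: left_diff_distrib)
    also have "2 powr (1 - \<theta>) \<le> 2 powr 1" using \<theta> by (intro powr_mono) auto
    finally show "?g powr \<theta> * (2 * ?g powr (1 - 1 / p)) powr (1 - \<theta>) \<le> 2 * ?g powr (1 - \<beta>)"
      by (simp add: mult_right_mono)
  qed simp
  finally show "?J \<le> 2 * ennreal_powr ?m (p / q) * ennreal_powr ?I \<beta> * ennreal (?g powr (1 - \<beta>))"
    by (simp add: \<theta>_def ennreal_mult mult_ac)
qed

text \<open>The \<open>q\<close>-th power of Hedberg's bound contains the maximal function to the
  power \<open>p\<close>, to which the Hardy--Littlewood inequality applies; the exponents of the
  remaining norms add up through \<open>1 + \<beta> * q = q / p\<close>.\<close>

lemma hardy_littlewood_sobolev:
  fixes A \<beta> p q :: real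
  assumes p: "1 < p" "p < q" "1 / q = 1 / p - \<beta>"
  obtains C where "0 < C" "\<And>f :: 'a::euclidean_space \<Rightarrow> real. f \<in> borel_measurable gauss \<Longrightarrow>
    (\<integral>\<^sup>+x. ennreal_powr (frac_max A \<beta> f x) q \<partial>gauss)
      \<le> ennreal C * ennreal_powr (\<integral>\<^sup>+x. ennreal (\<bar>f x\<bar> powr p) \<partial>gauss) (q / p)"
proof -
  obtain C where C: "0 < C" "\<And>f :: 'a \<Rightarrow> real. f \<in> borel_measurable gauss \<Longrightarrow>
    (\<integral>\<^sup>+x. ennreal_powr (frac_max A 0 f x) p \<partial>gauss) \<le> ennreal C * (\<integral>\<^sup>+x. ennreal (\<bar>f x\<bar> powr p) \<partial>gauss)"
    using hardy_littlewood[OF p(1)] by metis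
  show ?thesis
  proof (rule that[of "2 powr q * C"])
    fix f :: "'a \<Rightarrow> real" assume f [measurable]: "f \<in> borel_measurable gauss"
    let ?I = "\<integral>\<^sup>+x. ennreal (\<bar>f x\<bar> powr p) \<partial>gauss"
    have bq: "1 + \<beta> * q = q / p" "0 \<le> \<beta> * q"
    proof -
      have \<beta>: "\<beta> = 1 / p - 1 / q" using p by simp
      have "1 / q \<le> 1 / p" using p by (intro divide_left_mono) auto
      then show "0 \<le> \<beta> * q" using p(1,2) \<beta> by simp
      show "1 + \<beta> * q = q / p" unfolding \<beta> using p(1,2) by (simp add: field_simps)
    qed
    have "(\<integral>\<^sup>+x. ennreal_powr (frac_max A \<beta> f x) q \<partial>gauss) \<le>
      (\<integral>\<^sup>+x. ennreal_powr (2 * ennreal_powr (frac_max A 0 f x) (p / q) * ennreal_powr ?I \<beta>) q \<partial>gauss)"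
      using p by (intro nn_integral_mono ennreal_powr_mono frac_max_hedberg) auto
    also have "\<dots> = (\<integral>\<^sup>+x. (ennreal (2 powr q) * ennreal_powr ?I (\<beta> * q)) * ennreal_powr (frac_max A 0 f x) p \<partial>gauss)"
    proof -
      have "ennreal_powr 2 q = ennreal (2 powr q)" using ennreal_powr_ennreal[of 2 q] by simp
      then show ?thesis
        using p by (intro nn_integral_cong) (simp add: ennreal_powr_mult ennreal_powr_powr mult_ac)
    qed
    also have "\<dots> = (ennreal (2 powr q) * ennreal_powr ?I (\<beta> * q)) * (\<integral>\<^sup>+x. ennreal_powr (frac_max A 0 f x) p \<partial>gauss)"
      by (rule nn_integral_cmult) measurable
    also have "\<dots> \<le> (ennreal (2 powr q) * ennreal_powr ?I (\<beta> * q)) * (ennreal C * ?I)"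
      by (intro mult_left_mono C) auto
    also have "\<dots> = ennreal (2 powr q * C) * (ennreal_powr ?I 1 * ennreal_powr ?I (\<beta> * q))"
      using C by (simp add: ennreal_mult mult_ac)
    also have "ennreal_powr ?I 1 * ennreal_powr ?I (\<beta> * q) = ennreal_powr ?I (q / p)"
      using bq by (subst ennreal_powr_add_exponent [symmetric]) auto
    finally show "(\<integral>\<^sup>+x. ennreal_powr (frac_max A \<beta> f x) q \<partial>gauss) \<le> ennreal (2 powr q * C) * ennreal_powr ?I (q / p)" .
  qed (use C in auto)
qed

section \<open>Mean oscillation over larger admissible balls\<close>

text \<open>Not normalised, and with a free constant \<open>k\<close>: averages of different balls
  are compared by changing \<open>k\<close> and the ball independently.\<close>

definition deviation :: "('a::euclidean_space \<Rightarrow> real) \<Rightarrow> real \<Rightarrow> 'a \<Rightarrow> real \<Rightarrow> real" where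
  "deviation b k c r = (LINT x:ball c r|gauss. \<bar>b x - k\<bar>)"

lemma set_integrable_gauss_ball:
  fixes b :: "'a::euclidean_space \<Rightarrow> real"
  assumes "integrable gauss b"
  shows "set_integrable gauss (ball c r) b"
  unfolding set_integrable_def
  using ball_in_sets_gauss assms by (rule integrable_mult_indicator)

lemma set_integrable_gauss_ball_const: "set_integrable gauss (ball c r) (\<lambda>x. k :: real)"
  unfolding set_integrable_def using emeasure_gauss_ball_finite[of c r]
  by (simp add: integrable_indicator_iff)

lemma set_integrable_deviation:
  fixes b :: "'a::euclidean_space \<Rightarrow> real"
  assumes "integrable gauss b"
  shows "set_integrable gauss (ball c r) (\<lambda>x. \<bar>b x - k\<bar>)"
  by (rule set_integrable_abs, rule set_integral_diff(1))
    (rule set_integrable_gauss_ball set_integrable_gauss_ball_const assms)+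

lemma deviation_nonneg: "0 \<le> deviation b k c r"
  unfolding deviation_def set_lebesgue_integral_def by (intro integral_nonneg_AE) auto

lemma nn_integral_deviation:
  assumes "integrable gauss b"
  shows "(\<integral>\<^sup>+x\<in>ball c r. ennreal \<bar>b x - k\<bar> \<partial>gauss) = ennreal (deviation b k c r)"
proof -
  have "(\<integral>\<^sup>+x\<in>ball c r. ennreal \<bar>b x - k\<bar> \<partial>gauss) =
      (\<integral>\<^sup>+x. ennreal (indicator (ball c r) x *\<^sub>R \<bar>b x - k\<bar>) \<partial>gauss)"
    by (intro nn_integral_cong) (auto split: split_indicator)
  also have "\<dots> = ennreal (deviation b k c r)"
    unfolding deviation_def set_lebesgue_integral_def
    using set_integrable_deviation[OF assms, of c r k]
    by (intro nn_integral_eq_integral) (auto simp: set_integrable_def)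
  finally show ?thesis .
qed

lemma deviation_subset:
  assumes "integrable gauss b" "ball c r \<subseteq> ball c' r'"
  shows "deviation b k c r \<le> deviation b k c' r'"
proof -
  have "ennreal (deviation b k c r) \<le> ennreal (deviation b k c' r')"
    unfolding nn_integral_deviation[OF assms(1), symmetric]
    using assms(2) by (intro nn_integral_mono) (auto split: split_indicator)
  then show ?thesis using deviation_nonneg[of b k c' r'] by (simp add: ennreal_le_iff)
qed

lemma deviation_shift:
  assumes "integrable gauss b"
  shows "deviation b k c r \<le> deviation b l c r + \<bar>l - k\<bar> * measure gauss (ball c r)"
proof -
  have "deviation b k c r \<le> (LINT x:ball c r|gauss. \<bar>b x - l\<bar> + \<bar>l - k\<bar>)"
    unfolding deviation_def
    by (rule set_integral_mono, rule set_integrable_deviation[OF assms], rule set_integral_add(1))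
      (auto intro: set_integrable_deviation[OF assms] set_integrable_gauss_ball_const)
  also have "\<dots> = deviation b l c r + (LINT x:ball c r|gauss. \<bar>l - k\<bar>)"
    unfolding deviation_def
    by (rule set_integral_add(2)) (rule set_integrable_deviation[OF assms] set_integrable_gauss_ball_const)+
  also have "(LINT x:ball c r|gauss. \<bar>l - k\<bar>) = \<bar>l - k\<bar> * measure gauss (ball c r)"
    unfolding set_lebesgue_integral_def by simp
  finally show ?thesis .
qed

lemma ball_avg_deviation:
  assumes b: "integrable gauss b" and "0 < r"
  shows "\<bar>ball_avg b (ball c r) - k\<bar> * measure gauss (ball c r) \<le> deviation b k c r"
proof -
  let ?g = "measure gauss (ball c r)"
  have g: "0 < ?g" by (rule measure_gauss_ball_pos[OF assms(2)])
  have "(LINT x:ball c r|gauss. b x - k) = (LINT x:ball c r|gauss. b x) - (LINT x:ball c r|gauss. k)"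
    by (rule set_integral_diff(2)) (rule set_integrable_gauss_ball[OF b] set_integrable_gauss_ball_const)+
  also have "(LINT x:ball c r|gauss. k) = k * ?g"
    unfolding set_lebesgue_integral_def by simp
  finally have "(ball_avg b (ball c r) - k) * ?g = (LINT x:ball c r|gauss. b x - k)"
    using g by (simp add: ball_avg_def left_diff_distrib)
  then have "\<bar>ball_avg b (ball c r) - k\<bar> * ?g = \<bar>LINT x:ball c r|gauss. b x - k\<bar>"
    using g by (metis abs_mult abs_of_pos)
  also have "\<dots> \<le> deviation b k c r"
    using integral_norm_bound[of gauss "\<lambda>x. indicator (ball c r) x *\<^sub>R (b x - k)"]
    unfolding deviation_def set_lebesgue_integral_def by (simp add: abs_mult)
  finally show ?thesis .
qed

text \<open>Up to the factor 2 the average is the best constant, so it is enough to bound the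
  oscillation about any convenient constant.\<close>

lemma deviation_ball_avg:
  assumes "integrable gauss b" "0 < r"
  shows "deviation b (ball_avg b (ball c r)) c r \<le> 2 * deviation b k c r"
  using deviation_shift[OF assms(1), of "ball_avg b (ball c r)" c r k] ball_avg_deviation[OF assms, of c k]
  by (simp add: abs_minus_commute)

text \<open>A real, division-free form of the bound on the seminorm. The parameter \<open>A\<close>
  allows families of balls other than the one with \<open>A = 1\<close> that defines the
  seminorm.\<close>

definition bmo_le :: "real \<Rightarrow> real \<Rightarrow> ('a::euclidean_space \<Rightarrow> real) \<Rightarrow> bool" where
  "bmo_le A S b \<longleftrightarrow> integrable gauss b \<and>
    (\<forall>c r. admissible A c r \<longrightarrow> deviation b (ball_avg b (ball c r)) c r \<le> S * measure gauss (ball c r))"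

lemma bmo_leD:
  assumes "bmo_le A S b"
  shows "integrable gauss b"
    "admissible A c r \<Longrightarrow> deviation b (ball_avg b (ball c r)) c r \<le> S * measure gauss (ball c r)"
  using assms by (auto simp: bmo_le_def)

text \<open>Compactness is used once, for the unit ball; scaling and translating the same cover
  makes the number of small balls independent of \<open>c\<close> and \<open>r\<close>.\<close>

lemma unit_ball_finite_cover:
  assumes "0 < \<epsilon>"
  obtains F :: "'a::euclidean_space set" where "finite F" "F \<subseteq> cball 0 1"
    "\<And>c r. 0 < r \<Longrightarrow> ball c r \<subseteq> (\<Union>z\<in>F. ball (c + r *\<^sub>R z) (\<epsilon> * r))"
proof -
  have cov: "cball (0::'a) 1 \<subseteq> (\<Union>z\<in>cball 0 1. ball z \<epsilon>)" using assms by force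
  obtain F where F: "F \<subseteq> cball (0::'a) 1" "finite F" "cball 0 1 \<subseteq> (\<Union>z\<in>F. ball z \<epsilon>)"
    by (rule compactE_image[OF compact_cball _ cov]) auto
  show ?thesis
  proof (rule that[OF F(2,1)])
    fix c :: 'a and r :: real assume r: "0 < r"
    show "ball c r \<subseteq> (\<Union>z\<in>F. ball (c + r *\<^sub>R z) (\<epsilon> * r))"
    proof
      fix x assume x: "x \<in> ball c r"
      define u where "u = (x - c) /\<^sub>R r"
      have xu: "x = c + r *\<^sub>R u" using r by (simp add: u_def)
      have "norm u = norm (x - c) / r" using r by (simp add: u_def divide_inverse mult.commute)
      moreover have "norm (x - c) < r" using x by (simp add: dist_norm norm_minus_commute)
      ultimately have "u \<in> cball 0 1" using r by simp
      then obtain z where z: "z \<in> F" "dist z u < \<epsilon>" using F(3) by auto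
      have "dist (c + r *\<^sub>R z) x = r * dist z u"
        using r by (simp add: xu dist_norm flip: scaleR_diff_right)
      then have "dist (c + r *\<^sub>R z) x < \<epsilon> * r" using z r by (simp add: mult.commute)
      then show "x \<in> (\<Union>z\<in>F. ball (c + r *\<^sub>R z) (\<epsilon> * r))" using z by auto
    qed
  qed
qed

text \<open>A ball that is too large for the family is filled by balls of comparable radius that belong to it;
  consecutive averages along a chain of overlapping small balls differ by a multiple of the seminorm.\<close>

lemma bmo_le_enlarge:
  assumes "0 < a" "0 < A"
  obtains C where "0 < C" "\<And>b :: 'a::euclidean_space \<Rightarrow> real. \<And>S. 0 \<le> S \<Longrightarrow> bmo_le a S b \<Longrightarrow> bmo_le A (C * S) b"
proof -
  \<comment> \<open>By \<open>admissible_move\<close> a ball of radius \<open>r\<close> about any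
    point of the original ball has parameter \<open>A * (1 + A)\<close>; shrinking the radius by
    \<open>k\<close> brings this down to \<open>a\<close>. The small balls get half that radius, so
    that their doubles are still in the family.\<close>
  define k where "k = min 1 (a / (A * (1 + A)))"
  define \<epsilon> where "\<epsilon> = k / 2"
  have k: "0 < k" "k \<le> 1" "k * (A * (1 + A)) \<le> a" and \<epsilon>: "0 < \<epsilon>" "2 * \<epsilon> = k"
  proof -
    show "0 < k" "k \<le> 1" using assms by (auto simp: k_def)
    then show "0 < \<epsilon>" "2 * \<epsilon> = k" by (auto simp: \<epsilon>_def)
    have "k \<le> a / (A * (1 + A))" by (simp add: k_def)
    then show "k * (A * (1 + A)) \<le> a" using assms by (subst (asm) pos_le_divide_eq) auto
  qed
  obtain F :: "'a set" where F: "finite F" "F \<subseteq> cball 0 1"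
    "\<And>c r. 0 < r \<Longrightarrow> ball c r \<subseteq> (\<Union>z\<in>F. ball (c + r *\<^sub>R z) (\<epsilon> * r))"
    using unit_ball_finite_cover[OF \<epsilon>(1)] by metis
  define D where "D = doubling_const (2 * A)"
  define D1 where "D1 = D * 2 ^ DIM('a)"
  have D: "0 < D" "0 < D1" by (auto simp: D_def D1_def doubling_const_pos)
  \<comment> \<open>Number of links in a chain from the centre to another point of the ball: each
    link is then no longer than the radius \<open>\<epsilon> * r\<close> of the small balls.\<close>
  define N where "N = nat \<lceil>1 / \<epsilon>\<rceil>"
  have N: "0 < N" "1 / real N \<le> \<epsilon>"
  proof -
    have "1 / \<epsilon> \<le> real N" unfolding N_def by linarith
    moreover have "0 < 1 / \<epsilon>" using \<epsilon> by simp
    ultimately have "0 < real N" by linarith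
    then show "0 < N" by simp
    then show "1 / real N \<le> \<epsilon>" using \<open>1 / \<epsilon> \<le> real N\<close> \<epsilon> by (simp add: field_simps)
  qed
  \<comment> \<open>Each of the \<open>card F\<close> covering balls contributes its own oscillation
    (the summand 1) and the drift of averages along its chain, with \<open>D\<close> comparing
    measures. The leading 2 is for recentring at the average, and the final 1 makes \<open>C\<close>
    positive.\<close>
  define C where "C = 2 * (real (card F) * (1 + real N * (2 * D1)) * D) + 1"
  show ?thesis
  proof (rule that)
    show "0 < C" using D by (auto simp: C_def intro!: add_nonneg_pos)
    fix b :: "'a \<Rightarrow> real" and S assume S: "0 \<le> S" and bmo: "bmo_le a S b"
    note int = bmo_leD(1)[OF bmo]
    show "bmo_le A (C * S) b"
      unfolding bmo_le_def
    proof (intro conjI allI impI int)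
      fix c :: 'a and r assume adm: "admissible A c r"
      have r: "0 < r" using adm by (simp add: admissible_def)
      define \<delta> where "\<delta> = \<epsilon> * r"
      have \<delta>: "0 < \<delta>" "2 * \<delta> \<le> r"
      proof -
        show "0 < \<delta>" using \<epsilon> r by (simp add: \<delta>_def)
        have "2 * \<delta> = k * r" using \<epsilon> by (simp add: \<delta>_def)
        also have "\<dots> \<le> 1 * r" using k r by (intro mult_right_mono) auto
        finally show "2 * \<delta> \<le> r" by simp
      qed
      have adm2: "admissible a y (2 * \<delta>)" if "y \<in> cball c r" for y
      proof -
        have "admissible (k * (A * (1 + A))) y (k * r)"
          using admissible_move[OF adm] that k by (intro admissible_scale) auto
        then have "admissible a y (k * r)" using k by (rule_tac admissible_mono) auto
        also have "k * r = 2 * \<delta>" using \<epsilon> by (simp add: \<delta>_def)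
        finally show ?thesis .
      qed
      have sub: "ball y (2 * \<delta>) \<subseteq> ball c (2 * r)" "ball y \<delta> \<subseteq> ball c (2 * r)" if "y \<in> cball c r" for y
      proof -
        have "ball y s \<subseteq> ball c (2 * r)" if "s \<le> r" for s
        proof
          fix x assume "x \<in> ball y s"
          then show "x \<in> ball c (2 * r)"
            using that \<open>y \<in> cball c r\<close> dist_triangle[of c x y] by auto
        qed
        then show "ball y (2 * \<delta>) \<subseteq> ball c (2 * r)" "ball y \<delta> \<subseteq> ball c (2 * r)" using \<delta> by auto
      qed
      have adm2A: "admissible (2 * A) c (2 * r)" using adm by (intro admissible_scale) auto
      let ?av = "\<lambda>y s. ball_avg b (ball y s)"
      \<comment> \<open>A small ball whose centre is within \<open>\<delta>\<close> of
        \<open>y\<close> lies in the doubled ball about \<open>y\<close>. Two neighbouring averages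
        are compared through the average on that doubled ball.\<close>
      have half: "\<bar>?av z \<delta> - ?av y (2 * \<delta>)\<bar> \<le> D1 * S"
        if "y \<in> cball c r" "z \<in> cball c r" "dist y z \<le> \<delta>" for y z
      proof -
        let ?g = "measure gauss (ball z \<delta>)"
        have "ball z \<delta> \<subseteq> ball y (2 * \<delta>)"
        proof
          fix x assume "x \<in> ball z \<delta>"
          then show "x \<in> ball y (2 * \<delta>)" using that(3) dist_triangle[of y x z] by auto
        qed
        then have "deviation b (?av y (2 * \<delta>)) z \<delta> \<le> deviation b (?av y (2 * \<delta>)) y (2 * \<delta>)"
          by (rule deviation_subset[OF int])
        also have "\<dots> \<le> S * measure gauss (ball y (2 * \<delta>))"
          using adm2[OF that(1)] by (rule bmo_leD(2)[OF bmo])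
        also have "\<dots> \<le> S * (D * (2 * \<delta> / \<delta>) ^ DIM('a) * ?g)"
          using \<delta> S unfolding D_def
          by (intro mult_left_mono gauss_ball_compare[OF adm2A] sub that) auto
        also have "\<dots> = D1 * S * ?g" using \<delta> by (simp add: D1_def)
        finally have "\<bar>?av z \<delta> - ?av y (2 * \<delta>)\<bar> * ?g \<le> D1 * S * ?g"
          using ball_avg_deviation[OF int \<delta>(1), of z "?av y (2 * \<delta>)"] by linarith
        then show ?thesis
          using measure_gauss_ball_pos[OF \<delta>(1), of z] by (simp add: mult_le_cancel_right_pos)
      qed
      have step: "\<bar>?av z \<delta> - ?av y \<delta>\<bar> \<le> 2 * D1 * S"
        if "y \<in> cball c r" "z \<in> cball c r" "dist y z \<le> \<delta>" for y z
        using half[OF that] half[OF that(1,1)] \<delta> by simp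
      have chain: "\<bar>?av y \<delta> - ?av c \<delta>\<bar> \<le> real N * (2 * D1 * S)" if y: "y \<in> cball c r" for y
      proof -
        define p where "p i = c + (real i / real N) *\<^sub>R (y - c)" for i :: nat
        have p: "p i \<in> cball c r" if "i \<le> N" for i
        proof -
          have "dist c (p i) = real i / real N * dist c y"
            by (simp add: p_def dist_norm norm_minus_commute)
          also have "\<dots> \<le> 1 * r" using y that N by (intro mult_mono) auto
          finally show ?thesis by simp
        qed
        have "\<bar>?av (p i) \<delta> - ?av c \<delta>\<bar> \<le> real i * (2 * D1 * S)" if "i \<le> N" for i
          using that
        proof (induction i)
          case 0
          then show ?case by (simp add: p_def)
        next
          case (Suc i)
          have "p (Suc i) - p i = (1 / real N) *\<^sub>R (y - c)"
            by (simp add: p_def add_divide_distrib scaleR_add_left)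
          then have "dist (p i) (p (Suc i)) = 1 / real N * dist c y"
            by (metis abs_of_nonneg dist_commute dist_norm norm_scaleR of_nat_0_le_iff zero_le_divide_1_iff)
          also have "\<dots> \<le> \<epsilon> * r" using y N \<epsilon> by (intro mult_mono) auto
          finally have "\<bar>?av (p (Suc i)) \<delta> - ?av (p i) \<delta>\<bar> \<le> 2 * D1 * S"
            using Suc.prems by (intro step p) (auto simp: \<delta>_def)
          then show ?case using Suc by (simp add: algebra_simps)
        qed
        from this[of N] show ?thesis using N by (simp add: p_def)
      qed
      let ?K = "?av c \<delta>"
      have mem: "c + r *\<^sub>R z \<in> cball c r" if "z \<in> F" for z
        using subsetD[OF F(2) that] r by (simp add: dist_norm)
      have piece: "deviation b ?K (c + r *\<^sub>R z) \<delta> \<le> (1 + real N * (2 * D1)) * S * (D * measure gauss (ball c r))"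
        if "z \<in> F" for z
      proof -
        let ?y = "c + r *\<^sub>R z"
        have "deviation b ?K ?y \<delta> \<le> deviation b (?av ?y \<delta>) ?y \<delta> + \<bar>?av ?y \<delta> - ?K\<bar> * measure gauss (ball ?y \<delta>)"
          by (rule deviation_shift[OF int])
        also have "\<dots> \<le> S * measure gauss (ball ?y \<delta>) + real N * (2 * D1 * S) * measure gauss (ball ?y \<delta>)"
          using \<delta> that
          by (intro add_mono mult_right_mono chain mem bmo_leD(2)[OF bmo] admissible_radius_mono[OF adm2]) auto
        also have "\<dots> = (1 + real N * (2 * D1)) * S * measure gauss (ball ?y \<delta>)"
          by (simp add: algebra_simps)
        also have "\<dots> \<le> (1 + real N * (2 * D1)) * S * (D * measure gauss (ball c r))"
        proof (intro mult_left_mono)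
          have "measure gauss (ball ?y \<delta>) \<le> D * (\<delta> / r) ^ DIM('a) * measure gauss (ball c r)"
            unfolding D_def using \<delta> r by (intro gauss_ball_compare[OF adm2A] sub mem that) auto
          also have "\<dots> \<le> D * 1 * measure gauss (ball c r)"
            using D \<delta> r by (intro mult_right_mono mult_left_mono power_le_one) auto
          finally show "measure gauss (ball ?y \<delta>) \<le> D * measure gauss (ball c r)" by simp
        qed (use S D in auto)
        finally show ?thesis .
      qed
      have "ennreal (deviation b ?K c r) = (\<integral>\<^sup>+x\<in>ball c r. ennreal \<bar>b x - ?K\<bar> \<partial>gauss)"
        by (rule nn_integral_deviation[OF int, symmetric])
      also have "\<dots> \<le> (\<integral>\<^sup>+x. (\<Sum>z\<in>F. ennreal \<bar>b x - ?K\<bar> * indicator (ball (c + r *\<^sub>R z) \<delta>) x) \<partial>gauss)"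
      proof (intro nn_integral_mono)
        fix x
        show "ennreal \<bar>b x - ?K\<bar> * indicator (ball c r) x \<le>
          (\<Sum>z\<in>F. ennreal \<bar>b x - ?K\<bar> * indicator (ball (c + r *\<^sub>R z) \<delta>) x)"
        proof (cases "x \<in> ball c r")
          case True
          then obtain z where z: "z \<in> F" "x \<in> ball (c + r *\<^sub>R z) \<delta>"
            using F(3)[OF r, of c] unfolding \<delta>_def by blast
          then have "ennreal \<bar>b x - ?K\<bar> * indicator (ball c r) x =
              ennreal \<bar>b x - ?K\<bar> * indicator (ball (c + r *\<^sub>R z) \<delta>) x"
            using True by simp
          also have "\<dots> \<le> (\<Sum>z\<in>F. ennreal \<bar>b x - ?K\<bar> * indicator (ball (c + r *\<^sub>R z) \<delta>) x)"
            using z F(1) by (intro member_le_sum) auto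
          finally show ?thesis .
        qed simp
      qed
      also have "\<dots> = (\<Sum>z\<in>F. \<integral>\<^sup>+x. ennreal \<bar>b x - ?K\<bar> * indicator (ball (c + r *\<^sub>R z) \<delta>) x \<partial>gauss)"
        using borel_measurable_integrable[OF int] by (intro nn_integral_sum) auto
      also have "\<dots> = (\<Sum>z\<in>F. ennreal (deviation b ?K (c + r *\<^sub>R z) \<delta>))"
        by (simp only: nn_integral_deviation[OF int])
      also have "\<dots> = ennreal (\<Sum>z\<in>F. deviation b ?K (c + r *\<^sub>R z) \<delta>)"
        by (simp add: deviation_nonneg)
      finally have "deviation b ?K c r \<le> (\<Sum>z\<in>F. deviation b ?K (c + r *\<^sub>R z) \<delta>)"
        by (simp add: ennreal_le_iff sum_nonneg deviation_nonneg)
      also have "\<dots> \<le> (\<Sum>z\<in>F. (1 + real N * (2 * D1)) * S * (D * measure gauss (ball c r)))"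
        by (intro sum_mono piece)
      also have "\<dots> = real (card F) * (1 + real N * (2 * D1)) * D * S * measure gauss (ball c r)"
        by simp
      finally have "deviation b (?av c r) c r \<le> 2 * (real (card F) * (1 + real N * (2 * D1)) * D * S * measure gauss (ball c r))"
        using deviation_ball_avg[OF int r, of c ?K] by linarith
      also have "\<dots> = (C - 1) * S * measure gauss (ball c r)" by (simp add: C_def)
      also have "\<dots> \<le> C * S * measure gauss (ball c r)"
        using S by (intro mult_right_mono) auto
      finally show "deviation b (?av c r) c r \<le> C * S * measure gauss (ball c r)" .
    qed
  qed
qed

section \<open>The John--Nirenberg inequality\<close>

abbreviation power_deviation :: "real \<Rightarrow> ('a::euclidean_space \<Rightarrow> real) \<Rightarrow> 'a \<Rightarrow> real \<Rightarrow> ennreal" where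
  "power_deviation s b c r \<equiv> (\<integral>\<^sup>+x\<in>ball c r. ennreal (\<bar>b x - ball_avg b (ball c r)\<bar> powr s) \<partial>gauss)"

lemma ennreal_mult_le_cancel:
  assumes "0 < l" "ennreal l * x \<le> ennreal (l * y) * z"
  shows "x \<le> ennreal y * z"
proof -
  have "ennreal (1 / l) * (ennreal l * x) \<le> ennreal (1 / l) * (ennreal (l * y) * z)"
    using assms(2) by (rule mult_left_mono) simp
  moreover have "ennreal (1 / l) * ennreal l = 1" "ennreal (1 / l) * ennreal (l * y) = ennreal y"
    using assms(1) by (simp_all flip: ennreal_mult')
  ultimately show ?thesis by (simp flip: mult.assoc)
qed

lemma ennreal_mult_assoc:
  "0 \<le> x \<Longrightarrow> 0 \<le> y \<Longrightarrow> ennreal x * (ennreal y * z) = ennreal (x * y) * z"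
  by (simp add: ennreal_mult mult.assoc)

lemma abs_powr_add_le:
  fixes x y :: real
  assumes "0 \<le> s" "0 \<le> x" "0 \<le> y"
  shows "(x + y) powr s \<le> 2 powr s * (x powr s + y powr s)"
proof -
  have "(x + y) powr s \<le> (2 * max x y) powr s"
    using assms by (intro powr_mono2) auto
  also have "\<dots> = 2 powr s * (max x y) powr s" using assms by (simp add: powr_mult)
  also have "\<dots> \<le> 2 powr s * (x powr s + y powr s)"
    by (intro mult_left_mono) (auto simp: max_def)
  finally show ?thesis .
qed

text \<open>Calderon--Zygmund stopping: the balls on which the mean oscillation exceeds \<open>L * S\<close> for the
  first time have small total measure, which improves the bound \<open>\<phi>\<close> to \<open>\<phi> / 2\<close> up to a constant.\<close>

lemma john_nirenberg_step:
  fixes A s :: real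
  assumes "0 < A" "1 \<le> s"
  obtains L where "0 < L" "\<And>v :: 'a::euclidean_space \<Rightarrow> real. \<And>S \<phi> c \<rho>.
     bmo_le (2 * A) S v \<Longrightarrow> 0 < S \<Longrightarrow> 0 \<le> \<phi> \<Longrightarrow>
     (\<And>c r. admissible A c r \<Longrightarrow>
        power_deviation s v c r \<le> ennreal \<phi> * emeasure gauss (ball c r)) \<Longrightarrow>
     admissible A c \<rho> \<Longrightarrow>
     power_deviation s v c \<rho>
       \<le> ennreal (3 / 2 * (L * S) powr s + \<phi> / 2) * emeasure gauss (ball c \<rho>)"
proof -
  define n where "n = DIM('a)"
  define D where "D = doubling_const (2 * A)"
  define E where "E = D * 2 ^ n"
  define H where "H = E * (1 + E)"
  \<comment> \<open>Stopping radii below \<open>\<eta> * \<rho>\<close> have five-fold dilates of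
    radius at most \<open>\<rho> / (1 + A)\<close>. This compensates the factor \<open>1 + A\<close>
    lost by recentring, so the dilates are admissible with the same \<open>A\<close> and the bound
    \<open>\<phi>\<close> applies to them.\<close>
  define \<eta> where "\<eta> = 1 / (10 * (1 + A))"
  have pos: "0 < D" "0 < E" "0 < H" "0 < \<eta>" "0 < n"
    using assms by (auto simp: D_def E_def H_def \<eta>_def n_def doubling_const_pos intro!: mult_pos_pos add_pos_pos)
  \<comment> \<open>The first summand forces stopping balls to be small (\<open>L1\<close>), the
    second makes their contribution at most half (\<open>L2\<close>).\<close>
  define L where "L = 2 * H * D / \<eta> ^ n + 2 * 2 powr s * D * 5 ^ n * H"
  have L1: "H * D < L * \<eta> ^ n" and L2: "2 powr s * D * 5 ^ n * (H / L) \<le> 1 / 2" and L0: "0 < L"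
  proof -
    have p1: "0 < 2 * H * D / \<eta> ^ n" "0 < 2 * 2 powr s * D * 5 ^ n * H" using pos by auto
    then show L0: "0 < L" unfolding L_def by (rule add_pos_pos)
    have "2 * H * D < L * \<eta> ^ n"
    proof -
      have "L * \<eta> ^ n = 2 * H * D + (2 * 2 powr s * D * 5 ^ n * H) * \<eta> ^ n"
        using pos by (simp add: L_def distrib_right)
      moreover have "0 < (2 * 2 powr s * D * 5 ^ n * H) * \<eta> ^ n" using p1(2) pos by (intro mult_pos_pos) auto
      ultimately show ?thesis by linarith
    qed
    moreover have "0 < H * D" using pos by simp
    ultimately show "H * D < L * \<eta> ^ n" by linarith
    have "2 * 2 powr s * D * 5 ^ n * H \<le> L" using p1(1) unfolding L_def by linarith
    then show "2 powr s * D * 5 ^ n * (H / L) \<le> 1 / 2" using L0 by (simp add: field_simps)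
  qed
  show ?thesis
  proof (rule that[OF L0])
    fix v :: "'a \<Rightarrow> real" and S \<phi> and c :: 'a and \<rho>
    assume bmo: "bmo_le (2 * A) S v" and S: "0 < S" and \<phi>: "0 \<le> \<phi>"
      and hyp: "\<And>c r. admissible A c r \<Longrightarrow>
        power_deviation s v c r \<le> ennreal \<phi> * emeasure gauss (ball c r)"
      and adm: "admissible A c \<rho>"
    note int = bmo_leD(1)[OF bmo]
    have [measurable]: "v \<in> borel_measurable gauss" using int by simp
    have \<rho>: "0 < \<rho>" using adm by (simp add: admissible_def)
    have adm2: "admissible (2 * A) c (2 * \<rho>)" using adm by (intro admissible_scale) auto
    define k where "k = ball_avg v (ball c \<rho>)"
    define g where "g x = \<bar>v x - k\<bar>" for x
    define \<mu> where "\<mu> = L * S"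
    have [measurable]: "g \<in> borel_measurable gauss" unfolding g_def by measurable
    have l0: "0 < \<mu>" using L0 S by (simp add: \<mu>_def)
    have gint: "(\<integral>\<^sup>+y\<in>ball x t. ennreal (g y) \<partial>gauss) = ennreal (deviation v k x t)" for x t
      unfolding g_def by (rule nn_integral_deviation[OF int])
    \<comment> \<open>Stopping balls are centred in \<open>ball c \<rho>\<close> but may stick out
      of it, so the oscillation about \<open>k\<close> is needed on the doubled ball; hence the
      parameter \<open>2 * A\<close> in the hypothesis.\<close>
    have big: "deviation v k c (2 * \<rho>) \<le> S * H * measure gauss (ball c \<rho>)"
    proof -
      let ?k2 = "ball_avg v (ball c (2 * \<rho>))" and ?m = "measure gauss (ball c \<rho>)" and ?m2 = "measure gauss (ball c (2 * \<rho>))"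
      have m: "?m2 \<le> E * ?m"
        using gauss_ball_doubling[OF adm, of 2] by (simp add: E_def D_def n_def)
      have mpos: "0 < ?m" by (rule measure_gauss_ball_pos[OF \<rho>])
      have d2: "deviation v ?k2 c (2 * \<rho>) \<le> S * ?m2" by (rule bmo_leD(2)[OF bmo adm2])
      have "\<bar>k - ?k2\<bar> * ?m \<le> deviation v ?k2 c \<rho>"
        unfolding k_def by (rule ball_avg_deviation[OF int \<rho>])
      also have "\<dots> \<le> deviation v ?k2 c (2 * \<rho>)"
        using \<rho> by (intro deviation_subset[OF int] subset_ball) auto
      also have "\<dots> \<le> S * (E * ?m)" using d2 m S by (meson mult_left_mono less_imp_le order_trans)
      finally have kk: "\<bar>k - ?k2\<bar> \<le> S * E" using mpos by (simp add: mult.assoc[symmetric])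
      have "deviation v k c (2 * \<rho>) \<le> deviation v ?k2 c (2 * \<rho>) + \<bar>?k2 - k\<bar> * ?m2"
        by (rule deviation_shift[OF int])
      also have "\<dots> \<le> S * ?m2 + (S * E) * ?m2"
        using d2 kk by (intro add_mono mult_right_mono) (auto simp: abs_minus_commute)
      also have "\<dots> = S * (1 + E) * ?m2" by (simp add: algebra_simps)
      also have "\<dots> \<le> S * (1 + E) * (E * ?m)" using m S pos by (intro mult_left_mono) auto
      finally show ?thesis by (simp add: H_def mult_ac)
    qed
    define bad where "bad x t \<longleftrightarrow> 0 < t \<and> t \<le> \<rho> \<and> \<mu> * measure gauss (ball x t) < deviation v k x t" for x t
    have sub: "ball x t \<subseteq> ball c (2 * \<rho>)" if "x \<in> ball c \<rho>" "t \<le> \<rho>" for x t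
    proof
      fix y assume "y \<in> ball x t"
      then show "y \<in> ball c (2 * \<rho>)" using that dist_triangle[of c y x] by auto
    qed
    have small: "t < \<eta> * \<rho>" if "x \<in> ball c \<rho>" "bad x t" for x t
    proof (rule ccontr)
      assume "\<not> t < \<eta> * \<rho>"
      then have t: "0 < t" "t \<le> \<rho>" "\<eta> * \<rho> \<le> t" using that by (auto simp: bad_def)
      have lt: "\<mu> * measure gauss (ball x t) < S * H * measure gauss (ball c \<rho>)"
        using that(2) deviation_subset[OF int sub[OF that(1) t(2)], of k] big by (auto simp: bad_def)
      have "measure gauss (ball c \<rho>) \<le> D * (\<rho> / t) ^ n * measure gauss (ball x t)"
        unfolding D_def n_def using t \<rho> sub[OF that(1) t(2)]
        by (intro gauss_ball_compare[OF adm2] subset_ball) auto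
      also have "\<dots> \<le> D * (1 / \<eta>) ^ n * measure gauss (ball x t)"
        using t \<rho> pos by (intro mult_right_mono mult_left_mono power_mono) (auto simp: field_simps)
      finally have "S * H * measure gauss (ball c \<rho>) \<le> S * H * (D * (1 / \<eta>) ^ n * measure gauss (ball x t))"
        using S pos by (intro mult_left_mono) auto
      with lt have "L * S * measure gauss (ball x t) < S * H * D * (1 / \<eta>) ^ n * measure gauss (ball x t)"
        by (simp add: \<mu>_def mult_ac)
      then have "L * S < S * H * D * (1 / \<eta>) ^ n"
        using measure_nonneg by (rule mult_right_less_imp_less)
      then have "L < H * D * (1 / \<eta>) ^ n" using S by (simp add: mult.commute mult.left_commute)
      then show False using L1 pos by (simp add: field_simps)
    qed
    define E0 where "E0 = {x \<in> ball c \<rho>. \<exists>t. bad x t}"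
    \<comment> \<open>The supremum of the bad radii need not be attained. A bad radius exceeding
      half of it is enough: all radii from twice this one on are good, among them the radius of the
      five-fold dilate.\<close>
    have "\<exists>t. bad x t \<and> (\<forall>u. 2 * t \<le> u \<longrightarrow> \<not> bad x u)" if "x \<in> E0" for x
    proof -
      let ?T = "{t. bad x t}"
      have ne: "?T \<noteq> {}" and bdd: "bdd_above ?T"
        using that by (auto simp: E0_def bad_def intro!: bdd_aboveI[of _ \<rho>])
      obtain t0 where t0: "bad x t0" using ne by auto
      have "0 < Sup ?T" using cSup_upper[OF _ bdd, of t0] t0 by (auto simp: bad_def)
      then have "Sup ?T / 2 < Sup ?T" by simp
      then obtain t where t: "bad x t" "Sup ?T / 2 < t" using less_cSup_iff[OF ne bdd] by auto
      show ?thesis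
      proof (intro exI[of _ t] conjI allI impI notI t)
        fix u assume "2 * t \<le> u" "bad x u"
        then show False using cSup_upper[OF _ bdd, of u] t by auto
      qed
    qed
    then obtain \<tau> where \<tau>: "\<And>x. x \<in> E0 \<Longrightarrow> bad x (\<tau> x)" "\<And>x u. x \<in> E0 \<Longrightarrow> 2 * \<tau> x \<le> u \<Longrightarrow> \<not> bad x u"
      by metis
    have \<tau>': "0 < \<tau> x" "5 * \<tau> x \<le> \<rho>" "admissible A x (5 * \<tau> x)" "x \<in> ball c \<rho>" if "x \<in> E0" for x
    proof -
      show x: "x \<in> ball c \<rho>" using that by (simp add: E0_def)
      show t0: "0 < \<tau> x" using \<tau>(1)[OF that] by (simp add: bad_def)
      have "\<tau> x < \<eta> * \<rho>" using small[OF x \<tau>(1)[OF that]] .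
      then have t5: "5 * \<tau> x \<le> \<rho> / (1 + A)" using assms \<rho> by (simp add: \<eta>_def field_simps)
      also have "\<dots> \<le> \<rho> / 1" using assms \<rho> by (intro divide_left_mono) auto
      finally show "5 * \<tau> x \<le> \<rho>" by simp
      have "admissible (A * (1 + A)) x \<rho>" using admissible_move[OF adm, of x] x by auto
      then have "admissible (1 / (1 + A) * (A * (1 + A))) x (1 / (1 + A) * \<rho>)"
        using assms by (intro admissible_scale) auto
      moreover have "1 / (1 + A) * (A * (1 + A)) = A" using assms by simp
      ultimately have "admissible A x (\<rho> / (1 + A))" by simp
      then show "admissible A x (5 * \<tau> x)" using t0 t5 by (rule_tac admissible_radius_mono) auto
    qed
    define K where "K = (\<lambda>x. (x, \<tau> x)) ` E0"
    have Kadm: "admissible A x t" if "(x, t) \<in> K" for x t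
    proof -
      have x: "x \<in> E0" "t = \<tau> x" using that by (auto simp: K_def)
      note t = \<tau>'(1,3)[OF x(1)]
      show ?thesis unfolding x(2) by (rule admissible_radius_mono[OF t(2)]) (use t(1) in auto)
    qed
    obtain C where C: "countable C" "C \<subseteq> K" "disjoint_family_on (\<lambda>(c, r). ball c r) C"
      and cov: "\<And>c r. (c, r) \<in> K \<Longrightarrow> \<exists>(c', r')\<in>C. ball c r \<subseteq> ball c' (5 * r')"
      using admissible_Vitali[of K A, OF Kadm] by metis
    have CE: "fst i \<in> E0" "snd i = \<tau> (fst i)" if "i \<in> C" for i
      using subsetD[OF C(2) that] by (auto simp: K_def)
    \<comment> \<open>\<open>E0\<close> is replaced by the open set \<open>U\<close>, whose
      measurability is evident. At points of the ball outside \<open>U\<close> all radii below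
      \<open>\<rho>\<close> are good, so the differentiation lemma gives
      \<open>g \<le> \<mu>\<close> almost everywhere there.\<close>
    define U where "U = (\<Union>x\<in>E0. ball x (\<tau> x))"
    define W where "W = (\<Union>i\<in>C. ball (fst i) (5 * snd i))"
    have UW: "U \<subseteq> W"
    proof
      fix y assume "y \<in> U"
      then obtain x where x: "x \<in> E0" "y \<in> ball x (\<tau> x)" by (auto simp: U_def)
      then have "(x, \<tau> x) \<in> K" by (auto simp: K_def)
      then obtain c' r' where i: "(c', r') \<in> C" "ball x (\<tau> x) \<subseteq> ball c' (5 * r')"
        using cov by blast
      then have "y \<in> ball (fst (c', r')) (5 * snd (c', r'))" using x(2) by auto
      with i(1) show "y \<in> W" unfolding W_def by (rule UN_I)
    qed
    have [measurable]: "W \<in> sets lebesgue" unfolding W_def using C(1) by (intro sets.countable_UN'') auto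
    have openU: "open U" unfolding U_def by auto
    have AE: "AE x in gauss. x \<in> ball c \<rho> - U \<longrightarrow> g x \<le> \<mu>"
    proof (rule AE_le_if_ball_averages_le)
      show "ball c \<rho> - U \<in> sets lebesgue" using openU by (intro sets.Diff) auto
      fix x assume x: "x \<in> ball c \<rho> - U"
      have "x \<notin> E0"
      proof
        assume "x \<in> E0"
        then have "x \<in> ball x (\<tau> x)" using \<tau>'(1) by auto
        then show False using x \<open>x \<in> E0\<close> by (auto simp: U_def)
      qed
      then have nb: "\<not> bad x t" for t using x by (auto simp: E0_def)
      show "\<exists>\<delta>>0. \<forall>t. 0 < t \<and> t < \<delta> \<longrightarrow>
        (\<integral>\<^sup>+y\<in>ball x t. ennreal (g y) \<partial>gauss) \<le> ennreal \<mu> * emeasure gauss (ball x t)"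
      proof (intro exI[of _ \<rho>] conjI allI impI \<rho>)
        fix t assume t: "0 < t \<and> t < \<rho>"
        then have "deviation v k x t \<le> \<mu> * measure gauss (ball x t)"
          using nb[of t] by (auto simp: bad_def)
        then show "(\<integral>\<^sup>+y\<in>ball x t. ennreal (g y) \<partial>gauss) \<le> ennreal \<mu> * emeasure gauss (ball x t)"
          unfolding gint emeasure_gauss_ball_eq using l0 by (simp add: ennreal_leI flip: ennreal_mult)
      qed
    qed (use l0 in auto)
    let ?mB = "emeasure gauss (ball c \<rho>)"
    have total: "(\<integral>\<^sup>+i. emeasure gauss (ball (fst i) (snd i)) \<partial>count_space C) \<le> ennreal (H / L) * ?mB"
    proof (rule ennreal_mult_le_cancel[OF l0])
      have "ennreal \<mu> * (\<integral>\<^sup>+i. emeasure gauss (ball (fst i) (snd i)) \<partial>count_space C) =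
        (\<integral>\<^sup>+i. ennreal \<mu> * emeasure gauss (ball (fst i) (snd i)) \<partial>count_space C)"
        by (simp add: nn_integral_cmult)
      also have "\<dots> \<le> (\<integral>\<^sup>+i. (\<integral>\<^sup>+y\<in>ball (fst i) (snd i). ennreal (g y) \<partial>gauss) \<partial>count_space C)"
      proof (intro nn_integral_mono)
        fix i assume "i \<in> space (count_space C)"
        then have "bad (fst i) (snd i)" using CE[of i] \<tau>(1) by auto
        then show "ennreal \<mu> * emeasure gauss (ball (fst i) (snd i)) \<le> (\<integral>\<^sup>+y\<in>ball (fst i) (snd i). ennreal (g y) \<partial>gauss)"
          unfolding gint emeasure_gauss_ball_eq using l0
          by (simp add: bad_def ennreal_leI less_imp_le flip: ennreal_mult)
      qed
      also have "\<dots> = (\<integral>\<^sup>+y\<in>(\<Union>i\<in>C. ball (fst i) (snd i)). ennreal (g y) \<partial>gauss)"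
        using C by (intro nn_integral_UN_countable) (auto simp: case_prod_beta')
      also have "\<dots> \<le> (\<integral>\<^sup>+y\<in>ball c (2 * \<rho>). ennreal (g y) \<partial>gauss)"
      proof (intro nn_integral_mono)
        have "ball (fst i) (snd i) \<subseteq> ball c (2 * \<rho>)" if "i \<in> C" for i
          using CE[OF that] \<tau>'[of "fst i"] by (intro sub) auto
        then have "(\<Union>i\<in>C. ball (fst i) (snd i)) \<subseteq> ball c (2 * \<rho>)" by (rule UN_least)
        then show "ennreal (g y) * indicator (\<Union>i\<in>C. ball (fst i) (snd i)) y \<le> ennreal (g y) * indicator (ball c (2 * \<rho>)) y" for y
          by (intro mult_left_mono indicator_leI) (erule (1) subsetD, rule zero_le)
      qed
      also have "\<dots> \<le> ennreal (\<mu> * (H / L)) * ?mB"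
        unfolding gint emeasure_gauss_ball_eq using big L0 S pos
        by (simp add: \<mu>_def ennreal_leI flip: ennreal_mult)
      finally show "ennreal \<mu> * (\<integral>\<^sup>+i. emeasure gauss (ball (fst i) (snd i)) \<partial>count_space C)
        \<le> ennreal (\<mu> * (H / L)) * ?mB" .
    qed
    let ?P = "\<phi> + \<mu> powr s"
    \<comment> \<open>The dilate is not bad, so its average is within \<open>\<mu>\<close> of
      \<open>k\<close>; about its own average the oscillation is controlled by
      \<open>\<phi>\<close>.\<close>
    have piece: "(\<integral>\<^sup>+x\<in>ball (fst i) (5 * snd i). ennreal (g x powr s) \<partial>gauss)
      \<le> ennreal (2 powr s * ?P * (D * 5 ^ n)) * emeasure gauss (ball (fst i) (snd i))" if i: "i \<in> C" for i
    proof -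
      let ?x = "fst i" and ?t = "snd i"
      let ?B = "ball ?x (5 * ?t)"
      let ?k = "ball_avg v ?B"
      have x: "?x \<in> E0" "?t = \<tau> ?x" using CE[OF i] by auto
      have t: "0 < ?t" "5 * ?t \<le> \<rho>" "admissible A ?x (5 * ?t)" "?x \<in> ball c \<rho>" using \<tau>'[OF x(1)] x(2) by auto
      have nb: "deviation v k ?x (5 * ?t) \<le> \<mu> * measure gauss ?B"
        using \<tau>(2)[OF x(1), of "5 * ?t"] t x(2) by (auto simp: bad_def)
      have "\<bar>?k - k\<bar> * measure gauss ?B \<le> \<mu> * measure gauss ?B"
        using ball_avg_deviation[OF int, of "5 * ?t" ?x k] t nb by auto
      then have kk: "\<bar>?k - k\<bar> \<le> \<mu>"
        using measure_gauss_ball_pos[of "5 * ?t" ?x] t by simp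
      have "(\<integral>\<^sup>+x\<in>?B. ennreal (g x powr s) \<partial>gauss) \<le> ennreal (2 powr s) *
        (\<integral>\<^sup>+x\<in>?B. ennreal (\<bar>v x - ?k\<bar> powr s) \<partial>gauss) + (\<integral>\<^sup>+x\<in>?B. ennreal (2 powr s * \<mu> powr s) \<partial>gauss)"
      proof (rule set_nn_integral_le_add)
        fix x
        have "g x powr s \<le> (\<bar>v x - ?k\<bar> + \<mu>) powr s"
          using kk assms unfolding g_def by (intro powr_mono2) auto
        also have "\<dots> \<le> 2 powr s * (\<bar>v x - ?k\<bar> powr s + \<mu> powr s)"
          using assms l0 by (intro abs_powr_add_le) auto
        finally show "g x powr s \<le> 2 powr s * \<bar>v x - ?k\<bar> powr s + 2 powr s * \<mu> powr s"
          by (simp add: distrib_left)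
      qed auto
      also have "\<dots> = ennreal (2 powr s) * ((\<integral>\<^sup>+x\<in>?B. ennreal (\<bar>v x - ?k\<bar> powr s) \<partial>gauss) + ennreal (\<mu> powr s) * emeasure gauss ?B)"
        by (subst nn_integral_cmult_indicator) (auto simp: ennreal_mult distrib_left mult.assoc)
      also have "\<dots> \<le> ennreal (2 powr s) * (ennreal \<phi> * emeasure gauss ?B + ennreal (\<mu> powr s) * emeasure gauss ?B)"
        by (intro mult_left_mono add_mono hyp t order_refl) auto
      also have "\<dots> = ennreal (2 powr s * ?P) * emeasure gauss ?B"
        using \<phi> by (simp add: ennreal_mult ennreal_plus distrib_right mult.assoc)
      also have "\<dots> \<le> ennreal (2 powr s * ?P) * (ennreal (D * 5 ^ n) * emeasure gauss (ball ?x ?t))"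
      proof (intro mult_left_mono)
        have "measure gauss ?B \<le> D * (5 * ?t / ?t) ^ n * measure gauss (ball ?x ?t)"
          unfolding D_def n_def using t by (intro gauss_ball_compare[OF adm2] sub) auto
        then show "emeasure gauss ?B \<le> ennreal (D * 5 ^ n) * emeasure gauss (ball ?x ?t)"
          unfolding emeasure_gauss_ball_eq using t pos by (simp add: ennreal_leI flip: ennreal_mult)
      qed simp
      also have "\<dots> = ennreal (2 powr s * ?P * (D * 5 ^ n)) * emeasure gauss (ball ?x ?t)"
        using \<phi> pos by (simp add: ennreal_mult mult.assoc)
      finally show ?thesis .
    qed
    have "(\<integral>\<^sup>+x\<in>ball c \<rho>. ennreal (g x powr s) \<partial>gauss) \<le>
      (\<integral>\<^sup>+x. ennreal (\<mu> powr s) * indicator (ball c \<rho>) x + ennreal (g x powr s) * indicator W x \<partial>gauss)"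
    proof (intro nn_integral_mono_AE)
      show "AE x in gauss. ennreal (g x powr s) * indicator (ball c \<rho>) x
          \<le> ennreal (\<mu> powr s) * indicator (ball c \<rho>) x + ennreal (g x powr s) * indicator W x"
        using AE
      proof eventually_elim
        case (elim x)
        show ?case
        proof (cases "x \<in> ball c \<rho> \<and> x \<notin> W")
          case True
          then have "g x \<le> \<mu>" using elim UW by auto
          then have "g x powr s \<le> \<mu> powr s" using assms by (intro powr_mono2) (auto simp: g_def)
          then show ?thesis using True by (simp add: ennreal_leI)
        qed (auto split: split_indicator)
      qed
    qed
    also have "\<dots> = ennreal (\<mu> powr s) * ?mB + (\<integral>\<^sup>+x\<in>W. ennreal (g x powr s) \<partial>gauss)"
      by (subst nn_integral_add) (auto simp: nn_integral_cmult_indicator)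
    also have "(\<integral>\<^sup>+x\<in>W. ennreal (g x powr s) \<partial>gauss) \<le> (\<integral>\<^sup>+i. (\<integral>\<^sup>+x\<in>ball (fst i) (5 * snd i). ennreal (g x powr s) \<partial>gauss) \<partial>count_space C)"
      using C(1) by (intro nn_integral_UN_le) (auto simp: W_def)
    also have "\<dots> \<le> (\<integral>\<^sup>+i. ennreal (2 powr s * ?P * (D * 5 ^ n)) * emeasure gauss (ball (fst i) (snd i)) \<partial>count_space C)"
      by (intro nn_integral_mono piece) auto
    also have "\<dots> = ennreal (2 powr s * ?P * (D * 5 ^ n)) * (\<integral>\<^sup>+i. emeasure gauss (ball (fst i) (snd i)) \<partial>count_space C)"
      by (simp add: nn_integral_cmult)
    also have "\<dots> \<le> ennreal (2 powr s * ?P * (D * 5 ^ n)) * (ennreal (H / L) * ?mB)"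
      by (intro mult_left_mono total) auto
    also have "\<dots> = ennreal (?P * (2 powr s * D * 5 ^ n * (H / L))) * ?mB"
    proof -
      have "ennreal (2 powr s * ?P * (D * 5 ^ n)) * (ennreal (H / L) * ?mB) = ennreal (2 powr s * ?P * (D * 5 ^ n) * (H / L)) * ?mB"
        using \<phi> pos L0 by (intro ennreal_mult_assoc) auto
      also have "2 powr s * ?P * (D * 5 ^ n) * (H / L) = ?P * (2 powr s * D * 5 ^ n * (H / L))"
        by (simp only: mult_ac)
      finally show ?thesis .
    qed
    also have "\<dots> \<le> ennreal (?P * (1 / 2)) * ?mB"
      using L2 \<phi> by (intro mult_right_mono ennreal_leI mult_left_mono) auto
    also have "ennreal (\<mu> powr s) * ?mB + ennreal (?P * (1 / 2)) * ?mB = ennreal (\<mu> powr s + ?P * (1 / 2)) * ?mB"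
      using \<phi> by (subst ennreal_plus) (auto simp: distrib_right)
    also have "\<mu> powr s + ?P * (1 / 2) = 3 / 2 * (L * S) powr s + \<phi> / 2"
      unfolding \<mu>_def by (simp add: field_simps)
    finally show "power_deviation s v c \<rho>
       \<le> ennreal (3 / 2 * (L * S) powr s + \<phi> / 2) * ?mB"
      unfolding g_def k_def by (simp add: add_left_mono)
  qed
qed

text \<open>Boundedness gives a finite bound to start the iteration with. Each application of the
  step halves the excess over the fixed point, so \<open>M\<close> disappears in the limit.\<close>

lemma john_nirenberg_bounded:
  fixes A s :: real
  assumes "0 < A" "1 \<le> s"
  obtains L where "0 < L" "\<And>v :: 'a::euclidean_space \<Rightarrow> real. \<And>S M c \<rho>.
     bmo_le (2 * A) S v \<Longrightarrow> 0 < S \<Longrightarrow> (\<And>x. \<bar>v x\<bar> \<le> M) \<Longrightarrow> admissible A c \<rho> \<Longrightarrow>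
     power_deviation s v c \<rho>
       \<le> ennreal (3 * (L * S) powr s) * emeasure gauss (ball c \<rho>)"
proof (rule john_nirenberg_step[where 'a='a, OF assms])
  fix L assume L: "0 < L" and step: "\<And>v :: 'a \<Rightarrow> real. \<And>S \<phi> c \<rho>.
     bmo_le (2 * A) S v \<Longrightarrow> 0 < S \<Longrightarrow> 0 \<le> \<phi> \<Longrightarrow>
     (\<And>c r. admissible A c r \<Longrightarrow>
        power_deviation s v c r \<le> ennreal \<phi> * emeasure gauss (ball c r)) \<Longrightarrow>
     admissible A c \<rho> \<Longrightarrow>
     power_deviation s v c \<rho>
       \<le> ennreal (3 / 2 * (L * S) powr s + \<phi> / 2) * emeasure gauss (ball c \<rho>)"
  show thesis
  proof (rule that[OF L])
    fix v :: "'a \<Rightarrow> real" and S M and c :: 'a and \<rho>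
    assume bmo: "bmo_le (2 * A) S v" and S: "0 < S" and M: "\<And>x. \<bar>v x\<bar> \<le> M" and adm: "admissible A c \<rho>"
    note int = bmo_leD(1)[OF bmo]
    have M0: "0 \<le> M" using M[of 0] by linarith
    \<comment> \<open>The fixed point of the map taking \<open>\<phi>\<close> to
      \<open>3 / 2 * (L * S) powr s + \<phi> / 2\<close>.\<close>
    define a where "a = 3 * (L * S) powr s"
    have a0: "0 \<le> a" by (simp add: a_def)
    have bound: "power_deviation s v c r
      \<le> ennreal (a + (2 * M) powr s / 2 ^ n) * emeasure gauss (ball c r)" if "admissible A c r" for n c r
      using that
    proof (induction n arbitrary: c r)
      case 0
      have r: "0 < r" using 0 by (simp add: admissible_def)
      have "ennreal (deviation v 0 c r) \<le> (\<integral>\<^sup>+x. ennreal M * indicator (ball c r) x \<partial>gauss)"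
        unfolding nn_integral_deviation[OF int, symmetric]
        using M by (intro nn_integral_mono) (auto split: split_indicator intro: ennreal_leI)
      also have "\<dots> = ennreal (M * measure gauss (ball c r))"
        using M0 by (simp add: nn_integral_cmult_indicator emeasure_gauss_ball_eq ennreal_mult)
      finally have "deviation v 0 c r \<le> M * measure gauss (ball c r)"
        using M0 by (simp add: ennreal_le_iff)
      then have "\<bar>ball_avg v (ball c r)\<bar> * measure gauss (ball c r) \<le> M * measure gauss (ball c r)"
        using ball_avg_deviation[OF int r, of c 0] by simp
      then have av: "\<bar>ball_avg v (ball c r)\<bar> \<le> M"
        using measure_gauss_ball_pos[OF r, of c] by simp
      have "\<bar>v x - ball_avg v (ball c r)\<bar> powr s \<le> (2 * M) powr s" for x
        using M[of x] av assms by (intro powr_mono2) auto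
      then have "power_deviation s v c r
        \<le> (\<integral>\<^sup>+x. ennreal (a + (2 * M) powr s / 2 ^ 0) * indicator (ball c r) x \<partial>gauss)"
        using a0 by (intro nn_integral_mono) (auto split: split_indicator intro!: ennreal_leI add_increasing)
      then show ?case by (simp add: nn_integral_cmult_indicator)
    next
      case (Suc n)
      have "power_deviation s v c r
        \<le> ennreal (3 / 2 * (L * S) powr s + (a + (2 * M) powr s / 2 ^ n) / 2) * emeasure gauss (ball c r)"
        using a0 by (intro step[OF bmo S _ Suc.IH Suc.prems]) auto
      also have "3 / 2 * (L * S) powr s + (a + (2 * M) powr s / 2 ^ n) / 2 = a + (2 * M) powr s / 2 ^ Suc n"
        by (simp add: a_def field_simps)
      finally show ?case .
    qed
    have "(\<lambda>n. a + (2 * M) powr s / 2 ^ n) \<longlonglongrightarrow> a + 0"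
      by (intro tendsto_intros LIMSEQ_divide_realpow_zero) auto
    then have "(\<lambda>n. (a + (2 * M) powr s / 2 ^ n) * measure gauss (ball c \<rho>)) \<longlonglongrightarrow> a * measure gauss (ball c \<rho>)"
      by (intro tendsto_mult_right) simp
    then have lim: "(\<lambda>n. ennreal ((a + (2 * M) powr s / 2 ^ n) * measure gauss (ball c \<rho>))) \<longlonglongrightarrow> ennreal (a * measure gauss (ball c \<rho>))"
      by (rule tendsto_ennrealI)
    have "power_deviation s v c \<rho> \<le> ennreal (a * measure gauss (ball c \<rho>))"
      using bound[OF adm] a0
      by (intro LIMSEQ_le_const[OF lim] exI[of _ 0] allI impI) (simp add: emeasure_gauss_ball_eq ennreal_mult)
    then show "power_deviation s v c \<rho>
       \<le> ennreal (3 * (L * S) powr s) * emeasure gauss (ball c \<rho>)"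
      by (simp add: emeasure_gauss_ball_eq ennreal_mult a_def)
  qed
qed

section \<open>Truncation and the unbounded case\<close>

definition trunc :: "nat \<Rightarrow> real \<Rightarrow> real" where
  "trunc N x = max (- real N) (min (real N) x)"

lemma trunc_bounds:
  "\<bar>trunc N x\<bar> \<le> real N" "\<bar>trunc N x\<bar> \<le> \<bar>x\<bar>" "\<bar>trunc N x - trunc N y\<bar> \<le> \<bar>x - y\<bar>"
  by (auto simp: trunc_def)

lemma trunc_eq: "\<bar>x\<bar> \<le> real N \<Longrightarrow> trunc N x = x"
  by (auto simp: trunc_def)

lemma measurable_trunc [measurable]: "trunc N \<in> borel_measurable borel"
  unfolding trunc_def by measurable

lemma integrable_trunc:
  assumes "integrable gauss b" shows "integrable gauss (\<lambda>x. trunc N (b x))"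
  using assms by (rule Bochner_Integration.integrable_bound) (use assms trunc_bounds in auto)

lemma deviation_trunc:
  assumes "integrable gauss b"
  shows "deviation (\<lambda>x. trunc N (b x)) (trunc N k) c r \<le> deviation b k c r"
proof -
  have "ennreal (deviation (\<lambda>x. trunc N (b x)) (trunc N k) c r) \<le> ennreal (deviation b k c r)"
    unfolding nn_integral_deviation[OF assms, symmetric] nn_integral_deviation[OF integrable_trunc[OF assms], symmetric]
    using trunc_bounds(3) by (intro nn_integral_mono) (auto split: split_indicator intro!: ennreal_leI)
  then show ?thesis using deviation_nonneg[of b k c r] by (simp add: ennreal_le_iff)
qed

text \<open>Truncation is 1-Lipschitz, so it does not increase the oscillation about the truncated
  average; recentring at the average of the truncation costs the factor 2.\<close>

lemma bmo_le_trunc: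
  assumes "bmo_le A S b" shows "bmo_le A (2 * S) (\<lambda>x. trunc N (b x))"
  unfolding bmo_le_def
proof (intro conjI allI impI)
  note int = bmo_leD(1)[OF assms]
  show int': "integrable gauss (\<lambda>x. trunc N (b x))" by (rule integrable_trunc[OF int])
  fix c :: 'a and r assume adm: "admissible A c r"
  let ?k = "ball_avg b (ball c r)"
  have "deviation (\<lambda>x. trunc N (b x)) (ball_avg (\<lambda>x. trunc N (b x)) (ball c r)) c r
    \<le> 2 * deviation (\<lambda>x. trunc N (b x)) (trunc N ?k) c r"
    using adm by (intro deviation_ball_avg[OF int']) (simp add: admissible_def)
  also have "\<dots> \<le> 2 * (S * measure gauss (ball c r))"
    using deviation_trunc[OF int, of N ?k c r] bmo_leD(2)[OF assms adm] by linarith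
  finally show "deviation (\<lambda>x. trunc N (b x)) (ball_avg (\<lambda>x. trunc N (b x)) (ball c r)) c r
    \<le> 2 * S * measure gauss (ball c r)" by simp
qed

text \<open>The constant of the bounded case does not see the height of the truncation, so Fatou's
  lemma extends it to all of BMO. The enlargement of the family from parameter \<open>1\<close> to
  \<open>2 * A\<close> happens here as well.\<close>

lemma john_nirenberg:
  fixes A s :: real
  assumes A: "0 < A" and s: "1 \<le> s"
  obtains C where "0 < C" "\<And>b :: 'a::euclidean_space \<Rightarrow> real. \<And>S c r.
     bmo_le 1 S b \<Longrightarrow> 0 \<le> S \<Longrightarrow> admissible A c r \<Longrightarrow>
     power_deviation s b c r
       \<le> ennreal (C * S powr s) * emeasure gauss (ball c r)"
proof (rule john_nirenberg_bounded[where 'a='a, OF assms])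
  fix L assume L: "0 < L" and jn: "\<And>v :: 'a \<Rightarrow> real. \<And>S M c \<rho>.
     bmo_le (2 * A) S v \<Longrightarrow> 0 < S \<Longrightarrow> (\<And>x. \<bar>v x\<bar> \<le> M) \<Longrightarrow> admissible A c \<rho> \<Longrightarrow>
     power_deviation s v c \<rho>
       \<le> ennreal (3 * (L * S) powr s) * emeasure gauss (ball c \<rho>)"
  have A2: "0 < 2 * A" using A by simp
  obtain E where E: "0 < E" and enl: "\<And>b :: 'a \<Rightarrow> real. \<And>S. 0 \<le> S \<Longrightarrow> bmo_le 1 S b \<Longrightarrow> bmo_le (2 * A) (E * S) b"
    using bmo_le_enlarge[where 'a='a, OF zero_less_one A2] by metis
  define C where "C = 2 powr s * (3 * (L * (2 * E)) powr s + E powr s)"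
  show thesis
  proof (rule that)
    show "0 < C" using L E by (auto simp: C_def intro!: mult_pos_pos add_pos_pos)
    fix b :: "'a \<Rightarrow> real" and S and c :: 'a and r
    assume b: "bmo_le 1 S b" and S: "0 \<le> S" and adm: "admissible A c r"
    have bmo: "bmo_le (2 * A) (E * S) b" by (rule enl[OF S b])
    note int = bmo_leD(1)[OF bmo]
    have [measurable]: "b \<in> borel_measurable gauss" using int by simp
    have r: "0 < r" using adm by (simp add: admissible_def)
    have adm2: "admissible (2 * A) c r" using adm A by (rule_tac admissible_mono) auto
    define k where "k = ball_avg b (ball c r)"
    let ?m = "emeasure gauss (ball c r)"
    have dev: "deviation b k c r \<le> E * S * measure gauss (ball c r)"
      unfolding k_def by (rule bmo_leD(2)[OF bmo adm2])
    show "power_deviation s b c r \<le> ennreal (C * S powr s) * ?m"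
    proof (cases "S = 0")
      \<comment> \<open>The bounded case needs a positive bound; for \<open>S = 0\<close> the
        function equals \<open>k\<close> almost everywhere on the ball.\<close>
      case True
      then have "deviation b k c r = 0" using dev deviation_nonneg[of b k c r] by simp
      then have "(\<integral>\<^sup>+x\<in>ball c r. ennreal \<bar>b x - k\<bar> \<partial>gauss) = 0"
        by (simp add: nn_integral_deviation[OF int])
      then have "AE x in gauss. ennreal \<bar>b x - k\<bar> * indicator (ball c r) x = 0"
        by (subst (asm) nn_integral_0_iff_AE) auto
      then have "(\<integral>\<^sup>+x\<in>ball c r. ennreal (\<bar>b x - k\<bar> powr s) \<partial>gauss) = (\<integral>\<^sup>+x. 0 \<partial>(gauss :: 'a measure))"
      proof (intro nn_integral_cong_AE, eventually_elim)
        case (elim x)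
        then show ?case by (cases "x \<in> ball c r") auto
      qed
      then show ?thesis by (simp add: k_def)
    next
      case False
      with S have S0: "0 < S" by simp
      let ?t = "\<lambda>N x. trunc N (b x)"
      \<comment> \<open>Centred at \<open>trunc N k\<close>, which is \<open>k\<close> for large
        \<open>N\<close>, rather than at the average of the truncation: the integrands are then
        eventually constant at every point, and the change of centre costs at most
        \<open>E * S\<close>.\<close>
      have trb: "(\<integral>\<^sup>+x\<in>ball c r. ennreal (\<bar>?t N x - trunc N k\<bar> powr s) \<partial>gauss) \<le> ennreal (C * S powr s) * ?m" for N
      proof -
        have int': "integrable gauss (?t N)" by (rule integrable_trunc[OF int])
        let ?k = "ball_avg (?t N) (ball c r)"
        have "\<bar>?k - trunc N k\<bar> * measure gauss (ball c r) \<le> E * S * measure gauss (ball c r)"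
          using ball_avg_deviation[OF int' r, of c "trunc N k"] deviation_trunc[OF int, of N k c r] dev by linarith
        then have kk: "\<bar>?k - trunc N k\<bar> \<le> E * S"
          using measure_gauss_ball_pos[OF r, of c] by simp
        have "bmo_le (2 * A) (2 * (E * S)) (?t N)" by (rule bmo_le_trunc[OF bmo])
        then have j: "(\<integral>\<^sup>+x\<in>ball c r. ennreal (\<bar>?t N x - ?k\<bar> powr s) \<partial>gauss) \<le> ennreal (3 * (L * (2 * (E * S))) powr s) * ?m"
          using E S0 by (intro jn[of _ _ "real N"] adm trunc_bounds) auto
        have "(\<integral>\<^sup>+x\<in>ball c r. ennreal (\<bar>?t N x - trunc N k\<bar> powr s) \<partial>gauss) \<le> ennreal (2 powr s) *
          (\<integral>\<^sup>+x\<in>ball c r. ennreal (\<bar>?t N x - ?k\<bar> powr s) \<partial>gauss) + (\<integral>\<^sup>+x\<in>ball c r. ennreal (2 powr s * (E * S) powr s) \<partial>gauss)"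
        proof (rule set_nn_integral_le_add)
          fix x
          have "\<bar>?t N x - trunc N k\<bar> powr s \<le> (\<bar>?t N x - ?k\<bar> + E * S) powr s"
            using kk s by (intro powr_mono2) auto
          also have "\<dots> \<le> 2 powr s * (\<bar>?t N x - ?k\<bar> powr s + (E * S) powr s)"
            using s E S by (intro abs_powr_add_le) auto
          finally show "\<bar>?t N x - trunc N k\<bar> powr s \<le> 2 powr s * \<bar>?t N x - ?k\<bar> powr s + 2 powr s * (E * S) powr s"
            by (simp add: distrib_left)
        qed auto
        also have "\<dots> = ennreal (2 powr s) * ((\<integral>\<^sup>+x\<in>ball c r. ennreal (\<bar>?t N x - ?k\<bar> powr s) \<partial>gauss) + ennreal ((E * S) powr s) * ?m)"
          by (subst nn_integral_cmult_indicator) (auto simp: ennreal_mult distrib_left mult.assoc)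
        also have "\<dots> \<le> ennreal (2 powr s) * (ennreal (3 * (L * (2 * (E * S))) powr s) * ?m + ennreal ((E * S) powr s) * ?m)"
          by (intro mult_left_mono add_mono j order_refl) auto
        also have "\<dots> = ennreal (2 powr s * (3 * (L * (2 * (E * S))) powr s + (E * S) powr s)) * ?m"
          by (simp add: ennreal_mult ennreal_plus distrib_right mult.assoc)
        also have "2 powr s * (3 * (L * (2 * (E * S))) powr s + (E * S) powr s) = C * S powr s"
        proof -
          have "L * (2 * (E * S)) = (L * (2 * E)) * S" by simp
          then have "(L * (2 * (E * S))) powr s = (L * (2 * E)) powr s * S powr s" "(E * S) powr s = E powr s * S powr s"
            using L E S by (simp_all only: powr_mult)
          then show ?thesis by (simp add: C_def algebra_simps)
        qed
        finally show ?thesis .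
      qed
      have "(\<integral>\<^sup>+x\<in>ball c r. ennreal (\<bar>b x - k\<bar> powr s) \<partial>gauss) =
        (\<integral>\<^sup>+x. liminf (\<lambda>N. ennreal (\<bar>?t N x - trunc N k\<bar> powr s) * indicator (ball c r) x) \<partial>gauss)"
      proof (intro nn_integral_cong)
        fix x
        obtain N0 :: nat where N0: "\<bar>b x\<bar> + \<bar>k\<bar> \<le> real N0" using real_arch_simple by blast
        have "eventually (\<lambda>N. ennreal (\<bar>?t N x - trunc N k\<bar> powr s) * indicator (ball c r) x =
            ennreal (\<bar>b x - k\<bar> powr s) * indicator (ball c r) x) sequentially"
          using eventually_ge_at_top[of N0]
        proof eventually_elim
          case (elim N)
          then have "\<bar>b x\<bar> \<le> real N" "\<bar>k\<bar> \<le> real N" using N0 by linarith+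
          then show ?case by (simp add: trunc_eq)
        qed
        then have "(\<lambda>N. ennreal (\<bar>?t N x - trunc N k\<bar> powr s) * indicator (ball c r) x) \<longlonglongrightarrow>
            ennreal (\<bar>b x - k\<bar> powr s) * indicator (ball c r) x"
          by (rule tendsto_eventually)
        then show "ennreal (\<bar>b x - k\<bar> powr s) * indicator (ball c r) x =
            liminf (\<lambda>N. ennreal (\<bar>?t N x - trunc N k\<bar> powr s) * indicator (ball c r) x)"
          by (intro lim_imp_Liminf[symmetric]) auto
      qed
      also have "\<dots> \<le> liminf (\<lambda>N. (\<integral>\<^sup>+x\<in>ball c r. ennreal (\<bar>?t N x - trunc N k\<bar> powr s) \<partial>gauss))"
        by (intro nn_integral_liminf) measurable
      also have "\<dots> \<le> liminf (\<lambda>N::nat. ennreal (C * S powr s) * ?m)"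
        by (intro Liminf_mono always_eventually allI trb)
      also have "\<dots> = ennreal (C * S powr s) * ?m" by (simp add: Liminf_const)
      finally show ?thesis by (simp add: k_def)
    qed
  qed
qed

section \<open>Maximal oscillation\<close>

text \<open>Countability makes the counting measure sigma-finite, so this is the measurability part
  of Tonelli's theorem.\<close>

lemma borel_measurable_nn_integral_count_space:
  fixes f :: "'i \<Rightarrow> 'a \<Rightarrow> ennreal"
  assumes I: "countable I" and f: "\<And>i. i \<in> I \<Longrightarrow> f i \<in> borel_measurable M"
  shows "(\<lambda>x. \<integral>\<^sup>+i. f i x \<partial>count_space I) \<in> borel_measurable M"
proof -
  interpret sigma_finite_measure "count_space I"
    by (rule sigma_finite_measure_count_space_countable[OF I])
  have "(\<lambda>z. f (fst z) (snd z)) \<in> borel_measurable (count_space I \<Otimes>\<^sub>M M)"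
    by (rule measurable_pair_measure_countable1[OF I]) (use f in simp)
  from measurable_pair_swap[OF this] show ?thesis
    by (intro borel_measurable_nn_integral) (simp add: case_prod_beta')
qed

abbreviation frac_avg :: "real \<Rightarrow> ('a::euclidean_space \<Rightarrow> real) \<Rightarrow> 'a \<Rightarrow> real \<Rightarrow> ennreal" where
  "frac_avg \<beta> f c r \<equiv> ball_integral f c r / ennreal (measure gauss (ball c r) powr (1 - \<beta>))"

lemma frac_avg_le_frac_max:
  assumes "admissible A c r" "x \<in> ball c r"
  shows "frac_avg \<beta> f c r \<le> frac_max A \<beta> f x"
proof -
  have "0 < measure gauss (ball c r)"
    using assms(1) by (intro measure_gauss_ball_pos) (simp add: admissible_def)
  then show ?thesis
    using ball_integral_le_frac_max[OF assms, of f \<beta>] by (simp add: ennreal_divide_le_iff)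
qed

lemma ennreal_le_cancel_ball:
  assumes "0 < r" "x * emeasure gauss (ball c r) \<le> y * emeasure gauss (ball c r)"
  shows "x \<le> y"
proof -
  have "emeasure gauss (ball c r) \<noteq> 0" "emeasure gauss (ball c r) \<noteq> top"
    using measure_gauss_ball_pos[OF assms(1), of c] by (auto simp: emeasure_gauss_ball_eq)
  then show ?thesis using assms(2) by (simp add: ennreal_mult_le_mult_iff mult.commute[of _ "emeasure gauss (ball c r)"])
qed

text \<open>The left-hand side is at most an average of \<open>\<bar>b - k\<bar>\<close> over a ball
  containing \<open>x\<close>, and inside the larger ball the cut-off is invisible. All smaller
  balls through \<open>x\<close> are thus controlled by one localised function.\<close>

lemma abs_ball_avg_le_frac_max:
  assumes b: "integrable gauss b" and adm: "admissible A c r" "x \<in> ball c r" "ball c r \<subseteq> ball c' r'"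
  shows "ennreal \<bar>ball_avg b (ball c r) - k\<bar> \<le> frac_max A 0 (\<lambda>y. \<bar>b y - k\<bar> * indicator (ball c' r') y) x"
proof -
  have r: "0 < r" using adm by (simp add: admissible_def)
  let ?h = "\<lambda>y. \<bar>b y - k\<bar> * indicator (ball c' r') y"
  have "ennreal \<bar>ball_avg b (ball c r) - k\<bar> * emeasure gauss (ball c r) \<le> ennreal (deviation b k c r)"
    using ball_avg_deviation[OF b r, of c k] by (simp add: emeasure_gauss_ball_eq ennreal_leI flip: ennreal_mult)
  also have "\<dots> = ball_integral ?h c r"
    unfolding nn_integral_deviation[OF b, symmetric]
    using adm(3) by (intro nn_integral_cong) (auto split: split_indicator)
  also have "\<dots> \<le> frac_max A 0 ?h x * emeasure gauss (ball c r)"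
    by (rule ball_integral_le_frac_max_0[OF adm(1,2)])
  finally show ?thesis by (rule ennreal_le_cancel_ball[OF r])
qed

text \<open>At each dyadic level a Vitali selection of the balls with large fractional average is made; on a
  selected (dilated) ball every smaller average of \<open>b\<close> is controlled by the maximal function of its
  oscillation there, which is in \<open>L\<^sup>q\<close> by the John--Nirenberg inequality.\<close>

lemma maximal_oscillation:
  fixes A \<beta> q :: real
  assumes A: "0 < A" and q: "1 < q"
  obtains C where "0 < C" "\<And>(b :: 'a::euclidean_space \<Rightarrow> real) S f.
     bmo_le 1 S b \<Longrightarrow> 0 \<le> S \<Longrightarrow> f \<in> borel_measurable gauss \<Longrightarrow>
     (\<And>c r. admissible A c r \<Longrightarrow> frac_avg \<beta> f c r < \<infinity>) \<Longrightarrow>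
     \<exists>G\<in>borel_measurable gauss.
       (\<forall>c r x. admissible A c r \<and> x \<in> ball c r \<longrightarrow>
          ennreal_powr (ennreal \<bar>b x - ball_avg b (ball c r)\<bar> * frac_avg \<beta> f c r) q \<le> G x) \<and>
       (\<integral>\<^sup>+x. G x \<partial>gauss) \<le> ennreal (C * S powr q) * (\<integral>\<^sup>+x. ennreal_powr (frac_max A \<beta> f x) q \<partial>gauss)"
proof -
  obtain CH where CH: "0 < CH" and hl: "\<And>f :: 'a \<Rightarrow> real. f \<in> borel_measurable gauss \<Longrightarrow>
    (\<integral>\<^sup>+x. ennreal_powr (frac_max A 0 f x) q \<partial>gauss) \<le> ennreal CH * (\<integral>\<^sup>+x. ennreal (\<bar>f x\<bar> powr q) \<partial>gauss)"
    using hardy_littlewood[OF q] by metis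
  have A5: "0 < 5 * A" and q1: "1 \<le> q" using A q by auto
  show thesis
  proof (rule john_nirenberg[where 'a='a, OF A5 q1])
    fix CJ assume CJ: "0 < CJ" and jn: "\<And>(b :: 'a \<Rightarrow> real) S c r. bmo_le 1 S b \<Longrightarrow> 0 \<le> S \<Longrightarrow> admissible (5 * A) c r \<Longrightarrow>
     power_deviation q b c r
       \<le> ennreal (CJ * S powr q) * emeasure gauss (ball c r)"
    define D where "D = five_const TYPE('a) A"
    have D: "0 < D" by (simp add: D_def five_const_pos)
    define C1 where "C1 = 2 powr q * (1 + CH) * CJ * D"
    define Gc where "Gc = 1 / (1 - 2 powr (- q))"
    have Gc: "0 < Gc" using q powr_less_mono[of "- q" 0 2] by (simp add: Gc_def)
    have C1: "0 < C1" using CH CJ D by (simp add: C1_def)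
    define C where "C = C1 * 2 powr q * Gc"
    show thesis
    proof (rule that)
      show "0 < C" using C1 Gc by (simp add: C_def)
      fix b :: "'a \<Rightarrow> real" and S and f :: "'a \<Rightarrow> real"
      assume bmo: "bmo_le 1 S b" and S: "0 \<le> S" and f [measurable]: "f \<in> borel_measurable gauss"
        and fin: "\<And>c r. admissible A c r \<Longrightarrow> frac_avg \<beta> f c r < \<infinity>"
      let ?L = "\<lambda>k. {x. ennreal (pow2 k) < frac_max A \<beta> f x}"
      note int = bmo_leD(1)[OF bmo]
      have [measurable]: "b \<in> borel_measurable gauss" using int by simp
      define K where "K k = {(c, r). admissible A c r \<and> ennreal (pow2 k) < frac_avg \<beta> f c r}" for k
      have "\<exists>C. countable C \<and> C \<subseteq> K k \<and> disjoint_family_on (\<lambda>(c, r). ball c r) C \<and>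
        (\<forall>c r. (c, r) \<in> K k \<longrightarrow> (\<exists>i\<in>C. ball c r \<subseteq> ball (fst i) (5 * snd i)))" for k
      proof (rule admissible_Vitali[of "K k" A])
        show "admissible A c r" if "(c, r) \<in> K k" for c r using that by (simp add: K_def)
        fix C assume "countable C" "C \<subseteq> K k" "disjoint_family_on (\<lambda>(c, r). ball c r) C"
          "\<And>c r. (c, r) \<in> K k \<Longrightarrow> \<exists>(c', r')\<in>C. ball c r \<subseteq> ball c' (5 * r')"
        then show ?thesis by (intro exI[of _ C]) (auto simp: case_prod_beta')
      qed
      then obtain V where V: "\<And>k. countable (V k)" "\<And>k. V k \<subseteq> K k"
        "\<And>k. disjoint_family_on (\<lambda>(c, r). ball c r) (V k)"
        and cov: "\<And>k c r. (c, r) \<in> K k \<Longrightarrow> \<exists>i\<in>V k. ball c r \<subseteq> ball (fst i) (5 * snd i)"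
        by metis
      define h where "h i y = \<bar>b y - ball_avg b (ball (fst i) (5 * snd i))\<bar> * indicator (ball (fst i) (5 * snd i)) y"
        for i :: "'a \<times> real" and y
      have [measurable]: "h i \<in> borel_measurable gauss" for i unfolding h_def by measurable
      define H where "H i x = ennreal_powr (ennreal (h i x) + frac_max A 0 (h i) x) q" for i x
      have [measurable]: "H i \<in> borel_measurable gauss" for i unfolding H_def by measurable
      \<comment> \<open>A ball sorted into level \<open>k\<close> has fractional average at most
        \<open>pow2 (k + 1)\<close>, hence the weight. Summing over all levels and all selected
        balls overcounts, but gives a measurable function that dominates every single ball.\<close>
      define G where "G x = (\<integral>\<^sup>+k. ennreal (pow2 (k + 1) powr q) * (\<integral>\<^sup>+i. H i x \<partial>count_space (V k)) \<partial>count_space UNIV)" for x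
      have inner [measurable]: "(\<lambda>x. \<integral>\<^sup>+i. H i x \<partial>count_space (V k)) \<in> borel_measurable gauss" for k
        by (intro borel_measurable_nn_integral_count_space V) measurable
      have Gm: "G \<in> borel_measurable gauss"
        unfolding G_def by (intro borel_measurable_nn_integral_count_space) measurable
      have Gbound: "ennreal_powr (ennreal \<bar>b x - ball_avg b (ball c r)\<bar> * frac_avg \<beta> f c r) q \<le> G x"
        if adm: "admissible A c r" and x: "x \<in> ball c r" for c r x
      proof -
        \<comment> \<open>Finiteness of the fractional average places the ball in a dyadic level; if
          the average is zero, so is the product to be bounded.\<close>
        obtain F where F: "frac_avg \<beta> f c r = ennreal F" "0 \<le> F"
          using fin[OF adm] by (cases "frac_avg \<beta> f c r") auto
        show ?thesis
        proof (cases "F = 0")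
          case False
          then obtain k where k: "pow2 k < F" "F \<le> pow2 (k + 1)" using F pow2_bracket[of F] by auto
          then have "(c, r) \<in> K k" using adm F by (auto simp: K_def ennreal_less_iff less_imp_le)
          then obtain i where i: "i \<in> V k" "ball c r \<subseteq> ball (fst i) (5 * snd i)" using cov by blast
          let ?k = "ball_avg b (ball (fst i) (5 * snd i))"
          have "ennreal \<bar>b x - ball_avg b (ball c r)\<bar> \<le> ennreal \<bar>b x - ?k\<bar> + ennreal \<bar>ball_avg b (ball c r) - ?k\<bar>"
            by (simp add: ennreal_leI flip: ennreal_plus)
          also have "\<dots> \<le> ennreal (h i x) + frac_max A 0 (h i) x"
          proof (intro add_mono)
            have "x \<in> ball (fst i) (5 * snd i)" using x i by auto
            then show "ennreal \<bar>b x - ?k\<bar> \<le> ennreal (h i x)" by (simp add: h_def)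
            show "ennreal \<bar>ball_avg b (ball c r) - ?k\<bar> \<le> frac_max A 0 (h i) x"
              using abs_ball_avg_le_frac_max[OF int adm x i(2)] unfolding h_def .
          qed
          finally have "ennreal_powr (ennreal \<bar>b x - ball_avg b (ball c r)\<bar> * frac_avg \<beta> f c r) q \<le>
              ennreal_powr ((ennreal (h i x) + frac_max A 0 (h i) x) * ennreal (pow2 (k + 1))) q"
            using q F k by (intro ennreal_powr_mono mult_mono) (auto intro: ennreal_leI)
          also have "\<dots> = ennreal (pow2 (k + 1) powr q) * H i x"
            by (simp add: ennreal_powr_mult H_def ennreal_powr_ennreal less_imp_le mult.commute)
          also have "\<dots> \<le> ennreal (pow2 (k + 1) powr q) * (\<integral>\<^sup>+i. H i x \<partial>count_space (V k))"
            using i(1) by (intro mult_left_mono nn_integral_ge_point) auto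
          also have "\<dots> \<le> G x" unfolding G_def by (rule nn_integral_ge_point) simp
          finally show ?thesis .
        qed (use F in simp)
      qed
      \<comment> \<open>John--Nirenberg is applied on the dilate, hence its parameter
        \<open>5 * A\<close>; Hardy--Littlewood absorbs the maximal function of \<open>h i\<close>,
        and doubling leads back to the undilated ball.\<close>
      have Hint: "(\<integral>\<^sup>+x. H i x \<partial>gauss) \<le> ennreal (C1 * S powr q) * emeasure gauss (ball (fst i) (snd i))"
        if "admissible A (fst i) (snd i)" for i
      proof -
        let ?B = "ball (fst i) (5 * snd i)"
        have adm5: "admissible (5 * A) (fst i) (5 * snd i)" using that by (intro admissible_scale) auto
        have "(\<integral>\<^sup>+x. H i x \<partial>gauss) \<le>
          (\<integral>\<^sup>+x. ennreal (2 powr q) * (ennreal (h i x powr q) + ennreal_powr (frac_max A 0 (h i) x) q) \<partial>gauss)"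
          unfolding H_def using q
          by (intro nn_integral_mono order_trans[OF ennreal_powr_add_le]) (auto simp: ennreal_powr_ennreal h_def)
        also have "\<dots> = ennreal (2 powr q) * ((\<integral>\<^sup>+x. ennreal (h i x powr q) \<partial>gauss) + (\<integral>\<^sup>+x. ennreal_powr (frac_max A 0 (h i) x) q \<partial>gauss))"
          by (simp add: nn_integral_cmult nn_integral_add)
        also have "\<dots> \<le> ennreal (2 powr q) * ((\<integral>\<^sup>+x. ennreal (h i x powr q) \<partial>gauss) + ennreal CH * (\<integral>\<^sup>+x. ennreal (h i x powr q) \<partial>gauss))"
        proof (intro mult_left_mono add_left_mono)
          show "(\<integral>\<^sup>+x. ennreal_powr (frac_max A 0 (h i) x) q \<partial>gauss) \<le> ennreal CH * (\<integral>\<^sup>+x. ennreal (h i x powr q) \<partial>gauss)"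
            using hl[of "h i"] by (simp add: h_def abs_mult)
        qed simp
        also have "\<dots> = ennreal (2 powr q * (1 + CH)) * (\<integral>\<^sup>+x. ennreal (h i x powr q) \<partial>gauss)"
          using CH by (simp add: ennreal_mult ennreal_plus distrib_right mult.assoc)
        also have "(\<integral>\<^sup>+x. ennreal (h i x powr q) \<partial>gauss) = (\<integral>\<^sup>+x\<in>?B. ennreal (\<bar>b x - ball_avg b ?B\<bar> powr q) \<partial>gauss)"
          by (intro nn_integral_cong) (auto simp: h_def split: split_indicator)
        also have "ennreal (2 powr q * (1 + CH)) * \<dots> \<le> ennreal (2 powr q * (1 + CH)) * (ennreal (CJ * S powr q) * emeasure gauss ?B)"
          by (intro mult_left_mono jn[OF bmo S adm5]) auto
        also have "\<dots> \<le> ennreal (2 powr q * (1 + CH)) * (ennreal (CJ * S powr q) * (ennreal D * emeasure gauss (ball (fst i) (snd i))))"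
          unfolding D_def by (intro mult_left_mono emeasure_gauss_ball_five[OF that]) auto
        also have "\<dots> = ennreal (2 powr q * (1 + CH) * (CJ * S powr q * D)) * emeasure gauss (ball (fst i) (snd i))"
          using CH CJ D by (simp only: ennreal_mult_assoc mult_nonneg_nonneg powr_ge_zero less_imp_le add_nonneg_nonneg zero_le_one)
        also have "2 powr q * (1 + CH) * (CJ * S powr q * D) = C1 * S powr q" by (simp add: C1_def)
        finally show ?thesis .
      qed
      have lev: "?L k \<in> sets lebesgue" for k
        using borel_measurable_less[of "\<lambda>_. ennreal (pow2 k)" gauss "frac_max A \<beta> f"] by simp
      \<comment> \<open>The selected balls are disjoint and contained in the superlevel set, because
        each of them competes in the supremum at all of its points.\<close>
      have level: "(\<integral>\<^sup>+x. (\<integral>\<^sup>+i. H i x \<partial>count_space (V k)) \<partial>gauss) \<le>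
        ennreal (C1 * S powr q) * emeasure gauss (?L k)" for k
      proof -
        have "(\<integral>\<^sup>+x. (\<integral>\<^sup>+i. H i x \<partial>count_space (V k)) \<partial>gauss) = (\<integral>\<^sup>+i. (\<integral>\<^sup>+x. H i x \<partial>gauss) \<partial>count_space (V k))"
          by (intro nn_integral_count_space_nn_integral V) measurable
        also have "\<dots> \<le> (\<integral>\<^sup>+i. ennreal (C1 * S powr q) * emeasure gauss (ball (fst i) (snd i)) \<partial>count_space (V k))"
        proof (intro nn_integral_mono Hint)
          fix i assume "i \<in> space (count_space (V k))"
          then have "i \<in> K k" using V(2) by auto
          then show "admissible A (fst i) (snd i)" by (simp add: K_def case_prod_beta)
        qed
        also have "\<dots> = ennreal (C1 * S powr q) * (\<integral>\<^sup>+i. emeasure gauss (ball (fst i) (snd i)) \<partial>count_space (V k))"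
          by (simp add: nn_integral_cmult)
        also have "(\<integral>\<^sup>+i. emeasure gauss (ball (fst i) (snd i)) \<partial>count_space (V k)) = emeasure gauss (\<Union>i\<in>V k. ball (fst i) (snd i))"
          using V(1,3) by (intro emeasure_UN_countable [symmetric]) (auto simp: case_prod_beta')
        also have "ennreal (C1 * S powr q) * \<dots> \<le> ennreal (C1 * S powr q) * emeasure gauss (?L k)"
        proof (intro mult_left_mono emeasure_mono)
          have "ball (fst i) (snd i) \<subseteq> ?L k" if "i \<in> V k" for i
          proof
            fix x assume x: "x \<in> ball (fst i) (snd i)"
            have "i \<in> K k" using V(2) that by auto
            then have "admissible A (fst i) (snd i)" "ennreal (pow2 k) < frac_avg \<beta> f (fst i) (snd i)"
              by (auto simp: K_def case_prod_beta)
            then show "x \<in> ?L k"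
              using frac_avg_le_frac_max[of A "fst i" "snd i" x f \<beta>] x by (auto simp del: mem_ball intro: order.strict_trans2)
          qed
          then show "(\<Union>i\<in>V k. ball (fst i) (snd i)) \<subseteq> ?L k" by (rule UN_least)
        qed (use lev in auto)
        finally show ?thesis .
      qed
      have "(\<integral>\<^sup>+x. G x \<partial>gauss) = (\<integral>\<^sup>+k. (\<integral>\<^sup>+x. ennreal (pow2 (k + 1) powr q) * (\<integral>\<^sup>+i. H i x \<partial>count_space (V k)) \<partial>gauss) \<partial>count_space UNIV)"
        unfolding G_def by (intro nn_integral_count_space_nn_integral) auto
      also have "\<dots> \<le> (\<integral>\<^sup>+k. ennreal (pow2 (k + 1) powr q) * (ennreal (C1 * S powr q) * emeasure gauss (?L k)) \<partial>count_space UNIV)"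
        by (intro nn_integral_mono) (simp add: nn_integral_cmult mult_left_mono level)
      also have "\<dots> = (\<integral>\<^sup>+k. ennreal (C1 * 2 powr q * S powr q) * (ennreal (pow2 k powr q) * emeasure gauss (?L k)) \<partial>count_space UNIV)"
      proof (intro nn_integral_cong)
        fix k
        have "pow2 (k + 1) powr q * (C1 * S powr q) = C1 * 2 powr q * S powr q * pow2 k powr q"
          by (simp add: pow2_def powr_powr powr_add[symmetric] algebra_simps)
        then show "ennreal (pow2 (k + 1) powr q) * (ennreal (C1 * S powr q) * emeasure gauss (?L k)) =
          ennreal (C1 * 2 powr q * S powr q) * (ennreal (pow2 k powr q) * emeasure gauss (?L k))"
          using C1 by (simp only: ennreal_mult_assoc powr_ge_zero mult_nonneg_nonneg less_imp_le)
      qed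
      also have "\<dots> = ennreal (C1 * 2 powr q * S powr q) * (\<integral>\<^sup>+k. ennreal (pow2 k powr q) * emeasure gauss (?L k) \<partial>count_space UNIV)"
        by (rule nn_integral_cmult) simp
      also have "\<dots> \<le> ennreal (C1 * 2 powr q * S powr q) * (ennreal Gc * (\<integral>\<^sup>+x. ennreal_powr (frac_max A \<beta> f x) q \<partial>gauss))"
        unfolding Gc_def using dyadic_level_sum_le[of q "frac_max A \<beta> f" gauss] q by (intro mult_left_mono) auto
      also have "\<dots> = ennreal (C1 * 2 powr q * S powr q * Gc) * (\<integral>\<^sup>+x. ennreal_powr (frac_max A \<beta> f x) q \<partial>gauss)"
        using C1 Gc by (intro ennreal_mult_assoc) auto
      also have "C1 * 2 powr q * S powr q * Gc = C * S powr q" by (simp add: C_def)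
      finally have Gint: "(\<integral>\<^sup>+x. G x \<partial>gauss) \<le> ennreal (C * S powr q) * (\<integral>\<^sup>+x. ennreal_powr (frac_max A \<beta> f x) q \<partial>gauss)" .
      show "\<exists>G\<in>borel_measurable gauss.
       (\<forall>c r x. admissible A c r \<and> x \<in> ball c r \<longrightarrow>
          ennreal_powr (ennreal \<bar>b x - ball_avg b (ball c r)\<bar> * frac_avg \<beta> f c r) q \<le> G x) \<and>
       (\<integral>\<^sup>+x. G x \<partial>gauss) \<le> ennreal (C * S powr q) * (\<integral>\<^sup>+x. ennreal_powr (frac_max A \<beta> f x) q \<partial>gauss)"
        using Gm Gbound Gint by blast
    qed
  qed
qed

text \<open>Hoelder puts the exponent \<open>s'\<close> on \<open>b\<close>, where John--Nirenberg
  applies, and \<open>s\<close> on \<open>f\<close>. The order \<open>\<beta> * s\<close> is the one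
  for which the powers of the measure match:
  \<open>1 / s' + (1 - \<beta> * s) / s = 1 - \<beta>\<close>.\<close>

lemma oscillation_Hoelder:
  fixes A \<beta> s :: real
  assumes A: "0 < A" and s: "1 < s"
  obtains C where "0 < C" "\<And>(b :: 'a::euclidean_space \<Rightarrow> real) S f c r x.
     bmo_le 1 S b \<Longrightarrow> 0 \<le> S \<Longrightarrow> f \<in> borel_measurable gauss \<Longrightarrow>
     admissible A c r \<Longrightarrow> x \<in> ball c r \<Longrightarrow>
     (\<integral>\<^sup>+y\<in>ball c r. ennreal (\<bar>b y - ball_avg b (ball c r)\<bar> * \<bar>f y\<bar>) \<partial>gauss)
       \<le> ennreal (C * S) * ennreal_powr (frac_max A (\<beta> * s) (\<lambda>y. \<bar>f y\<bar> powr s) x) (1 / s)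
          * ennreal (measure gauss (ball c r) powr (1 - \<beta>))"
proof -
  define s' where "s' = s / (s - 1)"
  have s': "1 < s'" "1 / s + 1 / s' = 1" using s by (auto simp: s'_def field_simps)
  then have s'1: "1 \<le> s'" by simp
  show thesis
  proof (rule john_nirenberg[where 'a='a, OF A s'1])
    fix CJ assume CJ: "0 < CJ" and jn: "\<And>(b :: 'a \<Rightarrow> real) S c r. bmo_le 1 S b \<Longrightarrow> 0 \<le> S \<Longrightarrow> admissible A c r \<Longrightarrow>
     power_deviation s' b c r
       \<le> ennreal (CJ * S powr s') * emeasure gauss (ball c r)"
    show thesis
    proof (rule that)
      show "0 < 2 * CJ powr (1 / s')" using CJ by simp
      fix b :: "'a \<Rightarrow> real" and S and f :: "'a \<Rightarrow> real" and c :: 'a and r x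
      assume bmo: "bmo_le 1 S b" and S: "0 \<le> S" and [measurable]: "f \<in> borel_measurable gauss"
        and adm: "admissible A c r" and x: "x \<in> ball c r"
      have [measurable]: "b \<in> borel_measurable gauss" using bmo_leD(1)[OF bmo] by simp
      let ?B = "ball c r"
      let ?k = "ball_avg b ?B" and ?g = "measure gauss ?B" and ?M = "frac_max A (\<beta> * s) (\<lambda>y. \<bar>f y\<bar> powr s) x"
      have g: "0 < ?g" using adm by (intro measure_gauss_ball_pos) (simp add: admissible_def)
      have "(\<integral>\<^sup>+y\<in>?B. ennreal (\<bar>b y - ?k\<bar> * \<bar>f y\<bar>) \<partial>gauss) =
        (\<integral>\<^sup>+y. ennreal ((\<bar>b y - ?k\<bar> * indicator ?B y) * (\<bar>f y\<bar> * indicator ?B y)) \<partial>gauss)"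
        by (intro nn_integral_cong) (auto split: split_indicator)
      also have "\<dots> \<le> 2 * ennreal_powr (\<integral>\<^sup>+y. ennreal ((\<bar>b y - ?k\<bar> * indicator ?B y) powr s') \<partial>gauss) (1 / s')
        * ennreal_powr (\<integral>\<^sup>+y. ennreal ((\<bar>f y\<bar> * indicator ?B y) powr s) \<partial>gauss) (1 / s)"
        using s s' by (intro nn_integral_mult_le_powr) auto
      also have "(\<integral>\<^sup>+y. ennreal ((\<bar>b y - ?k\<bar> * indicator ?B y) powr s') \<partial>gauss) =
          (\<integral>\<^sup>+y\<in>?B. ennreal (\<bar>b y - ?k\<bar> powr s') \<partial>gauss)"
        by (intro nn_integral_cong) (auto split: split_indicator)
      also have "(\<integral>\<^sup>+y. ennreal ((\<bar>f y\<bar> * indicator ?B y) powr s) \<partial>gauss) = ball_integral (\<lambda>y. \<bar>f y\<bar> powr s) c r"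
        by (intro nn_integral_cong) (auto split: split_indicator)
      also have "2 * ennreal_powr (\<integral>\<^sup>+y\<in>?B. ennreal (\<bar>b y - ?k\<bar> powr s') \<partial>gauss) (1 / s') * ennreal_powr (ball_integral (\<lambda>y. \<bar>f y\<bar> powr s) c r) (1 / s)
        \<le> 2 * ennreal_powr (ennreal (CJ * S powr s') * emeasure gauss ?B) (1 / s') *
           ennreal_powr (?M * ennreal (?g powr (1 - \<beta> * s))) (1 / s)"
        using s s' by (intro mult_mono ennreal_powr_mono jn[OF bmo S adm] ball_integral_le_frac_max[OF adm x]) auto
      also have "\<dots> = 2 * ennreal ((CJ * S powr s' * ?g) powr (1 / s')) * (ennreal_powr ?M (1 / s) * ennreal (?g powr ((1 - \<beta> * s) / s)))"
        using CJ by (simp add: emeasure_gauss_ball_eq ennreal_powr_ennreal ennreal_powr_mult[of ?M] powr_powr flip: ennreal_mult)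
      also have "\<dots> = ennreal_powr ?M (1 / s) * ennreal (2 * (CJ * S powr s' * ?g) powr (1 / s') * ?g powr ((1 - \<beta> * s) / s))"
        by (simp add: ennreal_mult mult_ac)
      also have "2 * (CJ * S powr s' * ?g) powr (1 / s') * ?g powr ((1 - \<beta> * s) / s) = 2 * CJ powr (1 / s') * S * ?g powr (1 - \<beta>)"
      proof -
        have "(CJ * S powr s' * ?g) powr (1 / s') = CJ powr (1 / s') * S * ?g powr (1 / s')"
          using CJ g S s' by (simp add: powr_mult powr_powr)
        moreover have "?g powr (1 / s') * ?g powr ((1 - \<beta> * s) / s) = ?g powr (1 - \<beta>)"
        proof -
          have "(1 - \<beta> * s) / s = 1 / s - \<beta>" using s by (simp add: field_simps)
          then have "1 / s' + (1 - \<beta> * s) / s = 1 - \<beta>" using s'(2) by linarith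
          then show ?thesis by (simp flip: powr_add)
        qed
        ultimately show ?thesis by (simp add: mult.assoc)
      qed
      finally show "(\<integral>\<^sup>+y\<in>?B. ennreal (\<bar>b y - ?k\<bar> * \<bar>f y\<bar>) \<partial>gauss)
       \<le> ennreal (2 * CJ powr (1 / s') * S) * ennreal_powr ?M (1 / s) * ennreal (?g powr (1 - \<beta>))"
        using S by (simp add: ennreal_mult mult_ac)
    qed
  qed
qed

section \<open>The commutator\<close>

text \<open>By sublinearity, \<open>\<bar>b x\<bar>\<close> times the maximal function of
  \<open>f\<close> differs from the maximal function of \<open>b * f\<close> by at most
  \<open>V\<close>, in both directions. Replacing \<open>\<bar>b x\<bar>\<close> by
  \<open>b x\<close> changes the first quantity by twice the negative part.\<close>

lemma commutator_le:
  fixes b f :: "'a::euclidean_space \<Rightarrow> real"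
  assumes [measurable]: "b \<in> borel_measurable gauss" "f \<in> borel_measurable gauss"
    and fin: "frac_max A \<beta> f x < \<infinity>"
    and V: "\<And>c r. admissible A c r \<Longrightarrow> x \<in> ball c r \<Longrightarrow>
      (\<integral>\<^sup>+y\<in>ball c r. ennreal (\<bar>b x - b y\<bar> * \<bar>f y\<bar>) \<partial>gauss) \<le> V * ennreal (measure gauss (ball c r) powr (1 - \<beta>))"
  shows "e2ennreal \<bar>commutator b A \<beta> f x\<bar> \<le> V + 2 * ennreal (neg_part b x) * frac_max A \<beta> f x"
proof -
  let ?F = "frac_max A \<beta> f x" and ?m = "frac_max A \<beta> (\<lambda>y. b y * f y) x"
  have up: "?m \<le> ennreal \<bar>b x\<bar> * ?F + V"
    unfolding frac_max_le_iff
  proof (intro allI impI, elim conjE)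
    fix c :: 'a and r assume cr: "admissible A c r" "x \<in> ball c r"
    let ?e = "ennreal (measure gauss (ball c r) powr (1 - \<beta>))"
    have "\<bar>b y * f y\<bar> \<le> \<bar>b x\<bar> * \<bar>f y\<bar> + \<bar>b x - b y\<bar> * \<bar>f y\<bar>" for y
      unfolding abs_mult distrib_right [symmetric] by (intro mult_right_mono) auto
    then have "ball_integral (\<lambda>y. b y * f y) c r \<le>
        ennreal \<bar>b x\<bar> * ball_integral f c r + (\<integral>\<^sup>+y\<in>ball c r. ennreal (\<bar>b x - b y\<bar> * \<bar>f y\<bar>) \<partial>gauss)"
      by (intro set_nn_integral_le_add) auto
    also have "\<dots> \<le> ennreal \<bar>b x\<bar> * (?F * ?e) + V * ?e"
      by (intro add_mono mult_left_mono ball_integral_le_frac_max cr V) auto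
    also have "\<dots> = (ennreal \<bar>b x\<bar> * ?F + V) * ?e" by (simp add: distrib_right mult.assoc)
    finally show "ball_integral (\<lambda>y. b y * f y) c r \<le> (ennreal \<bar>b x\<bar> * ?F + V) * ?e" .
  qed
  have low: "ennreal \<bar>b x\<bar> * ?F \<le> ?m + V"
  proof (cases "b x = 0")
    \<comment> \<open>Here the supremum defining the maximal function of \<open>f\<close> is bounded
      ball by ball, which requires dividing by \<open>\<bar>b x\<bar>\<close>.\<close>
    case False
    define l where "l = \<bar>b x\<bar>"
    have l: "0 < l" using False by (simp add: l_def)
    have "?F \<le> ennreal (1 / l) * (?m + V)"
      unfolding frac_max_le_iff[of A \<beta> f]
    proof (intro allI impI, elim conjE)
      fix c :: 'a and r assume cr: "admissible A c r" "x \<in> ball c r"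
      let ?e = "ennreal (measure gauss (ball c r) powr (1 - \<beta>))"
      have "l * \<bar>f y\<bar> \<le> 1 * \<bar>b y * f y\<bar> + \<bar>b x - b y\<bar> * \<bar>f y\<bar>" for y
        unfolding l_def abs_mult mult_1 distrib_right [symmetric] by (intro mult_right_mono) auto
      then have "(\<integral>\<^sup>+y\<in>ball c r. ennreal (l * \<bar>f y\<bar>) \<partial>gauss) \<le>
          ennreal 1 * ball_integral (\<lambda>y. b y * f y) c r + (\<integral>\<^sup>+y\<in>ball c r. ennreal (\<bar>b x - b y\<bar> * \<bar>f y\<bar>) \<partial>gauss)"
        by (intro set_nn_integral_le_add) auto
      moreover have "ennreal l * ball_integral f c r = (\<integral>\<^sup>+y\<in>ball c r. ennreal (l * \<bar>f y\<bar>) \<partial>gauss)"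
        using l by (simp add: ennreal_mult mult.assoc nn_integral_cmult)
      ultimately have "ennreal l * ball_integral f c r \<le>
          ball_integral (\<lambda>y. b y * f y) c r + (\<integral>\<^sup>+y\<in>ball c r. ennreal (\<bar>b x - b y\<bar> * \<bar>f y\<bar>) \<partial>gauss)"
        by simp
      also have "\<dots> \<le> ?m * ?e + V * ?e"
        by (intro add_mono ball_integral_le_frac_max cr V)
      also have "\<dots> = ennreal (l * (1 / l)) * ((?m + V) * ?e)" using l by (simp add: distrib_right)
      finally have "ball_integral f c r \<le> ennreal (1 / l) * ((?m + V) * ?e)"
        by (rule ennreal_mult_le_cancel[OF l])
      then show "ball_integral f c r \<le> ennreal (1 / l) * (?m + V) * ?e" by (simp add: mult.assoc)
    qed
    then have "ennreal l * ?F \<le> ennreal l * (ennreal (1 / l) * (?m + V))" by (rule mult_left_mono) simp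
    also have "\<dots> = ?m + V" using l by (subst ennreal_mult_assoc) auto
    finally show ?thesis by (simp add: l_def)
  qed simp
  show ?thesis
  proof (cases V)
    case (real v)
    obtain F where F: "?F = ennreal F" "0 \<le> F" using fin by (cases ?F) auto
    \<comment> \<open>For finite \<open>V\<close>, the bound \<open>up\<close> makes the maximal
      function of \<open>b * f\<close> finite, so the commutator is a difference of real
      numbers.\<close>
    have "ennreal \<bar>b x\<bar> * ?F + V < top" using F real by (simp add: ennreal_mult_less_top)
    with up have "?m < top" by (rule order.strict_trans1)
    then obtain m where m: "?m = ennreal m" "0 \<le> m" by (cases ?m) auto
    have up': "m \<le> \<bar>b x\<bar> * F + v" and low': "\<bar>b x\<bar> * F \<le> m + v"
      using up low F real m by (simp_all flip: ennreal_mult ennreal_plus)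
    have "\<bar>b x * F - m\<bar> \<le> v + 2 * neg_part b x * F"
    proof (cases "0 \<le> b x")
      case True
      then show ?thesis using up' low' by (auto simp: neg_part_def)
    next
      case False
      then have np: "\<bar>b x\<bar> * F = - (b x * F)" "0 \<le> - (b x * F)" "2 * neg_part b x * F = - 2 * (b x * F)"
        using F by (auto simp: neg_part_def mult_nonpos_nonneg)
      show ?thesis
        unfolding np(3) using up' low' m(2) np(1,2) by (intro abs_leI) linarith+
    qed
    moreover have "commutator b A \<beta> f x = ereal (b x * F - m)"
      using F m by (simp add: commutator_def enn2ereal_ennreal)
    moreover have "0 \<le> neg_part b x" by (simp add: neg_part_def)
    ultimately show ?thesis
      using F real by (simp add: ennreal_leI flip: ennreal_mult ennreal_plus ennreal_numeral)
  qed simp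
qed

lemma Lp_norm_ereal: "Lp_norm p (\<lambda>x. ereal (f x)) = ennreal_powr (\<integral>\<^sup>+x. ennreal (\<bar>f x\<bar> powr p) \<partial>gauss) (1 / p)"
  unfolding Lp_norm_def by (simp add: ennreal_powr_ennreal)

text \<open>The pointwise bound has three parts: \<open>G\<close> for the oscillation at
  \<open>x\<close>, \<open>H\<close> for the oscillation under the integral, \<open>M\<close> for
  the negative part. All three lead to the same power of the norm of \<open>f\<close>: applied to
  \<open>\<bar>f\<bar> powr s\<close>, the fractional inequality with exponents \<open>p / s\<close>
  and \<open>q / s\<close> has the same ratio \<open>q / p\<close>.\<close>

lemma commutator_bound:
  fixes A \<beta> p q :: real
  assumes A: "0 < A" and p: "1 < p" "p < q" "1 / q = 1 / p - \<beta>"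
  obtains C where "0 < C" "\<And>(b :: 'a::euclidean_space \<Rightarrow> real) S k f.
     bmo_le 1 S b \<Longrightarrow> 0 \<le> S \<Longrightarrow> 0 \<le> k \<Longrightarrow> (AE x in gauss. neg_part b x \<le> k) \<Longrightarrow>
     f \<in> borel_measurable gauss \<Longrightarrow> (\<And>x. frac_max A \<beta> f x < \<infinity>) \<Longrightarrow>
     Lp_norm q (commutator b A \<beta> f) \<le> ennreal (C * (S + k)) * Lp_norm p (\<lambda>x. ereal (f x))"
proof -
  \<comment> \<open>Any number strictly between 1 and \<open>p\<close> would do:
    \<open>1 < s\<close> is needed for Hoelder, \<open>s < p\<close> for the fractional inequality
    with exponent \<open>p / s\<close>.\<close>
  define s where "s = (1 + p) / 2"
  have s: "1 < s" "s < p" using p by (auto simp: s_def)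
  have q: "1 < q" using p by simp
  have ps: "1 < p / s" "p / s < q / s" "1 / (q / s) = 1 / (p / s) - \<beta> * s"
  proof -
    show "1 < p / s" "p / s < q / s" using s p by (auto simp: divide_strict_right_mono)
    have "1 / (q / s) = s * (1 / q)" by simp
    also have "\<dots> = 1 / (p / s) - \<beta> * s" unfolding p(3) by (simp add: algebra_simps)
    finally show "1 / (q / s) = 1 / (p / s) - \<beta> * s" .
  qed
  obtain C3 where C3: "0 < C3" and hls3: "\<And>f :: 'a \<Rightarrow> real. f \<in> borel_measurable gauss \<Longrightarrow>
    (\<integral>\<^sup>+x. ennreal_powr (frac_max A (\<beta> * s) f x) (q / s) \<partial>gauss)
      \<le> ennreal C3 * ennreal_powr (\<integral>\<^sup>+x. ennreal (\<bar>f x\<bar> powr (p / s)) \<partial>gauss) (q / s / (p / s))"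
    using hardy_littlewood_sobolev[OF ps] by metis
  obtain C4 where C4: "0 < C4" and hls4: "\<And>f :: 'a \<Rightarrow> real. f \<in> borel_measurable gauss \<Longrightarrow>
    (\<integral>\<^sup>+x. ennreal_powr (frac_max A \<beta> f x) q \<partial>gauss)
      \<le> ennreal C4 * ennreal_powr (\<integral>\<^sup>+x. ennreal (\<bar>f x\<bar> powr p) \<partial>gauss) (q / p)"
    using hardy_littlewood_sobolev[OF p] by metis
  show thesis
  proof (rule maximal_oscillation[where 'a='a and \<beta>=\<beta>, OF A q], rule oscillation_Hoelder[where 'a='a and \<beta>=\<beta>, OF A s(1)])
    fix C1 C2
    assume C1: "0 < C1" and mo: "\<And>(b :: 'a \<Rightarrow> real) S f.
     bmo_le 1 S b \<Longrightarrow> 0 \<le> S \<Longrightarrow> f \<in> borel_measurable gauss \<Longrightarrow>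
     (\<And>c r. admissible A c r \<Longrightarrow> frac_avg \<beta> f c r < \<infinity>) \<Longrightarrow>
     \<exists>G\<in>borel_measurable gauss.
       (\<forall>c r x. admissible A c r \<and> x \<in> ball c r \<longrightarrow>
          ennreal_powr (ennreal \<bar>b x - ball_avg b (ball c r)\<bar> * frac_avg \<beta> f c r) q \<le> G x) \<and>
       (\<integral>\<^sup>+x. G x \<partial>gauss) \<le> ennreal (C1 * S powr q) * (\<integral>\<^sup>+x. ennreal_powr (frac_max A \<beta> f x) q \<partial>gauss)"
    assume C2: "0 < C2" and oh: "\<And>(b :: 'a \<Rightarrow> real) S f c r x.
     bmo_le 1 S b \<Longrightarrow> 0 \<le> S \<Longrightarrow> f \<in> borel_measurable gauss \<Longrightarrow>
     admissible A c r \<Longrightarrow> x \<in> ball c r \<Longrightarrow>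
     (\<integral>\<^sup>+y\<in>ball c r. ennreal (\<bar>b y - ball_avg b (ball c r)\<bar> * \<bar>f y\<bar>) \<partial>gauss)
       \<le> ennreal (C2 * S) * ennreal_powr (frac_max A (\<beta> * s) (\<lambda>y. \<bar>f y\<bar> powr s) x) (1 / s)
          * ennreal (measure gauss (ball c r) powr (1 - \<beta>))"
    \<comment> \<open>The two outer factors \<open>2 powr q\<close> come from separating three
      summands in two steps, the innermost one from the 2 in \<open>2 * k\<close>.\<close>
    define C where "C = 2 powr q * (C1 * C4 + 2 powr q * (C2 powr q * C3 + 2 powr q * C4))"
    have C: "0 < C" using C1 C2 C3 C4 by (auto simp: C_def intro!: mult_pos_pos add_pos_pos)
    show thesis
    proof (rule that)
      show "0 < C powr (1 / q)" using C by simp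
      fix b :: "'a \<Rightarrow> real" and S k and f :: "'a \<Rightarrow> real"
      assume bmo: "bmo_le 1 S b" and S: "0 \<le> S" and k: "0 \<le> k" and nb: "AE x in gauss. neg_part b x \<le> k"
        and f [measurable]: "f \<in> borel_measurable gauss" and fin: "\<And>x. frac_max A \<beta> f x < \<infinity>"
      have bm [measurable]: "b \<in> borel_measurable gauss" using bmo_leD(1)[OF bmo] by simp
      have fin': "frac_avg \<beta> f c r < \<infinity>" if "admissible A c r" for c r
        using frac_avg_le_frac_max[OF that, of c f \<beta>] fin[of c] that
        by (auto simp: admissible_def intro: order.strict_trans1)
      obtain G where Gm [measurable]: "G \<in> borel_measurable gauss"
        and Gp: "\<And>c r x. admissible A c r \<Longrightarrow> x \<in> ball c r \<Longrightarrow>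
          ennreal_powr (ennreal \<bar>b x - ball_avg b (ball c r)\<bar> * frac_avg \<beta> f c r) q \<le> G x"
        and Gi: "(\<integral>\<^sup>+x. G x \<partial>gauss) \<le> ennreal (C1 * S powr q) * (\<integral>\<^sup>+x. ennreal_powr (frac_max A \<beta> f x) q \<partial>gauss)"
        using mo[OF bmo S f fin'] by blast
      define J where "J = ennreal_powr (\<integral>\<^sup>+x. ennreal (\<bar>f x\<bar> powr p) \<partial>gauss) (q / p)"
      define M where "M = frac_max A \<beta> f"
      define H where "H x = ennreal (C2 * S) * ennreal_powr (frac_max A (\<beta> * s) (\<lambda>y. \<bar>f y\<bar> powr s) x) (1 / s)" for x
      have [measurable]: "M \<in> borel_measurable gauss" "H \<in> borel_measurable gauss" unfolding M_def H_def by measurable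
      have Mi: "(\<integral>\<^sup>+x. ennreal_powr (M x) q \<partial>gauss) \<le> ennreal C4 * J"
        unfolding M_def J_def by (rule hls4[OF f])
      have Gi': "(\<integral>\<^sup>+x. G x \<partial>gauss) \<le> ennreal (S powr q * (C1 * C4)) * J"
      proof -
        have "(\<integral>\<^sup>+x. G x \<partial>gauss) \<le> ennreal (C1 * S powr q) * (ennreal C4 * J)"
          using Gi Mi unfolding M_def by (blast intro: order_trans mult_left_mono zero_le)
        also have "\<dots> = ennreal (C1 * S powr q * C4) * J" using C1 C4 by (intro ennreal_mult_assoc) auto
        finally show ?thesis by (simp add: mult_ac)
      qed
      have Hi: "(\<integral>\<^sup>+x. ennreal_powr (H x) q \<partial>gauss) \<le> ennreal (S powr q * (C2 powr q * C3)) * J"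
      proof -
        have "(\<integral>\<^sup>+x. ennreal_powr (H x) q \<partial>gauss) =
          (\<integral>\<^sup>+x. ennreal ((C2 * S) powr q) * ennreal_powr (frac_max A (\<beta> * s) (\<lambda>y. \<bar>f y\<bar> powr s) x) (q / s) \<partial>gauss)"
          using C2 S by (intro nn_integral_cong) (simp add: H_def ennreal_powr_mult ennreal_powr_powr ennreal_powr_ennreal)
        also have "\<dots> = ennreal ((C2 * S) powr q) * (\<integral>\<^sup>+x. ennreal_powr (frac_max A (\<beta> * s) (\<lambda>y. \<bar>f y\<bar> powr s) x) (q / s) \<partial>gauss)"
          by (rule nn_integral_cmult) measurable
        also have "\<dots> \<le> ennreal ((C2 * S) powr q) * (ennreal C3 * ennreal_powr (\<integral>\<^sup>+x. ennreal (\<bar>\<bar>f x\<bar> powr s\<bar> powr (p / s)) \<partial>gauss) (q / s / (p / s)))"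
          by (intro mult_left_mono hls3) measurable
        also have "ennreal_powr (\<integral>\<^sup>+x. ennreal (\<bar>\<bar>f x\<bar> powr s\<bar> powr (p / s)) \<partial>gauss) (q / s / (p / s)) = J"
          using s by (simp add: J_def powr_powr)
        also have "ennreal ((C2 * S) powr q) * (ennreal C3 * J) = ennreal ((C2 * S) powr q * C3) * J"
          using C3 by (intro ennreal_mult_assoc) auto
        also have "(C2 * S) powr q * C3 = S powr q * (C2 powr q * C3)"
          using C2 S by (simp add: powr_mult)
        finally show ?thesis .
      qed
      have pointwise: "e2ennreal \<bar>commutator b A \<beta> f x\<bar> \<le>
          (ennreal_powr (G x) (1 / q) + H x) + 2 * ennreal (neg_part b x) * M x" for x
        unfolding M_def
      proof (rule commutator_le[OF bm f fin])
        fix c :: 'a and r assume cr: "admissible A c r" "x \<in> ball c r"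
        let ?B = "ball c r" and ?e = "ennreal (measure gauss (ball c r) powr (1 - \<beta>))"
        let ?k = "ball_avg b ?B"
        have g: "0 < measure gauss ?B" using cr by (intro measure_gauss_ball_pos) (simp add: admissible_def)
        have "\<bar>b x - b y\<bar> * \<bar>f y\<bar> \<le> \<bar>b x - ?k\<bar> * \<bar>f y\<bar> + \<bar>b y - ?k\<bar> * \<bar>f y\<bar>" for y
          unfolding distrib_right [symmetric] by (intro mult_right_mono) auto
        then have "(\<integral>\<^sup>+y\<in>?B. ennreal (\<bar>b x - b y\<bar> * \<bar>f y\<bar>) \<partial>gauss) \<le>
            ennreal \<bar>b x - ?k\<bar> * ball_integral f c r + (\<integral>\<^sup>+y\<in>?B. ennreal (\<bar>b y - ?k\<bar> * \<bar>f y\<bar>) \<partial>gauss)"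
          by (intro set_nn_integral_le_add) auto
        also have "\<dots> \<le> ennreal \<bar>b x - ?k\<bar> * (frac_avg \<beta> f c r * ?e) + H x * ?e"
        proof (intro add_mono mult_left_mono)
          show "ball_integral f c r \<le> frac_avg \<beta> f c r * ?e"
            using g ennreal_divide_le_iff[of "measure gauss ?B powr (1 - \<beta>)" "ball_integral f c r" "frac_avg \<beta> f c r"] by simp
          show "(\<integral>\<^sup>+y\<in>?B. ennreal (\<bar>b y - ?k\<bar> * \<bar>f y\<bar>) \<partial>gauss) \<le> H x * ?e"
            unfolding H_def by (rule oh[OF bmo S f cr])
        qed simp
        also have "\<dots> = (ennreal \<bar>b x - ?k\<bar> * frac_avg \<beta> f c r + H x) * ?e"
          by (simp add: distrib_right mult.assoc)
        also have "\<dots> \<le> (ennreal_powr (G x) (1 / q) + H x) * ?e"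
          using Gp[OF cr] q by (intro mult_right_mono add_right_mono) (auto simp: ennreal_powr_le_iff)
        finally show "(\<integral>\<^sup>+y\<in>?B. ennreal (\<bar>b x - b y\<bar> * \<bar>f y\<bar>) \<partial>gauss) \<le> (ennreal_powr (G x) (1 / q) + H x) * ?e" .
      qed
      have "(\<integral>\<^sup>+x. ennreal_powr (e2ennreal \<bar>commutator b A \<beta> f x\<bar>) q \<partial>gauss) \<le>
        (\<integral>\<^sup>+x. ennreal (2 powr q) * (G x + ennreal (2 powr q) * (ennreal_powr (H x) q + ennreal ((2 * k) powr q) * ennreal_powr (M x) q)) \<partial>gauss)"
      proof (intro nn_integral_mono_AE)
        show "AE x in gauss. ennreal_powr (e2ennreal \<bar>commutator b A \<beta> f x\<bar>) q \<le>
          ennreal (2 powr q) * (G x + ennreal (2 powr q) * (ennreal_powr (H x) q + ennreal ((2 * k) powr q) * ennreal_powr (M x) q))"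
          using nb
        proof eventually_elim
          case (elim x)
          have "e2ennreal \<bar>commutator b A \<beta> f x\<bar> \<le> ennreal_powr (G x) (1 / q) + (H x + ennreal (2 * k) * M x)"
          proof -
            have "2 * ennreal (neg_part b x) \<le> ennreal (2 * k)"
              using elim k by (simp add: ennreal_mult ennreal_leI mult_left_mono)
            then have "2 * ennreal (neg_part b x) * M x \<le> ennreal (2 * k) * M x" by (rule mult_right_mono) simp
            then show ?thesis using pointwise[of x]
              by (simp add: add.assoc) (meson add_left_mono order_trans)
          qed
          then have "ennreal_powr (e2ennreal \<bar>commutator b A \<beta> f x\<bar>) q \<le>
            ennreal_powr (ennreal_powr (G x) (1 / q) + (H x + ennreal (2 * k) * M x)) q"
            using q by (intro ennreal_powr_mono) auto
          also have "\<dots> \<le> ennreal (2 powr q) * (ennreal_powr (ennreal_powr (G x) (1 / q)) q + ennreal_powr (H x + ennreal (2 * k) * M x) q)"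
            using q by (intro ennreal_powr_add_le) auto
          also have "\<dots> \<le> ennreal (2 powr q) * (ennreal_powr (ennreal_powr (G x) (1 / q)) q +
            ennreal (2 powr q) * (ennreal_powr (H x) q + ennreal_powr (ennreal (2 * k) * M x) q))"
            using q by (intro mult_left_mono add_left_mono ennreal_powr_add_le) auto
          also have "ennreal_powr (ennreal_powr (G x) (1 / q)) q = G x"
            using q by (simp add: ennreal_powr_powr)
          also have "ennreal_powr (ennreal (2 * k) * M x) q = ennreal ((2 * k) powr q) * ennreal_powr (M x) q"
            using k by (simp add: ennreal_powr_mult[of "ennreal (2 * k)"] ennreal_powr_ennreal)
          finally show ?case .
        qed
      qed
      also have "\<dots> = ennreal (2 powr q) * ((\<integral>\<^sup>+x. G x \<partial>gauss) + ennreal (2 powr q) * ((\<integral>\<^sup>+x. ennreal_powr (H x) q \<partial>gauss)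
          + ennreal ((2 * k) powr q) * (\<integral>\<^sup>+x. ennreal_powr (M x) q \<partial>gauss)))"
        by (simp add: nn_integral_cmult nn_integral_add)
      also have "\<dots> \<le> ennreal (2 powr q) * (ennreal (S powr q * (C1 * C4)) * J + ennreal (2 powr q) * (ennreal (S powr q * (C2 powr q * C3)) * J
          + ennreal ((2 * k) powr q) * (ennreal C4 * J)))"
        by (intro mult_left_mono add_mono Gi' Hi Mi) auto
      also have "\<dots> = ennreal (2 powr q * (S powr q * (C1 * C4) + 2 powr q * (S powr q * (C2 powr q * C3) + (2 * k) powr q * C4))) * J"
        using C1 C2 C3 C4 by (simp add: ennreal_mult ennreal_plus distrib_right mult.assoc del: powr_mult)
      also have "\<dots> \<le> ennreal (C * (S + k) powr q) * J"
      proof (intro mult_right_mono ennreal_leI)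
        have *: "S powr q \<le> (S + k) powr q" "k powr q \<le> (S + k) powr q"
          using S k q by (auto intro: powr_mono2)
        have "2 powr q * (S powr q * (C1 * C4) + 2 powr q * (S powr q * (C2 powr q * C3) + (2 * k) powr q * C4))
          = 2 powr q * (S powr q * (C1 * C4) + 2 powr q * (S powr q * (C2 powr q * C3) + k powr q * (2 powr q * C4)))"
          using k by (simp add: powr_mult mult_ac)
        also have "\<dots> \<le> 2 powr q * ((S + k) powr q * (C1 * C4) + 2 powr q * ((S + k) powr q * (C2 powr q * C3) + (S + k) powr q * (2 powr q * C4)))"
          using * C1 C2 C3 C4 by (intro mult_left_mono add_mono mult_right_mono) auto
        also have "\<dots> = C * (S + k) powr q" by (simp add: C_def algebra_simps)
        finally show "2 powr q * (S powr q * (C1 * C4) + 2 powr q * (S powr q * (C2 powr q * C3) + (2 * k) powr q * C4)) \<le> C * (S + k) powr q" .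
      qed simp
      finally have main: "(\<integral>\<^sup>+x. ennreal_powr (e2ennreal \<bar>commutator b A \<beta> f x\<bar>) q \<partial>gauss) \<le> ennreal (C * (S + k) powr q) * J" .
      have "Lp_norm q (commutator b A \<beta> f) \<le> ennreal_powr (ennreal (C * (S + k) powr q) * J) (1 / q)"
        unfolding Lp_norm_def using q by (intro ennreal_powr_mono main) auto
      also have "\<dots> = ennreal ((C * (S + k) powr q) powr (1 / q)) * ennreal_powr (\<integral>\<^sup>+x. ennreal (\<bar>f x\<bar> powr p) \<partial>gauss) (1 / p)"
        unfolding ennreal_powr_mult using C q by (simp add: ennreal_powr_ennreal J_def ennreal_powr_powr)
      also have "(C * (S + k) powr q) powr (1 / q) = C powr (1 / q) * (S + k)"
        using C S k q by (simp add: powr_mult powr_powr)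
      finally show "Lp_norm q (commutator b A \<beta> f) \<le> ennreal (C powr (1 / q) * (S + k)) * Lp_norm p (\<lambda>x. ereal (f x))"
        by (simp add: Lp_norm_ereal)
    qed
  qed
qed

section \<open>Translation of seminorm and essential bounds into pointwise form\<close>

lemma bmo_seminorm_le_iff:
  fixes b :: "'a::euclidean_space \<Rightarrow> real"
  assumes "integrable gauss b" "0 \<le> S"
  shows "bmo_seminorm b \<le> ennreal S \<longleftrightarrow> bmo_le 1 S b"
proof -
  have *: "(\<integral>\<^sup>+x\<in>ball c r. ennreal \<bar>b x - ball_avg b (ball c r)\<bar> \<partial>gauss) / emeasure gauss (ball c r) \<le> ennreal S \<longleftrightarrow>
      deviation b (ball_avg b (ball c r)) c r \<le> S * measure gauss (ball c r)" if "admissible 1 c r" for c r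
  proof -
    have "0 < measure gauss (ball c r)" using that by (intro measure_gauss_ball_pos) (simp add: admissible_def)
    then show ?thesis
      unfolding nn_integral_deviation[OF assms(1)] emeasure_gauss_ball_eq
      using assms(2) by (simp add: ennreal_divide_le_iff ennreal_le_iff flip: ennreal_mult)
  qed
  have "bmo_seminorm b \<le> ennreal S \<longleftrightarrow> (\<forall>c r. admissible 1 c r \<longrightarrow>
      (\<integral>\<^sup>+x\<in>ball c r. ennreal \<bar>b x - ball_avg b (ball c r)\<bar> \<partial>gauss) / emeasure gauss (ball c r) \<le> ennreal S)"
    unfolding bmo_seminorm_def SUP_le_iff admissible_balls_eq by blast
  then show ?thesis using * assms(1) by (simp add: bmo_le_def)
qed

text \<open>Admissible balls through \<open>x\<close> lie in \<open>ball x (2 * A)\<close>, so the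
  power \<beta> of their measures, which is what remains of the fractional average of a bounded
  function, is bounded. This rules out \<open>\<infinity> - \<infinity>\<close> in the
  commutator.\<close>

lemma frac_max_less_top:
  fixes f :: "'a::euclidean_space \<Rightarrow> real"
  assumes "0 \<le> \<beta>" "0 \<le> k" "AE y in gauss. \<bar>f y\<bar> \<le> k"
  shows "frac_max A \<beta> f x < \<infinity>"
proof -
  let ?R = "measure gauss (ball x (2 * A))"
  have "frac_max A \<beta> f x \<le> ennreal (k * ?R powr \<beta>)"
    unfolding frac_max_le_iff
  proof (intro allI impI, elim conjE)
    fix c :: 'a and r assume adm: "admissible A c r" and x: "x \<in> ball c r"
    let ?g = "measure gauss (ball c r)"
    have g: "0 < ?g" using adm by (intro measure_gauss_ball_pos) (simp add: admissible_def)
    have "ball c r \<subseteq> ball x (2 * A)"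
    proof
      fix y assume "y \<in> ball c r"
      then show "y \<in> ball x (2 * A)"
        using x admissibleD(3)[OF adm] dist_triangle[of x y c] by (simp add: dist_commute)
    qed
    then have "emeasure gauss (ball c r) \<le> emeasure gauss (ball x (2 * A))" by (intro emeasure_mono) auto
    then have gR: "?g \<le> ?R" by (simp add: emeasure_gauss_ball_eq ennreal_le_iff)
    have "ball_integral f c r \<le> (\<integral>\<^sup>+y. ennreal k * indicator (ball c r) y \<partial>gauss)"
      using assms(3) by (intro nn_integral_mono_AE, eventually_elim) (auto split: split_indicator intro: ennreal_leI)
    also have "\<dots> = ennreal (k * (?g powr \<beta> * ?g powr (1 - \<beta>)))"
      using g assms(2) by (simp add: nn_integral_cmult_indicator emeasure_gauss_ball_eq ennreal_mult flip: powr_add)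
    also have "\<dots> \<le> ennreal (k * (?R powr \<beta> * ?g powr (1 - \<beta>)))"
      using gR g assms by (intro ennreal_leI mult_left_mono mult_right_mono powr_mono2) auto
    also have "\<dots> = ennreal (k * ?R powr \<beta>) * ennreal (?g powr (1 - \<beta>))"
      using assms(2) by (simp add: mult.assoc flip: ennreal_mult)
    finally show "ball_integral f c r \<le> ennreal (k * ?R powr \<beta>) * ennreal (?g powr (1 - \<beta>))" .
  qed
  also have "\<dots> < \<infinity>" by simp
  finally show ?thesis .
qed

lemma Linf_AE_bound:
  assumes "f \<in> Linf"
  shows "f \<in> borel_measurable gauss" "AE x in gauss. \<bar>f x\<bar> \<le> enn2real (Linf_norm f)"
    "Linf_norm f = ennreal (enn2real (Linf_norm f))"
proof -
  show "f \<in> borel_measurable gauss" using assms by (simp add: Linf_def)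
  show eq: "Linf_norm f = ennreal (enn2real (Linf_norm f))" using assms by (simp add: Linf_def)
  have "AE x in gauss. ennreal \<bar>f x\<bar> \<le> Linf_norm f" unfolding Linf_norm_def by (rule esssup_AE)
  then show "AE x in gauss. \<bar>f x\<bar> \<le> enn2real (Linf_norm f)"
    by eventually_elim (subst (asm) eq, simp add: ennreal_le_iff)
qed

text \<open>Upper bound: the measure of an intersection of two balls is at most the product of their
  measures to the powers \<beta> and 1 - \<beta>. It is attained by the ball itself, which is
  admissible with the same parameter.\<close>

lemma frac_max_scaled_ball:
  fixes c :: "'a::euclidean_space"
  assumes adm: "admissible A c r" and x: "x \<in> ball c r" and "0 \<le> t" "0 < \<beta>" "\<beta> < 1"
  shows "frac_max A \<beta> (\<lambda>y. t * indicator (ball c r) y) x = ennreal (t * measure gauss (ball c r) powr \<beta>)"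
proof (rule antisym)
  let ?f = "\<lambda>y. t * indicator (ball c r) y" and ?g = "measure gauss (ball c r)"
  have g: "0 < ?g" using adm by (intro measure_gauss_ball_pos) (simp add: admissible_def)
  have int: "ball_integral ?f c' r' = ennreal t * emeasure gauss (ball c r \<inter> ball c' r')" for c' :: 'a and r'
  proof -
    have "ball_integral ?f c' r' = (\<integral>\<^sup>+y. ennreal t * indicator (ball c r \<inter> ball c' r') y \<partial>gauss)"
      using assms(3) by (intro nn_integral_cong) (auto split: split_indicator)
    then show ?thesis by (simp add: nn_integral_cmult_indicator)
  qed
  show "frac_max A \<beta> ?f x \<le> ennreal (t * ?g powr \<beta>)"
    unfolding frac_max_le_iff
  proof (intro allI impI)
    fix c' :: 'a and r'
    let ?I = "ball c r \<inter> ball c' r'"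
    have fin: "emeasure gauss ?I < \<infinity>"
      by (intro emeasure_gauss_finite_bounded) (auto intro: bounded_subset[OF bounded_ball])
    then have eI: "emeasure gauss ?I = ennreal (measure gauss ?I)" by (intro emeasure_eq_ennreal_measure) auto
    have "emeasure gauss ?I \<le> emeasure gauss (ball c r)" "emeasure gauss ?I \<le> emeasure gauss (ball c' r')"
      by (intro emeasure_mono; auto)+
    then have le: "measure gauss ?I \<le> ?g" "measure gauss ?I \<le> measure gauss (ball c' r')"
      unfolding eI emeasure_gauss_ball_eq by (simp_all add: ennreal_le_iff)
    have "measure gauss ?I = measure gauss ?I powr (\<beta> + (1 - \<beta>))" by simp
    also have "\<dots> = measure gauss ?I powr \<beta> * measure gauss ?I powr (1 - \<beta>)" by (rule powr_add)
    also have "\<dots> \<le> ?g powr \<beta> * measure gauss (ball c' r') powr (1 - \<beta>)"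
      using le assms by (intro mult_mono powr_mono2) auto
    finally have "t * measure gauss ?I \<le> t * ?g powr \<beta> * measure gauss (ball c' r') powr (1 - \<beta>)"
      using assms(3) by (simp add: mult_left_mono mult.assoc)
    then show "ball_integral ?f c' r' \<le> ennreal (t * ?g powr \<beta>) * ennreal (measure gauss (ball c' r') powr (1 - \<beta>))"
      unfolding int eI using assms(3) by (simp add: ennreal_leI flip: ennreal_mult)
  qed
  have "ennreal (t * ?g powr \<beta>) * ennreal (?g powr (1 - \<beta>)) = ennreal (t * (?g powr \<beta> * ?g powr (1 - \<beta>)))"
    using assms(3) by (simp add: mult.assoc flip: ennreal_mult)
  also have "?g powr \<beta> * ?g powr (1 - \<beta>) = ?g" using g by (simp flip: powr_add)
  also have "ennreal (t * ?g) = ball_integral ?f c r"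
    unfolding int using assms(3) by (simp add: emeasure_gauss_ball_eq ennreal_mult)
  also have "\<dots> \<le> frac_max A \<beta> ?f x * ennreal (?g powr (1 - \<beta>))"
    by (rule ball_integral_le_frac_max[OF adm x])
  finally have "ennreal (t * ?g powr \<beta>) * ennreal (?g powr (1 - \<beta>)) \<le> frac_max A \<beta> ?f x * ennreal (?g powr (1 - \<beta>))" .
  moreover have "ennreal (?g powr (1 - \<beta>)) \<noteq> 0" "ennreal (?g powr (1 - \<beta>)) \<noteq> top" using g by auto
  ultimately show "ennreal (t * ?g powr \<beta>) \<le> frac_max A \<beta> ?f x"
    by (simp add: ennreal_mult_le_mult_iff mult.commute[of _ "ennreal (?g powr (1 - \<beta>))"])
qed

text \<open>Testing the commutator on the normalised indicator of the ball: there the maximal function of the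
  indicator is constant, while that of \<open>b\<close> times the indicator dominates the mean of \<open>\<bar>b\<bar>\<close>.\<close>

lemma commutator_test_ball:
  fixes b :: "'a::euclidean_space \<Rightarrow> real"
  assumes b: "integrable gauss b" and adm: "admissible A c r"
    and p: "0 < \<beta>" "\<beta> < 1" "1 < p" "p < q" "1 / q = 1 / p - \<beta>"
    and N: "commutator_opnorm b A \<beta> p q \<le> ennreal N" "0 \<le> N"
  shows "(\<integral>\<^sup>+x\<in>ball c r. ennreal (max 0 (ball_avg (\<lambda>y. \<bar>b y\<bar>) (ball c r) - b x)) \<partial>gauss)
    \<le> ennreal (2 * N) * emeasure gauss (ball c r)"
proof -
  let ?B = "ball c r"
  let ?g = "measure gauss ?B" and ?k = "ball_avg (\<lambda>y. \<bar>b y\<bar>) ?B"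
  have r: "0 < r" using adm by (simp add: admissible_def)
  have g: "0 < ?g" by (rule measure_gauss_ball_pos[OF r])
  have q: "1 < q" using p by simp
  have bm [measurable]: "b \<in> borel_measurable gauss" using b by simp
  \<comment> \<open>Makes the norm of the test function in \<open>L^p\<close> equal to 1, as the
    definition of the operator norm demands. Its maximal function on the ball then takes the value
    \<open>?g powr (- (1 / q))\<close>.\<close>
  define t where "t = ?g powr (- (1 / p))"
  have t: "0 < t" using g by (simp add: t_def)
  have tq: "t * ?g powr \<beta> = ?g powr (- (1 / q))" using g p(5) by (simp add: t_def flip: powr_add)
  define f where "f y = t * indicator ?B y" for y
  have fm [measurable]: "f \<in> borel_measurable gauss" unfolding f_def by measurable
  have "Linf_norm f \<le> ennreal t"
    unfolding Linf_norm_def using t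
    by (intro esssup_I) (auto simp: f_def abs_mult intro!: AE_I2 ennreal_leI split: split_indicator)
  then have fLinf: "f \<in> Linf" using fm by (auto simp: Linf_def intro: order.strict_trans1)
  have "AE x in gauss. x \<notin> cball c r \<longrightarrow> f x = 0" by (auto simp: f_def)
  with fLinf have fL: "f \<in> Linf_c"
    unfolding Linf_c_def mem_Collect_eq by (intro conjI exI[of _ "cball c r"] compact_cball)
  have "(\<integral>\<^sup>+x. ennreal (\<bar>f x\<bar> powr p) \<partial>gauss) = (\<integral>\<^sup>+x. ennreal (t powr p) * indicator ?B x \<partial>gauss)"
    using t by (intro nn_integral_cong) (auto simp: f_def split: split_indicator)
  also have "\<dots> = ennreal (t powr p * ?g)"
    by (simp add: nn_integral_cmult_indicator emeasure_gauss_ball_eq ennreal_mult)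
  also have "t powr p * ?g = 1"
  proof -
    have "t powr p = ?g powr (- 1)" using p by (simp add: t_def powr_powr)
    then show ?thesis using g by (simp add: powr_minus)
  qed
  finally have norm1: "Lp_norm p (\<lambda>x. ereal (f x)) = 1" by (simp add: Lp_norm_ereal)
  have "Lp_norm q (commutator b A \<beta> f) \<le> commutator_opnorm b A \<beta> p q"
    unfolding commutator_opnorm_def using fL norm1 by (intro SUP_upper) auto
  then have "Lp_norm q (commutator b A \<beta> f) \<le> ennreal N" using N(1) by (rule order_trans)
  then have Lq: "(\<integral>\<^sup>+x. ennreal_powr (e2ennreal \<bar>commutator b A \<beta> f x\<bar>) q \<partial>gauss) \<le> ennreal (N powr q)"
    using ennreal_powr_le_iff[of "1 / q" _ "ennreal N"] q N(2)
    by (simp add: Lp_norm_def ennreal_powr_ennreal)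
  \<comment> \<open>The reference value is the mean of \<open>\<bar>b\<bar>\<close>, not of
    \<open>b\<close>, because the maximal function of \<open>b * f\<close> depends on
    \<open>b\<close> only through its absolute value.\<close>
  define u where "u x = max 0 (?k - b x) * indicator ?B x" for x
  have um [measurable]: "u \<in> borel_measurable gauss" unfolding u_def by measurable
  have dev: "?k * ?g = deviation b 0 c r"
    using g by (simp add: ball_avg_def deviation_def)
  have k0: "0 \<le> ?k" using dev deviation_nonneg[of b 0 c r] g by (metis mult.commute zero_le_mult_iff not_less)
  have lower: "ennreal (?g powr (- (1 / q)) * u x) \<le> e2ennreal \<bar>commutator b A \<beta> f x\<bar>" for x
  proof (cases "x \<in> ?B")
    case x: True
    let ?t = "?g powr (- (1 / q))"
    have F: "frac_max A \<beta> f x = ennreal ?t"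
      unfolding f_def using frac_max_scaled_ball[OF adm x, of t \<beta>] t p by (simp add: tq)
    let ?m = "frac_max A \<beta> (\<lambda>y. b y * f y) x"
    have "ennreal (?t * ?k) * ennreal (?g powr (1 - \<beta>)) = ennreal (?t * ?k * ?g powr (1 - \<beta>))"
      using k0 by (simp add: ennreal_mult)
    also have "?t * ?k * ?g powr (1 - \<beta>) = t * (?g powr \<beta> * ?g powr (1 - \<beta>)) * ?k"
      unfolding tq [symmetric] by (simp only: mult_ac)
    also have "?g powr \<beta> * ?g powr (1 - \<beta>) = ?g" using g by (simp flip: powr_add)
    also have "ennreal (t * ?g * ?k) = ennreal t * ennreal (deviation b 0 c r)"
      using t k0 g by (simp add: mult_ac ennreal_mult flip: dev)
    also have "\<dots> = (\<integral>\<^sup>+y. ennreal t * (ennreal \<bar>b y - 0\<bar> * indicator ?B y) \<partial>gauss)"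
      unfolding nn_integral_deviation[OF b, symmetric] by (rule nn_integral_cmult [symmetric]) measurable
    also have "\<dots> = ball_integral (\<lambda>y. b y * f y) c r"
      using t by (intro nn_integral_cong) (auto simp: f_def abs_mult mult.commute ennreal_mult split: split_indicator)
    also have "\<dots> \<le> ?m * ennreal (?g powr (1 - \<beta>))"
      by (rule ball_integral_le_frac_max[OF adm x])
    finally have "ennreal (?t * ?k) * ennreal (?g powr (1 - \<beta>)) \<le> ?m * ennreal (?g powr (1 - \<beta>))" .
    moreover have "ennreal (?g powr (1 - \<beta>)) \<noteq> 0" "ennreal (?g powr (1 - \<beta>)) \<noteq> top" using g by auto
    ultimately have m: "ennreal (?t * ?k) \<le> ?m"
      by (simp add: ennreal_mult_le_mult_iff mult.commute[of _ "ennreal (?g powr (1 - \<beta>))"])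
    show ?thesis
    proof (cases ?m)
      case (real m')
      then have tk: "?t * ?k \<le> m'" using m by (simp add: ennreal_le_iff)
      have "commutator b A \<beta> f x = ereal (b x * ?t - m')"
        using F real g by (simp add: commutator_def enn2ereal_ennreal)
      moreover have "?t * u x \<le> \<bar>b x * ?t - m'\<bar>"
      proof -
        have "?t * (?k - b x) \<le> m' - b x * ?t" using tk by (simp add: algebra_simps)
        then show ?thesis using x by (auto simp: u_def max_def)
      qed
      ultimately show ?thesis by (simp add: ennreal_leI)
    next
      \<comment> \<open>The commutator is \<open>-\<infinity>\<close> here, so its absolute value
        dominates anything.\<close>
      case top
      then have "commutator b A \<beta> f x = - \<infinity>"
        using F g by (simp add: commutator_def enn2ereal_ennreal)
      then show ?thesis by simp
    qed
  qed (simp add: u_def)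
  \<comment> \<open>Raised to the power \<open>q\<close>, the constant
    \<open>?g powr (- (1 / q))\<close> becomes the normalising factor of an average: the mean of
    \<open>u powr q\<close> on the ball is at most \<open>N powr q\<close>. Hoelder then gives a
    mean of \<open>u\<close> of at most \<open>2 * N\<close>.\<close>
  have "ennreal (1 / ?g) * (\<integral>\<^sup>+x. ennreal (\<bar>u x\<bar> powr q) \<partial>gauss) =
      (\<integral>\<^sup>+x. ennreal (1 / ?g) * ennreal (\<bar>u x\<bar> powr q) \<partial>gauss)"
    by (rule nn_integral_cmult [symmetric]) measurable
  also have "\<dots> \<le> (\<integral>\<^sup>+x. ennreal_powr (e2ennreal \<bar>commutator b A \<beta> f x\<bar>) q \<partial>gauss)"
  proof (intro nn_integral_mono)
    fix x
    have u0: "0 \<le> u x" by (simp add: u_def)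
    have "ennreal (1 / ?g) * ennreal (\<bar>u x\<bar> powr q) = ennreal_powr (ennreal (?g powr (- (1 / q)) * u x)) q"
    proof -
      have "(?g powr (- (1 / q)) * u x) powr q = (?g powr (- (1 / q))) powr q * u x powr q"
        using u0 by (simp only: powr_mult)
      also have "(?g powr (- (1 / q))) powr q = ?g powr (- 1)" using q by (simp add: powr_powr)
      also have "\<dots> = 1 / ?g" using g by (simp add: powr_minus_divide)
      finally show ?thesis using u0 g by (simp only: ennreal_powr_ennreal mult_nonneg_nonneg powr_ge_zero abs_of_nonneg) (simp flip: ennreal_mult)
    qed
    also have "\<dots> \<le> ennreal_powr (e2ennreal \<bar>commutator b A \<beta> f x\<bar>) q"
      using q by (intro ennreal_powr_mono lower) auto
    finally show "ennreal (1 / ?g) * ennreal (\<bar>u x\<bar> powr q) \<le> ennreal_powr (e2ennreal \<bar>commutator b A \<beta> f x\<bar>) q" .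
  qed
  also have "\<dots> \<le> ennreal (N powr q)" by (rule Lq)
  also have "\<dots> = ennreal (1 / ?g * (?g * N powr q)) * 1" using g by simp
  finally have "ennreal (1 / ?g) * (\<integral>\<^sup>+x. ennreal (\<bar>u x\<bar> powr q) \<partial>gauss) \<le> ennreal (1 / ?g * (?g * N powr q)) * 1" .
  then have uq: "(\<integral>\<^sup>+x. ennreal (\<bar>u x\<bar> powr q) \<partial>gauss) \<le> ennreal (?g * N powr q) * 1"
    by (rule ennreal_mult_le_cancel[rotated]) (use g in simp)
  have "(\<integral>\<^sup>+x\<in>?B. ennreal (max 0 (?k - b x)) \<partial>gauss) = ball_integral u c r"
    by (intro nn_integral_cong) (auto simp: u_def split: split_indicator)
  also have "\<dots> \<le> ennreal (2 * ?g powr (1 - 1 / q)) * ennreal_powr (\<integral>\<^sup>+x. ennreal (\<bar>u x\<bar> powr q) \<partial>gauss) (1 / q)"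
    by (rule ball_integral_le_powr[OF um q])
  also have "\<dots> \<le> ennreal (2 * ?g powr (1 - 1 / q)) * ennreal_powr (ennreal (?g * N powr q)) (1 / q)"
    using uq q by (intro mult_left_mono ennreal_powr_mono) auto
  also have "\<dots> = ennreal (2 * ?g powr (1 - 1 / q) * (?g * N powr q) powr (1 / q))"
    by (subst ennreal_powr_ennreal) (simp_all add: ennreal_mult)
  also have "2 * ?g powr (1 - 1 / q) * (?g * N powr q) powr (1 / q) = 2 * N * (?g powr (1 - 1 / q) * ?g powr (1 / q))"
    using g N q by (simp add: powr_mult powr_powr)
  also have "?g powr (1 - 1 / q) * ?g powr (1 / q) = ?g" using g by (simp flip: powr_add)
  finally show ?thesis using N(2) by (simp add: emeasure_gauss_ball_eq ennreal_mult)
qed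

text \<open>Both conclusions come from the one-sided estimate of the test. The mean of
  \<open>\<bar>b\<bar>\<close> exceeds the mean of \<open>b\<close> by twice the mean of the
  negative part, which bounds the latter on every ball and, by differentiation, almost everywhere;
  and an integral of \<open>b\<close> minus its own average vanishes, so one-sided control is
  two-sided.\<close>

lemma commutator_bounded_imp:
  fixes b :: "'a::euclidean_space \<Rightarrow> real"
  assumes b: "integrable gauss b" and A: "0 < A"
    and p: "0 < \<beta>" "\<beta> < 1" "1 < p" "p < q" "1 / q = 1 / p - \<beta>"
    and N: "commutator_opnorm b A \<beta> p q \<le> ennreal N" "0 \<le> N"
  shows "bmo_le A (4 * N) b" "AE x in gauss. neg_part b x \<le> N"
proof -
  have bm [measurable]: "b \<in> borel_measurable gauss" using b by simp
  have key: "deviation b (ball_avg b (ball c r)) c r \<le> 4 * N * measure gauss (ball c r)"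
    "(\<integral>\<^sup>+x\<in>ball c r. ennreal (neg_part b x) \<partial>gauss) \<le> ennreal N * emeasure gauss (ball c r)"
    if adm: "admissible A c r" for c r
  proof -
    let ?B = "ball c r"
    let ?g = "measure gauss ?B" and ?k = "ball_avg (\<lambda>y. \<bar>b y\<bar>) ?B" and ?l = "ball_avg b ?B"
    have r: "0 < r" using adm by (simp add: admissible_def)
    have g: "0 < ?g" by (rule measure_gauss_ball_pos[OF r])
    note ib = set_integrable_gauss_ball[OF b, of c r] and ic = set_integrable_gauss_ball_const[of c r]
    have ia: "set_integrable gauss ?B (\<lambda>x. \<bar>b x\<bar>)" by (rule set_integrable_abs[OF ib])
    have ikb: "set_integrable gauss ?B (\<lambda>x. k - b x)" for k by (rule set_integral_diff(1)[OF ic ib])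
    have lkb: "(LINT x:?B|gauss. k - b x) = k * ?g - ?l * ?g" for k
    proof -
      have "(LINT x:?B|gauss. k - b x) = (LINT x:?B|gauss. k) - (LINT x:?B|gauss. b x)"
        by (rule set_integral_diff(2)[OF ic ib])
      then show ?thesis using g by (simp add: ball_avg_def set_lebesgue_integral_def)
    qed
    have lk: "?l \<le> ?k"
    proof -
      have "(LINT x:?B|gauss. b x) \<le> (LINT x:?B|gauss. \<bar>b x\<bar>)" by (rule set_integral_mono[OF ib ia]) auto
      then show ?thesis using g by (simp add: ball_avg_def divide_right_mono)
    qed
    have ip: "set_integrable gauss ?B (\<lambda>x. max 0 (?k - b x))"
    proof -
      have "set_integrable gauss ?B (\<lambda>x. (\<bar>?k - b x\<bar> + (?k - b x)) / 2)"
        by (intro set_integrable_divide set_integral_add(1) set_integrable_abs ikb)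
      moreover have "(\<lambda>x. (\<bar>?k - b x\<bar> + (?k - b x)) / 2) = (\<lambda>x. max 0 (?k - b x))"
        by (auto simp: fun_eq_iff max_def)
      ultimately show ?thesis by simp
    qed
    define P where "P = (LINT x:?B|gauss. max 0 (?k - b x))"
    have P0: "0 \<le> P" unfolding P_def set_lebesgue_integral_def by (intro integral_nonneg_AE) auto
    have "ennreal P = (\<integral>\<^sup>+x. ennreal (indicator ?B x *\<^sub>R max 0 (?k - b x)) \<partial>gauss)"
      unfolding P_def set_lebesgue_integral_def
      using ip by (intro nn_integral_eq_integral [symmetric]) (auto simp: set_integrable_def)
    also have "\<dots> = (\<integral>\<^sup>+x\<in>?B. ennreal (max 0 (?k - b x)) \<partial>gauss)"
      by (intro nn_integral_cong) (auto split: split_indicator)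
    also have "\<dots> \<le> ennreal (2 * N) * emeasure gauss ?B"
      by (rule commutator_test_ball[OF b adm p N])
    finally have P: "P \<le> 2 * N * ?g"
      using N(2) by (simp add: emeasure_gauss_ball_eq ennreal_le_iff flip: ennreal_mult)
    \<comment> \<open>Absolute value as twice the positive part minus the number itself, applied to
      \<open>?l - b x\<close>; the positive part grows when \<open>?l\<close> is replaced by
      \<open>?k\<close>, and \<open>?l - b x\<close> integrates to zero.\<close>
    have "deviation b ?l c r \<le> (LINT x:?B|gauss. 2 * max 0 (?k - b x) - (?l - b x))"
      unfolding deviation_def
    proof (rule set_integral_mono)
      show "set_integrable gauss ?B (\<lambda>x. \<bar>b x - ?l\<bar>)" by (rule set_integrable_deviation[OF b])
      show "set_integrable gauss ?B (\<lambda>x. 2 * max 0 (?k - b x) - (?l - b x))"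
        by (intro set_integral_diff(1) set_integrable_mult_right ip ikb)
    qed (use lk in \<open>auto simp: max_def abs_if\<close>)
    also have "\<dots> = (LINT x:?B|gauss. 2 * max 0 (?k - b x)) - (LINT x:?B|gauss. ?l - b x)"
      by (rule set_integral_diff(2)) (intro set_integrable_mult_right ip ikb)+
    also have "\<dots> = 2 * P" by (simp add: lkb P_def)
    finally show "deviation b ?l c r \<le> 4 * N * ?g" using P by simp
    \<comment> \<open>The left-hand side is twice the integral of the negative part over the
      ball.\<close>
    have "?k * ?g - ?l * ?g \<le> P"
      unfolding P_def lkb [symmetric] by (rule set_integral_mono[OF ikb ip]) auto
    then have kl: "?k * ?g - ?l * ?g \<le> 2 * N * ?g" using P by linarith
    have ik: "?k * ?g = (LINT x:?B|gauss. \<bar>b x\<bar>)" "?l * ?g = (LINT x:?B|gauss. b x)"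
      using g by (simp_all add: ball_avg_def)
    have npe: "neg_part b x = (\<bar>b x\<bar> - b x) / 2" for x by (auto simp: neg_part_def min_def)
    have "(\<integral>\<^sup>+x\<in>?B. ennreal (neg_part b x) \<partial>gauss) = (\<integral>\<^sup>+x. ennreal (indicator ?B x *\<^sub>R ((\<bar>b x\<bar> - b x) / 2)) \<partial>gauss)"
      unfolding npe by (intro nn_integral_cong) (auto split: split_indicator)
    also have "\<dots> = ennreal (LINT x:?B|gauss. (\<bar>b x\<bar> - b x) / 2)"
    proof -
      have "set_integrable gauss ?B (\<lambda>x. (\<bar>b x\<bar> - b x) / 2)"
        by (intro set_integrable_divide set_integral_diff(1) ia ib)
      then show ?thesis
        unfolding set_lebesgue_integral_def
        by (intro nn_integral_eq_integral) (auto simp: set_integrable_def)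
    qed
    also have "(LINT x:?B|gauss. (\<bar>b x\<bar> - b x) / 2) = ((LINT x:?B|gauss. \<bar>b x\<bar>) - (LINT x:?B|gauss. b x)) / 2"
      using set_integral_diff(2)[OF ia ib] by simp
    also have "ennreal \<dots> \<le> ennreal (N * ?g)" using kl unfolding ik by (intro ennreal_leI) simp
    also have "\<dots> = ennreal N * emeasure gauss ?B" using N(2) by (simp add: emeasure_gauss_ball_eq ennreal_mult)
    finally show "(\<integral>\<^sup>+x\<in>?B. ennreal (neg_part b x) \<partial>gauss) \<le> ennreal N * emeasure gauss ?B" .
  qed
  show "bmo_le A (4 * N) b" unfolding bmo_le_def using b key(1) by simp
  have "AE x in gauss. x \<in> UNIV \<longrightarrow> neg_part b x \<le> N"
  proof (rule AE_le_if_ball_averages_le)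
    show "neg_part b \<in> borel_measurable gauss" unfolding neg_part_def by measurable
    fix x :: 'a
    \<comment> \<open>The witness is the largest admissible radius at \<open>x\<close>; all smaller
      balls about \<open>x\<close> are admissible.\<close>
    show "\<exists>\<delta>>0. \<forall>t. 0 < t \<and> t < \<delta> \<longrightarrow>
        (\<integral>\<^sup>+y\<in>ball x t. ennreal (neg_part b y) \<partial>gauss) \<le> ennreal N * emeasure gauss (ball x t)"
    proof (intro exI[of _ "A / max 1 (norm x)"] conjI allI impI key(2))
      show pos: "0 < A / max 1 (norm x)" using A by simp
      fix t assume t: "0 < t \<and> t < A / max 1 (norm x)"
      then show "admissible A x t" by (simp add: admissible_def pos_less_divide_eq less_imp_le)
    qed
  qed (use N in auto)
  then show "AE x in gauss. neg_part b x \<le> N" by simp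
qed

theorem theorem1p3:
  fixes a \<beta> p q :: real
  assumes "0 < a" and "0 < \<beta>" and "\<beta> < 1" and "1 < p" and "p < q" and "1 / q = 1 / p - \<beta>"
  shows "\<exists>C::real. 0 < C \<and> (\<forall>b :: real ^ 'n \<Rightarrow> real.
     (b \<in> BMO \<and> neg_part b \<in> Linf \<longrightarrow>
        (\<forall>f\<in>Linf_c. Lp_norm q (commutator b a \<beta> f)
           \<le> ennreal C * (bmo_seminorm b + Linf_norm (neg_part b)) * Lp_norm p (\<lambda>x. ereal (f x))))
     \<and>
     (integrable gauss b \<and> commutator_bounded b a \<beta> p q \<longrightarrow>
        b \<in> BMO \<and> neg_part b \<in> Linf \<and>
        bmo_norm b + Linf_norm (neg_part b)
          \<le> Lp_norm 1 (\<lambda>x. ereal (b x)) + ennreal C * commutator_opnorm b a \<beta> p q))"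
proof (rule commutator_bound[where 'a="real ^ 'n", OF assms(1,4,5,6)])
  fix C1 :: real
  assume C1: "0 < C1" and upper: "\<And>(b :: real ^ 'n \<Rightarrow> real) S k f.
     bmo_le 1 S b \<Longrightarrow> 0 \<le> S \<Longrightarrow> 0 \<le> k \<Longrightarrow> (AE x in gauss. neg_part b x \<le> k) \<Longrightarrow>
     f \<in> borel_measurable gauss \<Longrightarrow> (\<And>x. frac_max a \<beta> f x < \<infinity>) \<Longrightarrow>
     Lp_norm q (commutator b a \<beta> f) \<le> ennreal (C1 * (S + k)) * Lp_norm p (\<lambda>x. ereal (f x))"
  obtain E where E: "0 < E" and enl: "\<And>(b :: real ^ 'n \<Rightarrow> real) S. 0 \<le> S \<Longrightarrow> bmo_le a S b \<Longrightarrow> bmo_le 1 (E * S) b"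
    using bmo_le_enlarge[where 'a="real ^ 'n", OF assms(1) zero_less_one] by metis
  \<comment> \<open>The same constant serves both parts: \<open>C1\<close> for (i); in (ii),
    \<open>4 * E\<close> is for the oscillation bound \<open>4 * N\<close> after passing from
    parameter \<open>a\<close> to \<open>1\<close>, and 1 for the negative part.\<close>
  define C where "C = C1 + (4 * E + 1)"
  have C: "0 < C" "C1 \<le> C" "4 * E + 1 \<le> C" using C1 E by (auto simp: C_def)
  have i: "Lp_norm q (commutator b a \<beta> f)
      \<le> ennreal C * (bmo_seminorm b + Linf_norm (neg_part b)) * Lp_norm p (\<lambda>x. ereal (f x))"
    if b: "b \<in> BMO" "neg_part b \<in> Linf" and f: "f \<in> Linf_c" for b f :: "real ^ 'n \<Rightarrow> real"
  proof -
    define S k where "S = enn2real (bmo_seminorm b)" and "k = enn2real (Linf_norm (neg_part b))"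
    have S: "0 \<le> S" "bmo_seminorm b = ennreal S" using b(1) by (auto simp: S_def BMO_def)
    have k: "0 \<le> k" "Linf_norm (neg_part b) = ennreal k" "AE x in gauss. \<bar>neg_part b x\<bar> \<le> k"
      using Linf_AE_bound[OF b(2)] by (auto simp: k_def)
    have bmo: "bmo_le 1 S b"
      using bmo_seminorm_le_iff[of b S] b(1) S by (simp add: BMO_def)
    have nb: "AE x in gauss. neg_part b x \<le> k" using k(3) by eventually_elim simp
    have fL: "f \<in> Linf" using f by (simp add: Linf_c_def)
    have fin: "frac_max a \<beta> f x < \<infinity>" for x
      using assms(2) by (intro frac_max_less_top[OF _ _ Linf_AE_bound(2)[OF fL]]) auto
    have "Lp_norm q (commutator b a \<beta> f) \<le> ennreal (C1 * (S + k)) * Lp_norm p (\<lambda>x. ereal (f x))"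
      by (rule upper[OF bmo S(1) k(1) nb Linf_AE_bound(1)[OF fL] fin])
    also have "\<dots> \<le> ennreal (C * (S + k)) * Lp_norm p (\<lambda>x. ereal (f x))"
      using C S k by (intro mult_right_mono ennreal_leI) auto
    also have "ennreal (C * (S + k)) = ennreal C * (bmo_seminorm b + Linf_norm (neg_part b))"
      using C S k by (simp add: ennreal_mult ennreal_plus)
    finally show ?thesis .
  qed
  have ii: "b \<in> BMO \<and> neg_part b \<in> Linf \<and> bmo_norm b + Linf_norm (neg_part b)
        \<le> Lp_norm 1 (\<lambda>x. ereal (b x)) + ennreal C * commutator_opnorm b a \<beta> p q"
    if b: "integrable gauss b" and bd: "commutator_bounded b a \<beta> p q" for b :: "real ^ 'n \<Rightarrow> real"
  proof -
    obtain C' where C': "0 \<le> C'" "\<And>f. f \<in> Linf_c \<Longrightarrow>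
        Lp_norm q (commutator b a \<beta> f) \<le> ennreal C' * Lp_norm p (\<lambda>x. ereal (f x))"
      using bd unfolding commutator_bounded_def by blast
    have "commutator_opnorm b a \<beta> p q \<le> ennreal C'"
      unfolding commutator_opnorm_def
    proof (rule SUP_least)
      fix f :: "real ^ 'n \<Rightarrow> real" assume "f \<in> {f \<in> Linf_c. Lp_norm p (\<lambda>x. ereal (f x)) = 1}"
      then show "Lp_norm q (commutator b a \<beta> f) \<le> ennreal C'" using C'(2)[of f] by simp
    qed
    \<comment> \<open>Boundedness makes the operator norm finite; from here on the norm
      \<open>N\<close> itself is used instead of the larger bound \<open>C'\<close>.\<close>
    then obtain N where N: "commutator_opnorm b a \<beta> p q = ennreal N" "0 \<le> N"
      by (cases "commutator_opnorm b a \<beta> p q") (auto simp: top_unique)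
    have low: "bmo_le a (4 * N) b" "AE x in gauss. neg_part b x \<le> N"
      using commutator_bounded_imp[OF b assms(1-6), of N] N by auto
    have "bmo_le 1 (E * (4 * N)) b" using N low(1) by (intro enl) auto
    then have semi: "bmo_seminorm b \<le> ennreal (E * (4 * N))"
      using bmo_seminorm_le_iff[OF b, of "E * (4 * N)"] N E by simp
    have nm: "neg_part b \<in> borel_measurable gauss"
      using borel_measurable_integrable[OF b] unfolding neg_part_def by measurable
    have inf: "Linf_norm (neg_part b) \<le> ennreal N"
      unfolding Linf_norm_def
    proof (rule esssup_I)
      show "AE x in gauss. ennreal \<bar>neg_part b x\<bar> \<le> ennreal N"
        using low(2) by eventually_elim (auto simp: neg_part_def intro!: ennreal_leI)
    qed (use nm in measurable)
    have "bmo_seminorm b + Linf_norm (neg_part b) \<le> ennreal (E * (4 * N)) + ennreal N"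
      by (rule add_mono[OF semi inf])
    also have "\<dots> = ennreal ((4 * E + 1) * N)"
      using N E by (simp add: algebra_simps flip: ennreal_plus)
    also have "\<dots> \<le> ennreal (C * N)" using C N by (intro ennreal_leI mult_right_mono) auto
    also have "\<dots> = ennreal C * commutator_opnorm b a \<beta> p q" using C N by (simp add: ennreal_mult)
    finally have sum: "bmo_seminorm b + Linf_norm (neg_part b) \<le> ennreal C * commutator_opnorm b a \<beta> p q" .
    have "bmo_norm b + Linf_norm (neg_part b) = Lp_norm 1 (\<lambda>x. ereal (b x)) + (bmo_seminorm b + Linf_norm (neg_part b))"
      unfolding bmo_norm_def by (simp only: ac_simps)
    also have "\<dots> \<le> Lp_norm 1 (\<lambda>x. ereal (b x)) + ennreal C * commutator_opnorm b a \<beta> p q"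
      by (rule add_left_mono[OF sum])
    finally have "bmo_norm b + Linf_norm (neg_part b)
        \<le> Lp_norm 1 (\<lambda>x. ereal (b x)) + ennreal C * commutator_opnorm b a \<beta> p q" .
    moreover have "b \<in> BMO" using b semi by (auto simp: BMO_def intro: order.strict_trans1)
    moreover have "neg_part b \<in> Linf" using nm inf by (auto simp: Linf_def intro: order.strict_trans1)
    ultimately show ?thesis by blast
  qed
  show ?thesis
    by (intro exI[of _ C] conjI allI C(1); intro impI ballI; elim conjE) (rule i ii; assumption)+
qed

end
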